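(* Let $K$ be a number field and let $\phi, \psi \in K(z)$ be rational functions of degree $d \geq 2$. Define $S_0$ to be the set of rational primes $$S_0 = \{2\} \cup \left\{p \text{ odd prime}: \tfrac{p - 1}{2} \,\Big|\, [K : \mathbb{Q}] \ \text{ and } \ p \mid d(d^2 - 1) \right\},$$ and let $S$ be the (finite) set of places of $K$ of bad reduction for $\phi$ or $\psi$ along with the places that divide a prime in $S_0$. If $\mathrm{Conj}_{\phi, \psi}(K)$ is nonempty, then $\mathrm{red}_v: \mathrm{Conj}_{\phi, \psi}(K) \to \mathrm{Conj}_{\phi, \psi}(\mathbb{F}_v)$ is a well-defined injection of sets for all finite places $v$ of $K$ outside $S$.
   Context: For a finite place $v$ of $K$, $K_v$ is the completion and $\mathbb{F}_v$ the residue field. A rational function over $K$ has good reduction at $v$ if the induced endomorphism of $\mathbb{P}^1_{K_v}$ extends to a morphism of $\mathbb{P}^1$ over the valuation ring of $K_v$ (equivalently, one can reduce its coefficients modulo $v$ and the resulting endomorphism of $\mathbb{P}^1_{\mathbb{F}_v}$ has the same degree); otherwise it has bad reduction at $v$. $\mathrm{Conj}_{\phi,\psi}(K)=\{f\in\mathrm{PGL}_2(K): f\circ\phi\circ f^{-1}=\psi\}$, and for $v$ of good reduction for both maps, $\mathrm{Conj}_{\phi,\psi}(\mathbb{F}_v)$ is the set of $f\in\mathrm{PGL}_2(\mathbb{F}_v)$ with $f\circ\phi_v\circ f^{-1}=\psi_v$, where $\phi_v,\psi_v$ are the reductions at $v$. The map $\mathrm{red}_v$ sends a conjugating map to its reduction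 modulo $v$; its being well defined includes the assertion that each element of $\mathrm{Conj}_{\phi,\psi}(K)$ has good reduction at $v$. *)

theory Defs
  imports
    Complex_Main
    "HOL-Algebra.Divisibility"
    "HOL-Algebra.QuotRing"
    "HOL-Algebra.UnivPoly"
    "HOL-Computational_Algebra.Primes"
begin

section \<open>Number fields and their finite places\<close>

text \<open>
  A number field is a type \<open>'k\<close> of class \<open>field_char_0\<close> that is finite dimensional over the
  rationals. \<open>as_ring\<close> turns it into a record, so that \<open>K\<close> and its residue fields, which depend
  on a place and hence cannot be types, share one theory of rational functions.
\<close>

definition rat_scale :: "rat \<Rightarrow> 'k::field_char_0 \<Rightarrow> 'k" where
  "rat_scale q x = of_rat q * x"

definition number_field :: "'k::field_char_0 itself \<Rightarrow> bool" where
  "number_field _ \<longleftrightarrow> (\<exists>B::'k set. finite B \<and> module.span rat_scale B = UNIV)"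

definition degree_over_rat :: "'k::field_char_0 itself \<Rightarrow> nat" where
  "degree_over_rat _ = vector_space.dim rat_scale (UNIV :: 'k set)"

definition as_ring :: "'k::field ring" where
  "as_ring = \<lparr>carrier = UNIV, mult = (*), one = 1, zero = 0, add = (+)\<rparr>"

text \<open>
  A finite place is given by its normalized (surjective) additive valuation on the nonzero
  elements of the field. The value at \<open>0\<close>, which should be infinite, is a dummy; fixing it
  makes different functions correspond to different places.
\<close>

definition finite_places :: "('k::field \<Rightarrow> int) set" where
  "finite_places = {v. v 0 = 0 \<and>
     (\<forall>x y. x \<noteq> 0 \<longrightarrow> y \<noteq> 0 \<longrightarrow> v (x * y) = v x + v y) \<and>
     (\<forall>x y. x \<noteq> 0 \<longrightarrow> y \<noteq> 0 \<longrightarrow> x + y \<noteq> 0 \<longrightarrow> min (v x) (v y) \<le> v (x + y)) \<and>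
     v ` (- {0}) = UNIV}"

definition integers_at :: "('k::field \<Rightarrow> int) \<Rightarrow> 'k set" where
  "integers_at v = {x. x = 0 \<or> 0 \<le> v x}"

definition max_ideal_at :: "('k::field \<Rightarrow> int) \<Rightarrow> 'k set" where
  "max_ideal_at v = {x. x = 0 \<or> 0 < v x}"

definition valuation_ring :: "('k::field \<Rightarrow> int) \<Rightarrow> 'k ring" where
  "valuation_ring v = as_ring\<lparr>carrier := integers_at v\<rparr>"

text \<open>
  The completion at \<open>v\<close> has the same residue field, and only elements of \<open>K\<close> have to be
  reduced, so the valuation ring is taken in \<open>K\<close> itself.
\<close>

definition residue_field :: "('k::field \<Rightarrow> int) \<Rightarrow> 'k set ring" where
  "residue_field v = valuation_ring v Quot max_ideal_at v"

definition residue :: "('k::field \<Rightarrow> int) \<Rightarrow> 'k \<Rightarrow> 'k set" where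
  "residue v x = max_ideal_at v +>\<^bsub>valuation_ring v\<^esub> x"

definition divides_prime :: "('k::field_char_0 \<Rightarrow> int) \<Rightarrow> nat \<Rightarrow> bool" where
  "divides_prime v p \<longleftrightarrow> 0 < v (of_nat p)"

section \<open>Rational functions over a field\<close>

text \<open>
  Here \<open>R\<close> is a field. An endomorphism of the projective line over \<open>R\<close> is a point of the
  projective line over \<open>R(z)\<close>, that is, a class of pairs \<open>(p, q) \<noteq> (0, 0)\<close> of polynomials with
  \<open>(p, q) \<sim> (p', q')\<close> iff \<open>p q' = p' q\<close>. The classes with \<open>q \<noteq> 0\<close> are the fractions
  \<open>p / q\<close> in \<open>R(z)\<close>; the remaining one is the constant \<open>\<infinity>\<close>.
\<close>

type_synonym 'a ratfun = "((nat \<Rightarrow> 'a) \<times> (nat \<Rightarrow> 'a)) set"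

definition fraction ::
  "('a, 'm) ring_scheme \<Rightarrow> (nat \<Rightarrow> 'a) \<Rightarrow> (nat \<Rightarrow> 'a) \<Rightarrow> 'a ratfun" where
  "fraction R p q = {(p', q'). p' \<in> carrier (UP R) \<and> q' \<in> carrier (UP R) \<and>
     (p' \<noteq> \<zero>\<^bsub>UP R\<^esub> \<or> q' \<noteq> \<zero>\<^bsub>UP R\<^esub>) \<and> p \<otimes>\<^bsub>UP R\<^esub> q' = p' \<otimes>\<^bsub>UP R\<^esub> q}"

definition rational_functions :: "('a, 'm) ring_scheme \<Rightarrow> 'a ratfun set" where
  "rational_functions R = {fraction R p q | p q.
     p \<in> carrier (UP R) \<and> q \<in> carrier (UP R) \<and> q \<noteq> \<zero>\<^bsub>UP R\<^esub>}"

definition coprime_polys ::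
  "('a, 'm) ring_scheme \<Rightarrow> (nat \<Rightarrow> 'a) \<Rightarrow> (nat \<Rightarrow> 'a) \<Rightarrow> bool" where
  "coprime_polys R p q \<longleftrightarrow> p \<in> carrier (UP R) \<and> q \<in> carrier (UP R) \<and>
     (\<forall>h \<in> carrier (UP R). h divides\<^bsub>UP R\<^esub> p \<longrightarrow> h divides\<^bsub>UP R\<^esub> q \<longrightarrow> h \<in> Units (UP R))"

text \<open>The representative in lowest terms is unique up to a nonzero scalar.\<close>

definition lowest_terms ::
  "('a, 'm) ring_scheme \<Rightarrow> 'a ratfun \<Rightarrow> (nat \<Rightarrow> 'a) \<times> (nat \<Rightarrow> 'a)" where
  "lowest_terms R \<phi> = (SOME (p, q). (p, q) \<in> \<phi> \<and> coprime_polys R p q)"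

definition ratfun_degree :: "('a, 'm) ring_scheme \<Rightarrow> 'a ratfun \<Rightarrow> nat" where
  "ratfun_degree R \<phi> = (case lowest_terms R \<phi> of (p, q) \<Rightarrow> max (deg R p) (deg R q))"

text \<open>\<open>hom_subst R n p u w = w\<^sup>n p (u / w)\<close> for polynomials \<open>p\<close> of degree at most \<open>n\<close>\<close>

definition hom_subst ::
  "('a, 'm) ring_scheme \<Rightarrow> nat \<Rightarrow> (nat \<Rightarrow> 'a) \<Rightarrow> (nat \<Rightarrow> 'a) \<Rightarrow> (nat \<Rightarrow> 'a) \<Rightarrow> (nat \<Rightarrow> 'a)" where
  "hom_subst R n p u w = (\<Oplus>\<^bsub>UP R\<^esub>i \<in> {..n}. coeff (UP R) p i \<odot>\<^bsub>UP R\<^esub>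
     (u [^]\<^bsub>UP R\<^esub> i \<otimes>\<^bsub>UP R\<^esub> w [^]\<^bsub>UP R\<^esub> (n - i)))"

definition ratfun_comp :: "('a, 'm) ring_scheme \<Rightarrow> 'a ratfun \<Rightarrow> 'a ratfun \<Rightarrow> 'a ratfun" where
  "ratfun_comp R \<phi> \<psi> =
     (let (p, q) = lowest_terms R \<phi>; (u, w) = lowest_terms R \<psi>; n = ratfun_degree R \<phi>
      in fraction R (hom_subst R n p u w) (hom_subst R n q u w))"

definition mobius ::
  "('a, 'm) ring_scheme \<Rightarrow> 'a \<Rightarrow> 'a \<Rightarrow> 'a \<Rightarrow> 'a \<Rightarrow> 'a ratfun" where
  "mobius R a b c e = fraction R
     (monom (UP R) a 1 \<oplus>\<^bsub>UP R\<^esub> monom (UP R) b 0) (monom (UP R) c 1 \<oplus>\<^bsub>UP R\<^esub> monom (UP R) e 0)"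

text \<open>
  The projective linear group in its faithful action on the projective line: an invertible
  matrix \<open>(a, b; c, e)\<close> modulo scalars is the map \<open>(a z + b) / (c z + e)\<close>.
\<close>

definition PGL2 :: "('a, 'm) ring_scheme \<Rightarrow> 'a ratfun monoid" where
  "PGL2 R = \<lparr>carrier = {mobius R a b c e | a b c e.
       a \<in> carrier R \<and> b \<in> carrier R \<and> c \<in> carrier R \<and> e \<in> carrier R \<and>
       a \<otimes>\<^bsub>R\<^esub> e \<ominus>\<^bsub>R\<^esub> b \<otimes>\<^bsub>R\<^esub> c \<noteq> \<zero>\<^bsub>R\<^esub>},
     mult = ratfun_comp R,
     one = mobius R \<one>\<^bsub>R\<^esub> \<zero>\<^bsub>R\<^esub> \<zero>\<^bsub>R\<^esub> \<one>\<^bsub>R\<^esub>\<rparr>"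

definition Conj :: "('a, 'm) ring_scheme \<Rightarrow> 'a ratfun \<Rightarrow> 'a ratfun \<Rightarrow> 'a ratfun set" where
  "Conj R \<phi> \<psi> = {f \<in> carrier (PGL2 R).
     ratfun_comp R (ratfun_comp R f \<phi>) (inv\<^bsub>PGL2 R\<^esub> f) = \<psi>}"

section \<open>Reduction at a finite place\<close>

text \<open>
  To reduce a rational function, write it in lowest terms with coefficients integral at \<open>v\<close>
  and not all in the maximal ideal (this determines the pair up to a unit at \<open>v\<close>), and
  reduce the coefficients. The reduced pair need not be in lowest terms, so the degree may drop.
\<close>

definition normalized_at ::
  "('k::field \<Rightarrow> int) \<Rightarrow> (nat \<Rightarrow> 'k) \<Rightarrow> (nat \<Rightarrow> 'k) \<Rightarrow> bool" where
  "normalized_at v p q \<longleftrightarrow>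
     (\<forall>i. coeff (UP as_ring) p i \<in> integers_at v \<and> coeff (UP as_ring) q i \<in> integers_at v) \<and>
     (\<exists>i. coeff (UP as_ring) p i \<notin> max_ideal_at v \<or> coeff (UP as_ring) q i \<notin> max_ideal_at v)"

definition reduce_poly :: "('k::field \<Rightarrow> int) \<Rightarrow> (nat \<Rightarrow> 'k) \<Rightarrow> (nat \<Rightarrow> 'k set)" where
  "reduce_poly v p = (\<lambda>i. residue v (coeff (UP as_ring) p i))"

definition red :: "('k::field \<Rightarrow> int) \<Rightarrow> 'k ratfun \<Rightarrow> 'k set ratfun" where
  "red v \<phi> =
     (let (p, q) = (SOME (p, q). (p, q) \<in> \<phi> \<and> coprime_polys as_ring p q \<and> normalized_at v p q)
      in fraction (residue_field v) (reduce_poly v p) (reduce_poly v q))"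

definition good_reduction :: "('k::field \<Rightarrow> int) \<Rightarrow> 'k ratfun \<Rightarrow> bool" where
  "good_reduction v \<phi> \<longleftrightarrow>
     ratfun_degree (residue_field v) (red v \<phi>) = ratfun_degree as_ring \<phi>"

definition exceptional_primes :: "'k::field_char_0 itself \<Rightarrow> nat \<Rightarrow> nat set" where
  "exceptional_primes K d = {2} \<union>
     {p. prime p \<and> odd p \<and> (p - 1) div 2 dvd degree_over_rat K \<and> p dvd d * (d\<^sup>2 - 1)}"

definition exceptional_places ::
  "nat \<Rightarrow> 'k::field_char_0 ratfun \<Rightarrow> 'k ratfun \<Rightarrow> ('k \<Rightarrow> int) set" where
  "exceptional_places d \<phi> \<psi> = {v \<in> finite_places.
     \<not> good_reduction v \<phi> \<or> \<not> good_reduction v \<psi> \<or>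
     (\<exists>p \<in> exceptional_primes TYPE('k) d. divides_prime v p)}"

end

theory Submission
  imports Defs "HOL-Algebra.Algebraic_Closure_Type"
begin

text \<open>
  Fix a place \<open>v\<close> that is not exceptional, write \<open>||x||\<close> for the absolute value of \<open>v\<close> and, on \<open>K\<^sup>2\<close>, for the
  maximum norm. After scaling, \<open>\<phi>\<close> and \<open>\<psi>\<close> are given by pairs \<open>F\<close>, \<open>G\<close> of binary forms of degree
  \<open>d\<close>, and a conjugating map \<open>f\<close> by a matrix \<open>M\<close>, all with integral coefficients, not all of them
  in the maximal ideal. That \<open>f\<close> conjugates \<open>\<phi>\<close> to \<open>\<psi>\<close> means \<open>M F adj(M) = t G\<close> for a nonzero
  constant \<open>t\<close>.

  Good reduction of \<open>\<phi>\<close> is used in the form \<open>||F(x)|| = ||x||\<^sup>d\<close> (\<open>norm_good_model\<close>), and likewise for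
  \<open>G\<close>. Evaluating the identity at two well chosen vectors gives
  \<open>||det M|| \<le> ||t|| \<le> ||det M||\<^sup>d\<close>; as \<open>d \<ge> 2\<close>, both \<open>det M\<close> and \<open>t\<close> are units
  (\<open>conj_det_unit\<close>). So \<open>f\<close> has good reduction, and reducing the coefficients of the identity shows
  that its reduction conjugates the reduced maps (\<open>reduce_conjugation\<close>).

  Let \<open>f\<close> and \<open>g\<close> have the same reduction, and let \<open>S = adj(M\<^sub>g) M\<^sub>f\<close>. Then \<open>S F = \<mu> F S\<close> for a
  constant \<open>\<mu>\<close>, and \<open>S\<close> is congruent to a scalar matrix. Suppose that \<open>S\<close> is not scalar. If \<open>x\<close> is an
  eigenvector of \<open>S\<close> over the algebraic closure for the eigenvalue \<open>\<kappa>\<close>, then \<open>F(x)\<close> is one for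
  \<open>\<mu> \<kappa>\<^sup>d\<close>. Hence the eigenvalues satisfy \<open>\<alpha>\<^sup>N = \<beta>\<^sup>N\<close> for some \<open>N\<close> among \<open>d - 1\<close>, \<open>d\<close>, \<open>d + 1\<close>; they are
  distinct because in characteristic 0 no map of degree at least 2 commutes with a translation
  (\<open>automorphism_finite_order\<close>). Some power of \<open>S\<close> then has prime order \<open>r\<close>, where \<open>r\<close> divides
  \<open>d (d\<^sup>2 - 1)\<close>. It is again congruent to a scalar, so its trace \<open>\<tau>\<close> is a unit, as \<open>v\<close> does not divide 2,
  and its discriminant \<open>D\<close> is in the maximal ideal. With \<open>r = 2 m + 1\<close>, the element
  \<open>w = D / \<tau>\<^sup>2\<close> of \<open>K\<close> is a root of \<open>\<Sum>\<^sub>i (r choose (2 i + 1)) w\<^sup>i\<close>, which is monic of degree \<open>m\<close> and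
  Eisenstein at \<open>r\<close> (\<open>eisenstein_of_finite_order\<close>). Consequently \<open>v\<close> divides \<open>r\<close>, and \<open>||w||\<^sup>m = ||r||\<close>
  makes \<open>1, w, \<dots>, w\<^sup>m\<^sup>-\<^sup>1\<close> linearly independent over the rationals because any two nonzero terms of a
  relation differ in absolute value. So \<open>m = (r - 1) / 2\<close> divides \<open>[K : \<rat>]\<close> and \<open>v\<close> divides an exceptional
  prime, a contradiction; \<open>S\<close> is scalar and \<open>f = g\<close> (\<open>conjugations_equal\<close>).

  Finiteness of the exceptional places: if \<open>A p + B q = 1\<close> for coprime \<open>p\<close> and \<open>q\<close>, then \<open>p / q\<close> has good reduction
  wherever the nonzero coefficients of \<open>p\<close>, \<open>q\<close>, \<open>A\<close>, \<open>B\<close> are units. A nonzero element of \<open>K\<close> is a unit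
  at almost all places, since it is algebraic over the rationals and only finitely many places lie
  above a prime: approximation provides as many linearly independent elements as there are places.
\<close>

section \<open>The absolute value of a finite place\<close>

text \<open>
  Unlike \<open>v\<close> itself, the absolute value has the right value at \<open>0\<close>. The base 2 is arbitrary.
\<close>

definition place_abs :: "('k::field \<Rightarrow> int) \<Rightarrow> 'k \<Rightarrow> real" where
  "place_abs v x = (if x = 0 then 0 else 2 powr (- of_int (v x)))"

locale finite_place =
  fixes v :: "'k::field \<Rightarrow> int"
  assumes finite_place: "v \<in> finite_places"
begin

abbreviation vabs :: "'k \<Rightarrow> real" ("||_||") where "||x|| \<equiv> place_abs v x"

lemma vabs_zero [simp]: "||0|| = 0" by (simp add: place_abs_def)

lemma vabs_nonneg [simp]: "0 \<le> ||x||" by (simp add: place_abs_def)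

lemma vabs_eq_0_iff [simp]: "||x|| = 0 \<longleftrightarrow> x = 0" by (simp add: place_abs_def)

lemma vabs_pos_iff [simp]: "0 < ||x|| \<longleftrightarrow> x \<noteq> 0" by (simp add: place_abs_def)

lemma vabs_le_0_iff [simp]: "||x|| \<le> 0 \<longleftrightarrow> x = 0" by (simp add: place_abs_def)

lemma vabs_mult: "||x * y|| = ||x|| * ||y||"
proof (cases "x = 0 \<or> y = 0")
  case False
  then have "v (x * y) = v x + v y" using finite_place by (auto simp: finite_places_def)
  then show ?thesis using False by (simp add: place_abs_def powr_add [symmetric])
qed (auto simp: place_abs_def)

lemma vabs_one [simp]: "||1|| = 1"
  using vabs_mult [of 1 1] vabs_eq_0_iff [of 1] by (simp del: vabs_eq_0_iff)

lemma vabs_power: "||x ^ n|| = ||x|| ^ n"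
  by (induction n) (simp_all add: vabs_mult)

lemma vabs_minus [simp]: "||- x|| = ||x||"
proof -
  have "||- 1|| ^ 2 = 1" using vabs_power [of "- 1" 2] by simp
  then have "||- 1|| = 1" by (smt (verit) power2_eq_1_iff vabs_nonneg)
  then show ?thesis using vabs_mult [of "- 1" x] by simp
qed

lemma vabs_inverse: "||inverse x|| = inverse ||x||"
proof (cases "x = 0")
  case False
  then have "||x|| * ||inverse x|| = 1" by (simp add: vabs_mult [symmetric])
  then show ?thesis by (metis inverse_unique)
qed simp

lemma vabs_divide: "||x / y|| = ||x|| / ||y||"
  by (simp add: divide_inverse vabs_mult vabs_inverse)

lemma vabs_add_le: "||x + y|| \<le> max ||x|| ||y||"
proof (cases "x = 0 \<or> y = 0 \<or> x + y = 0")
  case True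
  then show ?thesis by (auto simp: max_def)
next
  case False
  then have "min (v x) (v y) \<le> v (x + y)" using finite_place by (auto simp: finite_places_def)
  then show ?thesis using False by (auto simp: place_abs_def max_def min_def split: if_splits)
qed

lemma vabs_diff_le: "||x - y|| \<le> max ||x|| ||y||"
  using vabs_add_le [of x "- y"] by simp

lemma vabs_sum_le:
  assumes "\<And>i. i \<in> I \<Longrightarrow> ||f i|| \<le> C" and "0 \<le> C"
  shows "||\<Sum>i\<in>I. f i|| \<le> C"
  using assms
proof (induction I rule: infinite_finite_induct)
  case (insert i I)
  then show ?case using vabs_add_le [of "f i" "\<Sum>i\<in>I. f i"] by fastforce
qed auto

lemma vabs_sum_less:
  assumes "\<And>i. i \<in> I \<Longrightarrow> ||f i|| < C" and "0 < C"
  shows "||\<Sum>i\<in>I. f i|| < C"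
  using assms
proof (induction I rule: infinite_finite_induct)
  case (insert i I)
  then show ?case using vabs_add_le [of "f i" "\<Sum>i\<in>I. f i"] by fastforce
qed auto

lemma vabs_add_dominant:
  assumes "||y|| < ||x||"
  shows "||x + y|| = ||x||"
  using vabs_add_le [of x y] vabs_diff_le [of "x + y" y] assms by (simp add: max_def split: if_splits)

text \<open>
  In a nonarchimedean field the largest term of a sum, if it is unique, determines the absolute value
  of the sum. The linear independence of powers of an element and of elements attached to distinct places
  is proved in this way.
\<close>

lemma sum_dominant_nonzero:
  assumes "finite I" "i \<in> I" "f i \<noteq> 0" "\<And>j. j \<in> I \<Longrightarrow> j \<noteq> i \<Longrightarrow> ||f j|| < ||f i||"
  shows "(\<Sum>j\<in>I. f j) \<noteq> 0"
proof -
  have "||\<Sum>j\<in>I - {i}. f j|| < ||f i||"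
    using assms by (intro vabs_sum_less) auto
  then have "||\<Sum>j\<in>I. f j|| = ||f i||"
    using vabs_add_dominant assms by (simp add: sum.remove)
  then show ?thesis using assms(3) by (metis vabs_eq_0_iff)
qed

lemma vabs_of_nat_le: "||of_nat n|| \<le> 1"
proof (induction n)
  case (Suc n)
  then show ?case using vabs_add_le [of 1 "of_nat n"] by simp
qed simp

lemma vabs_of_int_le: "||of_int n|| \<le> 1"
  by (cases n rule: int_cases2) (simp_all add: vabs_of_nat_le)

lemma vabs_less_1_iff: "||x|| < 1 \<longleftrightarrow> x = 0 \<or> 0 < v x"
  using powr_less_cancel_iff [of 2 "- of_int (v x)" 0] by (auto simp: place_abs_def)

lemma vabs_le_1_iff: "||x|| \<le> 1 \<longleftrightarrow> x = 0 \<or> 0 \<le> v x"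
  using powr_le_cancel_iff [of 2 "- of_int (v x)" 0] by (auto simp: place_abs_def)

lemma integers_at_iff: "x \<in> integers_at v \<longleftrightarrow> ||x|| \<le> 1"
  by (simp add: integers_at_def vabs_le_1_iff)

lemma max_ideal_at_iff: "x \<in> max_ideal_at v \<longleftrightarrow> ||x|| < 1"
  by (simp add: max_ideal_at_def vabs_less_1_iff)

section \<open>The residue field\<close>

lemma valuation_ring_simps [simp]:
  "carrier (valuation_ring v) = integers_at v"
  "mult (valuation_ring v) = (*)"  "monoid.one (valuation_ring v) = 1"
  "ring.zero (valuation_ring v) = 0" "add (valuation_ring v) = (+)"
  by (simp_all add: valuation_ring_def as_ring_def)

lemma cring_valuation_ring: "cring (valuation_ring v)"
proof (rule cringI)
  show "abelian_group (valuation_ring v)"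
  proof (rule abelian_groupI)
    fix x assume "x \<in> carrier (valuation_ring v)"
    then show "\<exists>y\<in>carrier (valuation_ring v). y \<oplus>\<^bsub>valuation_ring v\<^esub> x = \<zero>\<^bsub>valuation_ring v\<^esub>"
      by (intro bexI [of _ "- x"]) (auto simp: integers_at_iff)
  next
    fix x y assume "x \<in> carrier (valuation_ring v)" "y \<in> carrier (valuation_ring v)"
    then show "x \<oplus>\<^bsub>valuation_ring v\<^esub> y \<in> carrier (valuation_ring v)"
      using vabs_add_le [of x y] by (auto simp: integers_at_iff)
  qed (auto simp: integers_at_iff add_ac)
  show "comm_monoid (valuation_ring v)"
    by (rule comm_monoidI) (auto simp: integers_at_iff vabs_mult mult_le_one mult_ac)
qed (auto simp: distrib_right)

lemma ideal_max_ideal: "ideal (max_ideal_at v) (valuation_ring v)"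
proof -
  interpret V: cring "valuation_ring v" by (rule cring_valuation_ring)
  have uminus: "\<ominus>\<^bsub>valuation_ring v\<^esub> x = - x" if "x \<in> integers_at v" for x
    using that by (intro V.minus_equality) (auto simp: integers_at_iff)
  show ?thesis
  proof (rule idealI)
    show "subgroup (max_ideal_at v) (add_monoid (valuation_ring v))"
    proof (rule V.add.subgroupI)
      show "max_ideal_at v \<subseteq> carrier (valuation_ring v)"
        by (auto simp: integers_at_iff max_ideal_at_iff)
      show "max_ideal_at v \<noteq> {}" by (auto simp: max_ideal_at_def)
    next
      fix x assume "x \<in> max_ideal_at v"
      then show "\<ominus>\<^bsub>valuation_ring v\<^esub> x \<in> max_ideal_at v"
        by (subst uminus) (auto simp: integers_at_iff max_ideal_at_iff)
    next
      fix x y assume "x \<in> max_ideal_at v" "y \<in> max_ideal_at v"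
      then show "x \<oplus>\<^bsub>valuation_ring v\<^esub> y \<in> max_ideal_at v"
        using vabs_add_le [of x y] by (auto simp: max_ideal_at_iff)
    qed
  next
    fix x y assume *: "x \<in> max_ideal_at v" "y \<in> carrier (valuation_ring v)"
    then have "||x|| < 1" "||y|| \<le> 1" by (auto simp: integers_at_iff max_ideal_at_iff)
    then have "||x|| * ||y|| < 1"
      by (metis mult_left_le mult.right_neutral le_less_trans vabs_nonneg)
    then show "y \<otimes>\<^bsub>valuation_ring v\<^esub> x \<in> max_ideal_at v" "x \<otimes>\<^bsub>valuation_ring v\<^esub> y \<in> max_ideal_at v"
      by (simp_all add: max_ideal_at_iff vabs_mult mult.commute)
  qed (rule V.ring_axioms)
qed

lemma field_residue_field: "field (residue_field v)"
proof -
  interpret I: ideal "max_ideal_at v" "valuation_ring v" by (rule ideal_max_ideal)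
  have "maximalideal (max_ideal_at v) (valuation_ring v)"
  proof (rule maximalidealI)
    show "carrier (valuation_ring v) \<noteq> max_ideal_at v"
    proof
      assume "carrier (valuation_ring v) = max_ideal_at v"
      moreover have "1 \<in> integers_at v" "1 \<notin> max_ideal_at v"
        by (auto simp: integers_at_iff max_ideal_at_iff)
      ultimately show False by auto
    qed
  next
    fix J assume J: "ideal J (valuation_ring v)" "max_ideal_at v \<subseteq> J" "J \<subseteq> carrier (valuation_ring v)"
    interpret J: ideal J "valuation_ring v" by (rule J)
    show "J = max_ideal_at v \<or> J = carrier (valuation_ring v)"
    proof (cases "J \<subseteq> max_ideal_at v")
      case False
      then obtain x where x: "x \<in> J" "x \<notin> max_ideal_at v" by auto
      then have x1: "||x|| = 1" using J(3) by (force simp: integers_at_iff max_ideal_at_iff)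
      then have "x \<noteq> 0" by auto
      have "inverse x \<in> carrier (valuation_ring v)" by (simp add: integers_at_iff vabs_inverse x1)
      from J.I_l_closed [OF x(1) this] \<open>x \<noteq> 0\<close> have "1 \<in> J" by simp
      then have "J = carrier (valuation_ring v)"
        using J.one_imp_carrier by simp
      then show ?thesis ..
    qed (use J in auto)
  qed (rule ideal_max_ideal)
  then interpret M: maximalideal "max_ideal_at v" "valuation_ring v" .
  show ?thesis unfolding residue_field_def by (rule M.quotient_is_field [OF cring_valuation_ring])
qed

lemma residue_ring_hom: "residue v \<in> ring_hom (valuation_ring v) (residue_field v)"
  using ideal.rcos_ring_hom [OF ideal_max_ideal] unfolding residue_def [abs_def] residue_field_def .

lemma residue_closed [simp]: "||x|| \<le> 1 \<Longrightarrow> residue v x \<in> carrier (residue_field v)"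
  using ring_hom_closed [OF residue_ring_hom] by (simp add: integers_at_iff)

lemma residue_mult: "||x|| \<le> 1 \<Longrightarrow> ||y|| \<le> 1 \<Longrightarrow>
    residue v (x * y) = residue v x \<otimes>\<^bsub>residue_field v\<^esub> residue v y"
  using ring_hom_mult [OF residue_ring_hom] by (simp add: integers_at_iff)

lemma residue_add: "||x|| \<le> 1 \<Longrightarrow> ||y|| \<le> 1 \<Longrightarrow>
    residue v (x + y) = residue v x \<oplus>\<^bsub>residue_field v\<^esub> residue v y"
  using ring_hom_add [OF residue_ring_hom] by (simp add: integers_at_iff)

lemma residue_one: "residue v 1 = \<one>\<^bsub>residue_field v\<^esub>"
  using ring_hom_one [OF residue_ring_hom] by simp

lemma residue_eq_iff:
  assumes "||x|| \<le> 1" "||y|| \<le> 1"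
  shows "residue v x = residue v y \<longleftrightarrow> ||x - y|| < 1"
proof -
  interpret I: ideal "max_ideal_at v" "valuation_ring v" by (rule ideal_max_ideal)
  have uminus: "\<ominus>\<^bsub>valuation_ring v\<^esub> x = - x" if "x \<in> integers_at v" for x
    using that by (intro I.minus_equality) (auto simp: integers_at_iff)
  have "x \<ominus>\<^bsub>valuation_ring v\<^esub> y = x - y"
    using assms by (simp add: a_minus_def uminus integers_at_iff)
  then show ?thesis
    using I.quotient_eq_iff_same_a_r_cos [OF ideal_max_ideal, of x y] assms
    by (simp add: residue_def integers_at_iff max_ideal_at_iff)
qed

lemma residue_zero: "residue v 0 = \<zero>\<^bsub>residue_field v\<^esub>"
proof -
  interpret F: field "residue_field v" by (rule field_residue_field)
  interpret V: cring "valuation_ring v" by (rule cring_valuation_ring)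
  interpret h: ring_hom_ring "valuation_ring v" "residue_field v" "residue v"
    using residue_ring_hom V.ring_axioms F.ring_axioms by (simp add: ring_hom_ring.intro ring_hom_ring_axioms.intro)
  show ?thesis using h.hom_zero by simp
qed

lemma residue_eq_zero_iff:
  assumes "||x|| \<le> 1"
  shows "residue v x = \<zero>\<^bsub>residue_field v\<^esub> \<longleftrightarrow> ||x|| < 1"
  using residue_eq_iff [of x 0] assms by (simp add: residue_zero)

lemma residue_surj:
  assumes "y \<in> carrier (residue_field v)"
  obtains x where "||x|| \<le> 1" "y = residue v x"
proof -
  from assms obtain x where "x \<in> integers_at v" "y = residue v x"
    by (auto simp: residue_field_def FactRing_def residue_def A_RCOSETS_def' )
  then show ?thesis using that by (simp add: integers_at_iff)
qed

end

section \<open>Rational functions over an abstract field\<close>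

text \<open>
  Both \<open>K\<close> and its residue fields are instances. Over the finite residue fields a polynomial is not
  determined by its values, so that this part computes with polynomials only.
\<close>

locale UP_field = UP R P + R?: Ring.field R for R (structure) and P (structure)

sublocale UP_field < UP_domain
  by intro_locales [1] (rule P_def)

context UP_field
begin

abbreviation UP_add (infixl "\<oplus>\<^sub>P" 65) where "p \<oplus>\<^sub>P q \<equiv> p \<oplus>\<^bsub>P\<^esub> q"
abbreviation UP_mult (infixl "\<otimes>\<^sub>P" 70) where "p \<otimes>\<^sub>P q \<equiv> p \<otimes>\<^bsub>P\<^esub> q"
abbreviation UP_smult (infixl "\<odot>\<^sub>P" 70) where "c \<odot>\<^sub>P p \<equiv> c \<odot>\<^bsub>P\<^esub> p"
abbreviation UP_zero ("\<zero>\<^sub>P") where "\<zero>\<^sub>P \<equiv> \<zero>\<^bsub>P\<^esub>"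
abbreviation UP_one ("\<one>\<^sub>P") where "\<one>\<^sub>P \<equiv> \<one>\<^bsub>P\<^esub>"

lemma unit_const:
  assumes "c \<in> carrier R" "c \<noteq> \<zero>" "p \<in> carrier P"
  shows "inv c \<odot>\<^sub>P (c \<odot>\<^sub>P p) = p" "c \<odot>\<^sub>P (inv c \<odot>\<^sub>P p) = p"
proof -
  have "c \<in> Units R" using assms field_Units by auto
  then show "inv c \<odot>\<^sub>P (c \<odot>\<^sub>P p) = p" "c \<odot>\<^sub>P (inv c \<odot>\<^sub>P p) = p"
    using assms by (simp_all add: smult_assoc1 [symmetric])
qed

lemma nonzero_pow: "c \<in> carrier R \<Longrightarrow> c \<noteq> \<zero> \<Longrightarrow> c [^] (n::nat) \<noteq> \<zero>"
  by (induction n) (auto simp: R.integral_iff)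

lemma euclidean_domain_UP: "euclidean_domain P (deg R)"
proof (rule domain.euclidean_domainI [OF UP_domain])
  fix f g assume f: "f \<in> carrier P - {\<zero>\<^sub>P}" and g: "g \<in> carrier P - {\<zero>\<^sub>P}"
  obtain q r and k :: nat where qr: "q \<in> carrier P" "r \<in> carrier P"
    "lcoeff g [^] k \<odot>\<^sub>P f = g \<otimes>\<^sub>P q \<oplus>\<^sub>P r" "r = \<zero>\<^sub>P \<or> deg R r < deg R g"
    using long_div_theorem [of g f] f g by auto
  define c where "c = lcoeff g [^] k"
  have c: "c \<in> carrier R" "c \<noteq> \<zero>"
    using g lcoeff_nonzero2 [of g] nonzero_pow [of "lcoeff g"] unfolding c_def by auto
  have ic: "inv c \<in> carrier R" "inv c \<noteq> \<zero>" using c field_Units R.Units_inv_Units by auto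
  have "f = inv c \<odot>\<^sub>P (c \<odot>\<^sub>P f)" using unit_const c f by auto
  also have "\<dots> = g \<otimes>\<^sub>P (inv c \<odot>\<^sub>P q) \<oplus>\<^sub>P (inv c \<odot>\<^sub>P r)"
    using qr g ic by (simp add: c_def smult_r_distr P.m_comm [of g] UP_smult_assoc2)
  finally show "\<exists>q r. q \<in> carrier P \<and> r \<in> carrier P \<and> f = g \<otimes>\<^sub>P q \<oplus>\<^sub>P r \<and>
      (r = \<zero>\<^sub>P \<or> deg R r < deg R g)"
    using qr ic by (intro exI [of _ "inv c \<odot>\<^sub>P q"] exI [of _ "inv c \<odot>\<^sub>P r"]) auto
qed

text \<open>
  Division with remainder makes the polynomials a principal ideal domain; the generator of the ideal of
  \<open>p\<close> and \<open>q\<close> is their greatest common divisor.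
\<close>

lemma bezout_gcd:
  assumes "p \<in> carrier P" "q \<in> carrier P" "p \<noteq> \<zero>\<^sub>P \<or> q \<noteq> \<zero>\<^sub>P"
  obtains g p0 q0 A B where "g \<in> carrier P" "g \<noteq> \<zero>\<^sub>P" "p0 \<in> carrier P" "q0 \<in> carrier P"
    "A \<in> carrier P" "B \<in> carrier P" "p = g \<otimes>\<^sub>P p0" "q = g \<otimes>\<^sub>P q0"
    "A \<otimes>\<^sub>P p0 \<oplus>\<^sub>P B \<otimes>\<^sub>P q0 = \<one>\<^sub>P"
proof -
  interpret E: euclidean_domain P "deg R" by (rule euclidean_domain_UP)
  let ?I = "PIdl\<^bsub>P\<^esub> p <+>\<^bsub>P\<^esub> PIdl\<^bsub>P\<^esub> q"
  have "ideal ?I P" using assms by (intro P.add_ideals P.cgenideal_ideal)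
  then obtain g where g: "g \<in> carrier P" "?I = PIdl\<^bsub>P\<^esub> g" using E.exists_gen by blast
  have mem: "x \<in> ?I \<longleftrightarrow> (\<exists>A\<in>carrier P. \<exists>B\<in>carrier P. x = A \<otimes>\<^sub>P p \<oplus>\<^sub>P B \<otimes>\<^sub>P q)" for x
    by (auto simp: set_add_def' cgenideal_def) 
  have mem_g: "x \<in> ?I \<longleftrightarrow> (\<exists>A\<in>carrier P. x = A \<otimes>\<^sub>P g)" for x
    unfolding g(2) by (auto simp: cgenideal_def)
  have "p \<in> ?I" unfolding mem using assms
    by (intro bexI [of _ "\<one>\<^sub>P"] bexI [of _ "\<zero>\<^sub>P"]) auto
  then obtain p0 where p0: "p0 \<in> carrier P" "p = p0 \<otimes>\<^sub>P g" unfolding mem_g by auto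
  have "q \<in> ?I" unfolding mem using assms
    by (intro bexI [of _ "\<one>\<^sub>P"] bexI [of _ "\<zero>\<^sub>P"]) auto
  then obtain q0 where q0: "q0 \<in> carrier P" "q = q0 \<otimes>\<^sub>P g" unfolding mem_g by auto
  have g0: "g \<noteq> \<zero>\<^sub>P" using assms p0 q0 by auto
  have "g \<in> ?I" unfolding mem_g using g by (intro bexI [of _ "\<one>\<^sub>P"]) auto
  then obtain A B where AB: "A \<in> carrier P" "B \<in> carrier P" "g = A \<otimes>\<^sub>P p \<oplus>\<^sub>P B \<otimes>\<^sub>P q"
    unfolding mem by auto
  have "\<one>\<^sub>P \<otimes>\<^sub>P g = (A \<otimes>\<^sub>P p0 \<oplus>\<^sub>P B \<otimes>\<^sub>P q0) \<otimes>\<^sub>P g"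
    using AB p0 q0 g by (simp add: P.l_distr P.m_assoc)
  then have "A \<otimes>\<^sub>P p0 \<oplus>\<^sub>P B \<otimes>\<^sub>P q0 = \<one>\<^sub>P"
    using domain.m_rcancel [OF UP_domain g0 g(1) UP_one_closed, of "A \<otimes>\<^sub>P p0 \<oplus>\<^sub>P B \<otimes>\<^sub>P q0"]
      AB(1,2) p0(1) q0(1) by simp
  moreover have "p = g \<otimes>\<^sub>P p0" "q = g \<otimes>\<^sub>P q0"
    unfolding p0(2) q0(2) using p0(1) q0(1) g(1) by (simp_all only: P.m_comm)
  ultimately show ?thesis by (intro that [OF g(1) g0 p0(1) q0(1) AB(1,2)])
qed

lemma coprime_polys_iff_bezout:
  "coprime_polys R p q \<longleftrightarrow> p \<in> carrier P \<and> q \<in> carrier P \<and>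
     (\<exists>A\<in>carrier P. \<exists>B\<in>carrier P. A \<otimes>\<^sub>P p \<oplus>\<^sub>P B \<otimes>\<^sub>P q = \<one>\<^sub>P)"
proof safe
  assume *: "coprime_polys R p q"
  then show pq: "p \<in> carrier P" "q \<in> carrier P" by (auto simp: coprime_polys_def P_def)
  have unit: "h \<in> Units P" if "h \<in> carrier P" "h divides\<^bsub>P\<^esub> p" "h divides\<^bsub>P\<^esub> q" for h
    using * that by (auto simp: coprime_polys_def P_def)
  have nz: "p \<noteq> \<zero>\<^sub>P \<or> q \<noteq> \<zero>\<^sub>P"
  proof (rule ccontr)
    assume "\<not> ?thesis"
    then have "\<zero>\<^sub>P \<in> Units P" by (intro unit) (auto simp: factor_def intro: bexI [of _ "\<zero>\<^sub>P"])
    then show False by (metis P.Units_r_inv P.Units_inv_closed P.l_null UP_one_not_zero)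
  qed
  obtain g p0 q0 A B where g: "g \<in> carrier P" "g \<noteq> \<zero>\<^sub>P" "p0 \<in> carrier P" "q0 \<in> carrier P"
    "A \<in> carrier P" "B \<in> carrier P" "p = g \<otimes>\<^sub>P p0" "q = g \<otimes>\<^sub>P q0"
    "A \<otimes>\<^sub>P p0 \<oplus>\<^sub>P B \<otimes>\<^sub>P q0 = \<one>\<^sub>P"
    using bezout_gcd [OF pq nz] by metis
  then have "g \<in> Units P" by (intro unit) (auto simp: factor_def)
  define i where "i = inv\<^bsub>P\<^esub> g"
  have i: "i \<in> carrier P" "i \<otimes>\<^sub>P g = \<one>\<^sub>P"
    using \<open>g \<in> Units P\<close> by (auto simp: i_def)
  have cancel: "i \<otimes>\<^sub>P (g \<otimes>\<^sub>P x) = x" if "x \<in> carrier P" for x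
    using i g(1) that by (simp add: P.m_assoc [symmetric])
  have "(A \<otimes>\<^sub>P i) \<otimes>\<^sub>P p \<oplus>\<^sub>P (B \<otimes>\<^sub>P i) \<otimes>\<^sub>P q = \<one>\<^sub>P"
    using g i(1) by (simp add: P.m_assoc cancel)
  then show "\<exists>A\<in>carrier P. \<exists>B\<in>carrier P. A \<otimes>\<^sub>P p \<oplus>\<^sub>P B \<otimes>\<^sub>P q = \<one>\<^sub>P"
    using g i P.m_closed by blast
next
  fix A B assume *: "p \<in> carrier P" "q \<in> carrier P" "A \<in> carrier P" "B \<in> carrier P"
    "A \<otimes>\<^sub>P p \<oplus>\<^sub>P B \<otimes>\<^sub>P q = \<one>\<^sub>P"
  have "h \<in> Units P" if "h \<in> carrier P" "h divides\<^bsub>P\<^esub> p" "h divides\<^bsub>P\<^esub> q" for h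
  proof -
    from that obtain x y where xy: "x \<in> carrier P" "y \<in> carrier P" "p = h \<otimes>\<^sub>P x" "q = h \<otimes>\<^sub>P y"
      by (auto simp: factor_def)
    have "h \<otimes>\<^sub>P (A \<otimes>\<^sub>P x \<oplus>\<^sub>P B \<otimes>\<^sub>P y) = A \<otimes>\<^sub>P p \<oplus>\<^sub>P B \<otimes>\<^sub>P q"
      using * xy that by (simp add: P.r_distr P.m_lcomm)
    then have "h \<otimes>\<^sub>P (A \<otimes>\<^sub>P x \<oplus>\<^sub>P B \<otimes>\<^sub>P y) = \<one>\<^sub>P" using * by simp
    moreover have "A \<otimes>\<^sub>P x \<oplus>\<^sub>P B \<otimes>\<^sub>P y \<in> carrier P" using * xy by simp
    ultimately show ?thesis using that(1) P.m_comm [of h] unfolding Units_def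
      by (auto intro!: bexI [of _ "A \<otimes>\<^sub>P x \<oplus>\<^sub>P B \<otimes>\<^sub>P y"])
  qed
  then show "coprime_polys R p q" using * by (auto simp: coprime_polys_def P_def)
qed

lemma coprime_polys_closed: "coprime_polys R p q \<Longrightarrow> p \<in> carrier P" "coprime_polys R p q \<Longrightarrow> q \<in> carrier P"
  by (auto simp: coprime_polys_iff_bezout)

lemma coprime_polys_nonzero: "coprime_polys R p q \<Longrightarrow> p \<noteq> \<zero>\<^sub>P \<or> q \<noteq> \<zero>\<^sub>P"
  by (auto simp: coprime_polys_iff_bezout)

text \<open>
  The multiplier is \<open>h = A p' + B q'\<close> when \<open>A p + B q = 1\<close>.
\<close>

lemma proportional_to_coprime:
  assumes "coprime_polys R p q" "p' \<in> carrier P" "q' \<in> carrier P" "p \<otimes>\<^sub>P q' = p' \<otimes>\<^sub>P q"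
  obtains h where "h \<in> carrier P" "p' = h \<otimes>\<^sub>P p" "q' = h \<otimes>\<^sub>P q"
proof -
  obtain A B where AB: "A \<in> carrier P" "B \<in> carrier P" "A \<otimes>\<^sub>P p \<oplus>\<^sub>P B \<otimes>\<^sub>P q = \<one>\<^sub>P"
    and pq: "p \<in> carrier P" "q \<in> carrier P"
    using assms(1) by (auto simp: coprime_polys_iff_bezout)
  let ?h = "A \<otimes>\<^sub>P p' \<oplus>\<^sub>P B \<otimes>\<^sub>P q'"
  have "?h \<otimes>\<^sub>P p = A \<otimes>\<^sub>P p \<otimes>\<^sub>P p' \<oplus>\<^sub>P B \<otimes>\<^sub>P (p \<otimes>\<^sub>P q')"
    using AB(1,2) pq assms(2,3) by (simp add: P.l_distr P.r_distr P.m_ac)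
  also have "\<dots> = (A \<otimes>\<^sub>P p \<oplus>\<^sub>P B \<otimes>\<^sub>P q) \<otimes>\<^sub>P p'"
    unfolding assms(4) using AB(1,2) pq assms(2,3) by (simp add: P.l_distr P.r_distr P.m_ac)
  also have "\<dots> = p'" using AB assms by simp
  finally have 1: "?h \<otimes>\<^sub>P p = p'" .
  have "?h \<otimes>\<^sub>P q = A \<otimes>\<^sub>P (p' \<otimes>\<^sub>P q) \<oplus>\<^sub>P B \<otimes>\<^sub>P q \<otimes>\<^sub>P q'"
    using AB(1,2) pq assms(2,3) by (simp add: P.l_distr P.r_distr P.m_ac)
  also have "\<dots> = (A \<otimes>\<^sub>P p \<oplus>\<^sub>P B \<otimes>\<^sub>P q) \<otimes>\<^sub>P q'"
    unfolding assms(4) [symmetric] using AB(1,2) pq assms(2,3) by (simp add: P.l_distr P.r_distr P.m_ac)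
  also have "\<dots> = q'" using AB assms by simp
  finally have 2: "?h \<otimes>\<^sub>P q = q'" .
  show ?thesis using that [of ?h] 1 2 AB assms by auto
qed

lemma fraction_iff:
  "(p', q') \<in> fraction R p q \<longleftrightarrow> p' \<in> carrier P \<and> q' \<in> carrier P \<and>
     (p' \<noteq> \<zero>\<^sub>P \<or> q' \<noteq> \<zero>\<^sub>P) \<and> p \<otimes>\<^sub>P q' = p' \<otimes>\<^sub>P q"
  by (simp add: fraction_def P_def)

lemma fraction_self:
  assumes "p \<in> carrier P" "q \<in> carrier P" "p \<noteq> \<zero>\<^sub>P \<or> q \<noteq> \<zero>\<^sub>P"
  shows "(p, q) \<in> fraction R p q"
  using assms by (simp add: fraction_iff)

lemma fraction_cancel:
  assumes "h \<in> carrier P" "h \<noteq> \<zero>\<^sub>P" "p \<in> carrier P" "q \<in> carrier P"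
  shows "fraction R (h \<otimes>\<^sub>P p) (h \<otimes>\<^sub>P q) = fraction R p q"
proof -
  have "h \<otimes>\<^sub>P p \<otimes>\<^sub>P q' = p' \<otimes>\<^sub>P (h \<otimes>\<^sub>P q) \<longleftrightarrow> p \<otimes>\<^sub>P q' = p' \<otimes>\<^sub>P q"
    if "p' \<in> carrier P" "q' \<in> carrier P" for p' q'
  proof -
    have "h \<otimes>\<^sub>P p \<otimes>\<^sub>P q' = h \<otimes>\<^sub>P (p \<otimes>\<^sub>P q')" "p' \<otimes>\<^sub>P (h \<otimes>\<^sub>P q) = h \<otimes>\<^sub>P (p' \<otimes>\<^sub>P q)"
      using assms that by (simp_all add: P.m_assoc P.m_lcomm)
    then show ?thesis using assms that by (simp add: domain.m_lcancel [OF UP_domain])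
  qed
  then show ?thesis by (auto simp: fraction_iff)
qed

lemma smult_eq_mult: "c \<in> carrier R \<Longrightarrow> p \<in> carrier P \<Longrightarrow> c \<odot>\<^sub>P p = up_ring.monom P c 0 \<otimes>\<^sub>P p"
  by (simp add: monom_mult_is_smult)

lemma monom_0_nonzero: "c \<in> carrier R \<Longrightarrow> c \<noteq> \<zero> \<Longrightarrow> up_ring.monom P c 0 \<noteq> \<zero>\<^sub>P"
  by (metis coeff_monom coeff_zero)

lemma fraction_smult:
  assumes "c \<in> carrier R" "c \<noteq> \<zero>" "p \<in> carrier P" "q \<in> carrier P"
  shows "fraction R (c \<odot>\<^sub>P p) (c \<odot>\<^sub>P q) = fraction R p q"
  using fraction_cancel [of "up_ring.monom P c 0" p q] assms by (simp add: smult_eq_mult monom_0_nonzero)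

lemma unit_is_const:
  assumes "h \<in> Units P"
  obtains c where "c \<in> carrier R" "c \<noteq> \<zero>" "h = up_ring.monom P c 0"
proof -
  obtain h' where h: "h \<in> carrier P" "h' \<in> carrier P" "h \<otimes>\<^sub>P h' = \<one>\<^sub>P"
    using assms by (auto simp: Units_def)
  have nz: "h \<noteq> \<zero>\<^sub>P" "h' \<noteq> \<zero>\<^sub>P" using h UP_one_not_zero by auto
  have "deg R h + deg R h' = 0" using deg_mult [OF nz h(1,2)] h(3) by simp
  then have "h = up_ring.monom P (up_ring.coeff P h 0) 0" using deg_zero_impl_monom [OF h(1)] by simp
  moreover have "up_ring.coeff P h 0 \<noteq> \<zero>" using calculation nz by auto
  ultimately show ?thesis using that h(1) coeff_closed by metis
qed

lemma coprime_representatives: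
  assumes "coprime_polys R p q" "coprime_polys R p' q'" "p \<otimes>\<^sub>P q' = p' \<otimes>\<^sub>P q"
  obtains c where "c \<in> carrier R" "c \<noteq> \<zero>" "p' = c \<odot>\<^sub>P p" "q' = c \<odot>\<^sub>P q"
proof -
  note cl = coprime_polys_closed [OF assms(1)] coprime_polys_closed [OF assms(2)]
  obtain h where h: "h \<in> carrier P" "p' = h \<otimes>\<^sub>P p" "q' = h \<otimes>\<^sub>P q"
    using proportional_to_coprime [OF assms(1) cl(3,4) assms(3)] by metis
  have "h divides\<^bsub>P\<^esub> p'" "h divides\<^bsub>P\<^esub> q'" using h cl by (auto simp: factor_def)
  then have "h \<in> Units P" using assms(2) h by (simp add: coprime_polys_def P_def)
  then obtain c where "c \<in> carrier R" "c \<noteq> \<zero>" "h = up_ring.monom P c 0" using unit_is_const by metis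
  then show ?thesis using that h cl by (auto simp: smult_eq_mult)
qed

lemma coprime_polys_smult:
  assumes "coprime_polys R p q" "c \<in> carrier R" "c \<noteq> \<zero>"
  shows "coprime_polys R (c \<odot>\<^sub>P p) (c \<odot>\<^sub>P q)"
proof -
  obtain A B where AB: "A \<in> carrier P" "B \<in> carrier P" "A \<otimes>\<^sub>P p \<oplus>\<^sub>P B \<otimes>\<^sub>P q = \<one>\<^sub>P"
    and pq: "p \<in> carrier P" "q \<in> carrier P"
    using assms(1) by (auto simp: coprime_polys_iff_bezout)
  have ic: "inv c \<in> carrier R" using assms field_Units by auto
  have "(inv c \<odot>\<^sub>P A) \<otimes>\<^sub>P (c \<odot>\<^sub>P p) = A \<otimes>\<^sub>P p" "(inv c \<odot>\<^sub>P B) \<otimes>\<^sub>P (c \<odot>\<^sub>P q) = B \<otimes>\<^sub>P q"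
    using AB pq ic assms
    by (simp_all add: UP_smult_assoc2 P.m_comm [of A] P.m_comm [of B] unit_const)
  then show ?thesis using AB pq ic assms unfolding coprime_polys_iff_bezout by (metis UP_smult_closed)
qed

lemma lowest_terms_mem:
  assumes "(p, q) \<in> \<phi>" "coprime_polys R p q"
  shows "lowest_terms R \<phi> \<in> \<phi> \<and> coprime_polys R (fst (lowest_terms R \<phi>)) (snd (lowest_terms R \<phi>))"
proof -
  have "case lowest_terms R \<phi> of (p, q) \<Rightarrow> (p, q) \<in> \<phi> \<and> coprime_polys R p q"
    unfolding lowest_terms_def
    by (rule someI [of "\<lambda>(p, q). (p, q) \<in> \<phi> \<and> coprime_polys R p q" "(p, q)"]) (use assms in auto)
  then show ?thesis by auto
qed

text \<open>
  Whatever representative the choice operator returns, it is this one up to a constant. The lemmas below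
  therefore compute with an arbitrary coprime representative.
\<close>

lemma lowest_terms_fraction:
  assumes "coprime_polys R p q"
  obtains c where "c \<in> carrier R" "c \<noteq> \<zero>"
    "lowest_terms R (fraction R p q) = (c \<odot>\<^sub>P p, c \<odot>\<^sub>P q)"
proof -
  have "(p, q) \<in> fraction R p q"
    using assms coprime_polys_closed coprime_polys_nonzero by (intro fraction_self)
  note * = lowest_terms_mem [OF this assms]
  then have "p \<otimes>\<^sub>P snd (lowest_terms R (fraction R p q)) = fst (lowest_terms R (fraction R p q)) \<otimes>\<^sub>P q"
    by (metis fraction_iff prod.collapse)
  then show ?thesis using coprime_representatives [OF assms conjunct2 [OF *]] that by (metis prod.collapse)
qed

lemma ratfun_degree_fraction:
  assumes "coprime_polys R p q"
  shows "ratfun_degree R (fraction R p q) = max (deg R p) (deg R q)"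
proof -
  obtain c where "c \<in> carrier R" "c \<noteq> \<zero>"
    "lowest_terms R (fraction R p q) = (c \<odot>\<^sub>P p, c \<odot>\<^sub>P q)"
    using lowest_terms_fraction [OF assms] by metis
  then show ?thesis using coprime_polys_closed [OF assms] by (simp add: ratfun_degree_def)
qed

lemma fraction_eq_of_coprime_mem:
  assumes "coprime_polys R p q" "coprime_polys R p' q'" "(p', q') \<in> fraction R p q"
  shows "fraction R p q = fraction R p' q'"
proof -
  obtain c where "c \<in> carrier R" "c \<noteq> \<zero>" "p' = c \<odot>\<^sub>P p" "q' = c \<odot>\<^sub>P q"
    using coprime_representatives [OF assms(1,2)] assms(3) fraction_iff by metis
  then show ?thesis using coprime_polys_closed [OF assms(1)] by (simp add: fraction_smult)
qed

lemma rational_functions_coprime: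
  assumes "p \<in> carrier P" "q \<in> carrier P" "p \<noteq> \<zero>\<^sub>P \<or> q \<noteq> \<zero>\<^sub>P"
  obtains h p0 q0 where "coprime_polys R p0 q0" "fraction R p q = fraction R p0 q0"
    "h \<in> carrier P" "h \<noteq> \<zero>\<^sub>P" "p = h \<otimes>\<^sub>P p0" "q = h \<otimes>\<^sub>P q0"
proof -
  obtain g p0 q0 A B where g: "g \<in> carrier P" "g \<noteq> \<zero>\<^sub>P" "p0 \<in> carrier P" "q0 \<in> carrier P"
    "A \<in> carrier P" "B \<in> carrier P" "p = g \<otimes>\<^sub>P p0" "q = g \<otimes>\<^sub>P q0"
    "A \<otimes>\<^sub>P p0 \<oplus>\<^sub>P B \<otimes>\<^sub>P q0 = \<one>\<^sub>P"
    using bezout_gcd [OF assms] by metis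
  then have "coprime_polys R p0 q0" unfolding coprime_polys_iff_bezout by blast
  then show ?thesis using that g by (simp add: fraction_cancel)
qed

lemma hom_subst_alt:
  "hom_subst R n p u w = (\<Oplus>\<^bsub>P\<^esub>i \<in> {..n}. up_ring.coeff P p i \<odot>\<^sub>P (u [^]\<^bsub>P\<^esub> i \<otimes>\<^sub>P w [^]\<^bsub>P\<^esub> (n - i)))"
  by (simp add: hom_subst_def P_def)

lemma hom_subst_closed [simp]:
  "p \<in> carrier P \<Longrightarrow> u \<in> carrier P \<Longrightarrow> w \<in> carrier P \<Longrightarrow> hom_subst R n p u w \<in> carrier P"
  unfolding hom_subst_alt by (intro P.finsum_closed) auto

lemma finsum_smult:
  "finite I \<Longrightarrow> c \<in> carrier R \<Longrightarrow> (\<And>i. i \<in> I \<Longrightarrow> f i \<in> carrier P) \<Longrightarrow>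
    c \<odot>\<^sub>P (\<Oplus>\<^bsub>P\<^esub>i \<in> I. f i) = (\<Oplus>\<^bsub>P\<^esub>i \<in> I. c \<odot>\<^sub>P f i)"
proof (induction I rule: finite_induct)
  case (insert i I)
  have "(\<Oplus>\<^bsub>P\<^esub>i \<in> I. f i) \<in> carrier P" by (rule P.finsum_closed) (use insert in auto)
  then show ?case using insert by (simp add: smult_r_distr Pi_def)
qed (simp add: smult_r_null)

lemma hom_subst_smult:
  assumes "p \<in> carrier P" "u \<in> carrier P" "w \<in> carrier P" "c \<in> carrier R"
  shows "hom_subst R n (c \<odot>\<^sub>P p) u w = c \<odot>\<^sub>P hom_subst R n p u w"
  using assms unfolding hom_subst_alt
  by (subst finsum_smult) (auto simp: smult_assoc1 intro!: P.finsum_cong')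

lemma smult_pow:
  assumes "c \<in> carrier R" "u \<in> carrier P"
  shows "(c \<odot>\<^sub>P u) [^]\<^bsub>P\<^esub> (i::nat) = (c [^] i) \<odot>\<^sub>P (u [^]\<^bsub>P\<^esub> i)"
proof (induction i)
  case (Suc i)
  have "(c \<odot>\<^sub>P u) [^]\<^bsub>P\<^esub> Suc i = (c [^] i \<odot>\<^sub>P u [^]\<^bsub>P\<^esub> i) \<otimes>\<^sub>P (c \<odot>\<^sub>P u)"
    using Suc by simp
  also have "\<dots> = c [^] i \<odot>\<^sub>P (u [^]\<^bsub>P\<^esub> i \<otimes>\<^sub>P (c \<odot>\<^sub>P u))"
    using assms by (intro UP_smult_assoc2) auto
  also have "u [^]\<^bsub>P\<^esub> i \<otimes>\<^sub>P (c \<odot>\<^sub>P u) = (c \<odot>\<^sub>P u) \<otimes>\<^sub>P u [^]\<^bsub>P\<^esub> i"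
    using assms by (intro P.m_comm) auto
  also have "\<dots> = c \<odot>\<^sub>P (u \<otimes>\<^sub>P u [^]\<^bsub>P\<^esub> i)"
    using assms by (intro UP_smult_assoc2) auto
  also have "c [^] i \<odot>\<^sub>P \<dots> = (c [^] i \<otimes> c) \<odot>\<^sub>P (u \<otimes>\<^sub>P u [^]\<^bsub>P\<^esub> i)"
    using assms by (intro smult_assoc1 [symmetric]) auto
  finally show ?case using assms by (simp add: P.m_comm)
qed (use assms in simp)

lemma smult_mult_smult:
  assumes "r \<in> carrier R" "s \<in> carrier R" "f \<in> carrier P" "g \<in> carrier P"
  shows "(r \<odot>\<^sub>P f) \<otimes>\<^sub>P (s \<odot>\<^sub>P g) = (r \<otimes> s) \<odot>\<^sub>P (f \<otimes>\<^sub>P g)"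
proof -
  have "(r \<odot>\<^sub>P f) \<otimes>\<^sub>P (s \<odot>\<^sub>P g) = r \<odot>\<^sub>P (f \<otimes>\<^sub>P (s \<odot>\<^sub>P g))"
    using assms by (intro UP_smult_assoc2) auto
  also have "f \<otimes>\<^sub>P (s \<odot>\<^sub>P g) = (s \<odot>\<^sub>P g) \<otimes>\<^sub>P f"
    using assms by (intro P.m_comm) auto
  also have "\<dots> = s \<odot>\<^sub>P (g \<otimes>\<^sub>P f)" using assms by (intro UP_smult_assoc2) auto
  also have "g \<otimes>\<^sub>P f = f \<otimes>\<^sub>P g" using assms by (intro P.m_comm) auto
  also have "r \<odot>\<^sub>P (s \<odot>\<^sub>P (f \<otimes>\<^sub>P g)) = (r \<otimes> s) \<odot>\<^sub>P (f \<otimes>\<^sub>P g)"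
    using assms by (intro smult_assoc1 [symmetric]) auto
  finally show ?thesis .
qed

lemma hom_subst_scale:
  assumes "p \<in> carrier P" "u \<in> carrier P" "w \<in> carrier P" "c \<in> carrier R"
  shows "hom_subst R n p (c \<odot>\<^sub>P u) (c \<odot>\<^sub>P w) = (c [^] n) \<odot>\<^sub>P hom_subst R n p u w"
proof -
  have "up_ring.coeff P p i \<odot>\<^sub>P ((c \<odot>\<^sub>P u) [^]\<^bsub>P\<^esub> i \<otimes>\<^sub>P (c \<odot>\<^sub>P w) [^]\<^bsub>P\<^esub> (n - i)) =
      c [^] n \<odot>\<^sub>P (up_ring.coeff P p i \<odot>\<^sub>P (u [^]\<^bsub>P\<^esub> i \<otimes>\<^sub>P w [^]\<^bsub>P\<^esub> (n - i)))" if "i \<le> n" for i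
  proof -
    have "c [^] n = c [^] i \<otimes> c [^] (n - i)" using that assms by (simp add: R.nat_pow_mult)
    then have "(c \<odot>\<^sub>P u) [^]\<^bsub>P\<^esub> i \<otimes>\<^sub>P (c \<odot>\<^sub>P w) [^]\<^bsub>P\<^esub> (n - i) =
        c [^] n \<odot>\<^sub>P (u [^]\<^bsub>P\<^esub> i \<otimes>\<^sub>P w [^]\<^bsub>P\<^esub> (n - i))"
      using assms by (simp add: smult_pow smult_mult_smult)
    then show ?thesis using assms
      by (simp add: smult_assoc1 [symmetric] R.m_comm)
  qed
  then show ?thesis using assms unfolding hom_subst_alt
    by (subst finsum_smult) (auto intro!: P.finsum_cong')
qed

text \<open>
  Scaling either representative multiplies both components of the result by the same constant.
\<close>

lemma ratfun_comp_fraction: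
  assumes "coprime_polys R p q" "coprime_polys R u w" "n = max (deg R p) (deg R q)"
  shows "ratfun_comp R (fraction R p q) (fraction R u w) =
    fraction R (hom_subst R n p u w) (hom_subst R n q u w)"
proof -
  obtain c where c: "c \<in> carrier R" "c \<noteq> \<zero>"
    "lowest_terms R (fraction R p q) = (c \<odot>\<^sub>P p, c \<odot>\<^sub>P q)"
    using lowest_terms_fraction [OF assms(1)] by metis
  obtain c' where c': "c' \<in> carrier R" "c' \<noteq> \<zero>"
    "lowest_terms R (fraction R u w) = (c' \<odot>\<^sub>P u, c' \<odot>\<^sub>P w)"
    using lowest_terms_fraction [OF assms(2)] by metis
  note cl = coprime_polys_closed [OF assms(1)] coprime_polys_closed [OF assms(2)]
  show ?thesis
    using c c' cl assms
    by (simp add: ratfun_comp_def Let_def ratfun_degree_fraction hom_subst_smult hom_subst_scale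
        fraction_smult nonzero_pow)
qed

end

context UP_field
begin

section \<open>Moebius transformations and conjugation\<close>

definition lin :: "'a \<Rightarrow> 'a \<Rightarrow> nat \<Rightarrow> 'a" where
  "lin a b = up_ring.monom P a 1 \<oplus>\<^sub>P up_ring.monom P b 0"

lemma lin_closed [simp]: "a \<in> carrier R \<Longrightarrow> b \<in> carrier R \<Longrightarrow> lin a b \<in> carrier P"
  by (simp add: lin_def)

lemma coeff_lin [simp]:
  "a \<in> carrier R \<Longrightarrow> b \<in> carrier R \<Longrightarrow>
    up_ring.coeff P (lin a b) i = (if i = 0 then b else if i = 1 then a else \<zero>)"
  by (simp add: lin_def)

lemma lin_inject:
  assumes "a \<in> carrier R" "b \<in> carrier R" "a' \<in> carrier R" "b' \<in> carrier R"
  shows "lin a b = lin a' b' \<longleftrightarrow> a = a' \<and> b = b'"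
proof
  assume "lin a b = lin a' b'"
  then have "up_ring.coeff P (lin a b) i = up_ring.coeff P (lin a' b') i" for i by simp
  from this [of 0] this [of 1] show "a = a' \<and> b = b'" using assms by simp
qed simp

lemma smult_lin:
  "a \<in> carrier R \<Longrightarrow> b \<in> carrier R \<Longrightarrow> c \<in> carrier R \<Longrightarrow> c \<odot>\<^sub>P lin a b = lin (c \<otimes> a) (c \<otimes> b)"
  by (rule up_eqI) auto

lemma add_lin:
  "a \<in> carrier R \<Longrightarrow> b \<in> carrier R \<Longrightarrow> a' \<in> carrier R \<Longrightarrow> b' \<in> carrier R \<Longrightarrow>
    lin a b \<oplus>\<^sub>P lin a' b' = lin (a \<oplus> a') (b \<oplus> b')"
  by (rule up_eqI) auto

lemma deg_lin_le: "a \<in> carrier R \<Longrightarrow> b \<in> carrier R \<Longrightarrow> deg R (lin a b) \<le> 1"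
  by (intro deg_aboveI) auto

lemma mobius_eq_fraction: "mobius R a b c e = fraction R (lin a b) (lin c e)"
  by (simp add: mobius_def lin_def P_def)

definition det2 :: "'a \<Rightarrow> 'a \<Rightarrow> 'a \<Rightarrow> 'a \<Rightarrow> 'a" where
  "det2 a b c e = a \<otimes> e \<ominus> b \<otimes> c"

lemma det2_closed [simp]: "a \<in> carrier R \<Longrightarrow> b \<in> carrier R \<Longrightarrow> c \<in> carrier R \<Longrightarrow> e \<in> carrier R \<Longrightarrow>
  det2 a b c e \<in> carrier R"
  by (simp add: det2_def)

text \<open>
  The adjugate matrix \<open>(e, -b; -c, a)\<close> inverts \<open>(a, b; c, e)\<close> up to the determinant. It is used in place of
  the inverse, so that no denominators occur.
\<close>

lemma adjugate_identities:
  assumes "a \<in> carrier R" "b \<in> carrier R" "c \<in> carrier R" "e \<in> carrier R" "x \<in> carrier R" "y \<in> carrier R"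
  shows "e \<otimes> (a \<otimes> x \<oplus> b \<otimes> y) \<oplus> (\<ominus> b) \<otimes> (c \<otimes> x \<oplus> e \<otimes> y) = det2 a b c e \<otimes> x"
    "(\<ominus> c) \<otimes> (a \<otimes> x \<oplus> b \<otimes> y) \<oplus> a \<otimes> (c \<otimes> x \<oplus> e \<otimes> y) = det2 a b c e \<otimes> y"
  unfolding det2_def using assms by algebra+

lemma adjugate_comb:
  assumes "a \<in> carrier R" "b \<in> carrier R" "c \<in> carrier R" "e \<in> carrier R" "p \<in> carrier P" "q \<in> carrier P"
  shows "e \<odot>\<^sub>P (a \<odot>\<^sub>P p \<oplus>\<^sub>P b \<odot>\<^sub>P q) \<oplus>\<^sub>P (\<ominus> b) \<odot>\<^sub>P (c \<odot>\<^sub>P p \<oplus>\<^sub>P e \<odot>\<^sub>P q) = det2 a b c e \<odot>\<^sub>P p"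
    "(\<ominus> c) \<odot>\<^sub>P (a \<odot>\<^sub>P p \<oplus>\<^sub>P b \<odot>\<^sub>P q) \<oplus>\<^sub>P a \<odot>\<^sub>P (c \<odot>\<^sub>P p \<oplus>\<^sub>P e \<odot>\<^sub>P q) = det2 a b c e \<odot>\<^sub>P q"
  by (rule up_eqI; use assms in \<open>simp add: adjugate_identities\<close>)+

lemma det2_mult:
  assumes "a \<in> carrier R" "b \<in> carrier R" "c \<in> carrier R" "e \<in> carrier R"
    "a' \<in> carrier R" "b' \<in> carrier R" "c' \<in> carrier R" "e' \<in> carrier R"
  shows "det2 (a \<otimes> a' \<oplus> b \<otimes> c') (a \<otimes> b' \<oplus> b \<otimes> e') (c \<otimes> a' \<oplus> e \<otimes> c') (c \<otimes> b' \<oplus> e \<otimes> e') =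
    det2 a b c e \<otimes> det2 a' b' c' e'"
  unfolding det2_def using assms by algebra

lemma mult_nonzero: "x \<in> carrier R \<Longrightarrow> y \<in> carrier R \<Longrightarrow> x \<noteq> \<zero> \<Longrightarrow> y \<noteq> \<zero> \<Longrightarrow> x \<otimes> y \<noteq> \<zero>"
  by (simp add: R.integral_iff)

lemma deg_comb_le:
  assumes "a \<in> carrier R" "b \<in> carrier R" "p \<in> carrier P" "q \<in> carrier P"
  shows "deg R (a \<odot>\<^sub>P p \<oplus>\<^sub>P b \<odot>\<^sub>P q) \<le> max (deg R p) (deg R q)"
proof -
  have "deg R (a \<odot>\<^sub>P p \<oplus>\<^sub>P b \<odot>\<^sub>P q) \<le> max (deg R (a \<odot>\<^sub>P p)) (deg R (b \<odot>\<^sub>P q))"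
    using assms by (intro deg_add) auto
  also have "\<dots> \<le> max (deg R p) (deg R q)"
    using assms by (intro max.mono deg_smult_decr) auto
  finally show ?thesis .
qed

text \<open>
  An invertible matrix has an inverse that is a matrix as well, hence Bezout identities and degree bounds
  carry over in both directions.
\<close>

lemma matrix_comb:
  assumes M: "a \<in> carrier R" "b \<in> carrier R" "c \<in> carrier R" "e \<in> carrier R" "det2 a b c e \<noteq> \<zero>"
    and cop: "coprime_polys R p q"
  shows coprime_polys_comb: "coprime_polys R (a \<odot>\<^sub>P p \<oplus>\<^sub>P b \<odot>\<^sub>P q) (c \<odot>\<^sub>P p \<oplus>\<^sub>P e \<odot>\<^sub>P q)"
    and deg_comb: "max (deg R (a \<odot>\<^sub>P p \<oplus>\<^sub>P b \<odot>\<^sub>P q)) (deg R (c \<odot>\<^sub>P p \<oplus>\<^sub>P e \<odot>\<^sub>P q)) = max (deg R p) (deg R q)"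
proof -
  define f g where "f = a \<odot>\<^sub>P p \<oplus>\<^sub>P b \<odot>\<^sub>P q" and "g = c \<odot>\<^sub>P p \<oplus>\<^sub>P e \<odot>\<^sub>P q"
  define \<delta> where "\<delta> = det2 a b c e"
  have pq: "p \<in> carrier P" "q \<in> carrier P" using cop coprime_polys_closed by auto
  have fg: "f \<in> carrier P" "g \<in> carrier P" using M pq by (auto simp: f_def g_def)
  have \<delta>: "\<delta> \<in> carrier R" "\<delta> \<noteq> \<zero>" using M by (auto simp: \<delta>_def)
  have id: "e \<odot>\<^sub>P f \<oplus>\<^sub>P (\<ominus> b) \<odot>\<^sub>P g = \<delta> \<odot>\<^sub>P p" "(\<ominus> c) \<odot>\<^sub>P f \<oplus>\<^sub>P a \<odot>\<^sub>P g = \<delta> \<odot>\<^sub>P q"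
    using adjugate_comb M pq unfolding f_def g_def \<delta>_def by auto
  obtain A B where AB: "A \<in> carrier P" "B \<in> carrier P"
    "A \<otimes>\<^sub>P (\<delta> \<odot>\<^sub>P p) \<oplus>\<^sub>P B \<otimes>\<^sub>P (\<delta> \<odot>\<^sub>P q) = \<one>\<^sub>P"
    using coprime_polys_smult [OF cop \<delta>] by (auto simp: coprime_polys_iff_bezout)
  have swap: "h \<otimes>\<^sub>P (r \<odot>\<^sub>P h') = (r \<odot>\<^sub>P h) \<otimes>\<^sub>P h'" if "h \<in> carrier P" "h' \<in> carrier P" "r \<in> carrier R" for h h' r
    using that by (simp add: UP_smult_assoc2 P.m_comm [of h])
  have "A \<otimes>\<^sub>P (\<delta> \<odot>\<^sub>P p) \<oplus>\<^sub>P B \<otimes>\<^sub>P (\<delta> \<odot>\<^sub>P q) =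
     (e \<odot>\<^sub>P A \<oplus>\<^sub>P (\<ominus> c) \<odot>\<^sub>P B) \<otimes>\<^sub>P f \<oplus>\<^sub>P ((\<ominus> b) \<odot>\<^sub>P A \<oplus>\<^sub>P a \<odot>\<^sub>P B) \<otimes>\<^sub>P g"
    unfolding id [symmetric] using AB(1,2) fg M by (simp add: P.l_distr P.r_distr swap P.a_ac)
  then have "coprime_polys R f g" unfolding coprime_polys_iff_bezout
    using AB fg M
    by (intro conjI bexI [of _ "e \<odot>\<^sub>P A \<oplus>\<^sub>P (\<ominus> c) \<odot>\<^sub>P B"] bexI [of _ "(\<ominus> b) \<odot>\<^sub>P A \<oplus>\<^sub>P a \<odot>\<^sub>P B"]) auto
  then show "coprime_polys R (a \<odot>\<^sub>P p \<oplus>\<^sub>P b \<odot>\<^sub>P q) (c \<odot>\<^sub>P p \<oplus>\<^sub>P e \<odot>\<^sub>P q)" by (simp add: f_def g_def)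
  have "deg R p \<le> max (deg R f) (deg R g)" "deg R q \<le> max (deg R f) (deg R g)"
    using deg_comb_le [of e "\<ominus> b" f g] deg_comb_le [of "\<ominus> c" a f g] M fg \<delta> pq by (auto simp: id)
  moreover have "deg R f \<le> max (deg R p) (deg R q)" "deg R g \<le> max (deg R p) (deg R q)"
    using deg_comb_le M pq by (auto simp: f_def g_def)
  ultimately show "max (deg R (a \<odot>\<^sub>P p \<oplus>\<^sub>P b \<odot>\<^sub>P q)) (deg R (c \<odot>\<^sub>P p \<oplus>\<^sub>P e \<odot>\<^sub>P q)) = max (deg R p) (deg R q)"
    unfolding f_def g_def by linarith
qed

lemma coprime_X_one: "coprime_polys R (lin \<one> \<zero>) (lin \<zero> \<one>)"
proof -
  have "lin \<zero> \<one> = \<one>\<^sub>P" by (rule up_eqI) auto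
  then show ?thesis unfolding coprime_polys_iff_bezout
    by (intro conjI bexI [of _ "\<zero>\<^sub>P"] bexI [of _ "\<one>\<^sub>P"]) auto
qed

lemma lin_as_comb:
  "a \<in> carrier R \<Longrightarrow> b \<in> carrier R \<Longrightarrow> a \<odot>\<^sub>P lin \<one> \<zero> \<oplus>\<^sub>P b \<odot>\<^sub>P lin \<zero> \<one> = lin a b"
  by (simp add: smult_lin add_lin)

lemma mobius_facts:
  assumes "a \<in> carrier R" "b \<in> carrier R" "c \<in> carrier R" "e \<in> carrier R" "det2 a b c e \<noteq> \<zero>"
  shows coprime_polys_lin: "coprime_polys R (lin a b) (lin c e)"
    and deg_mobius: "max (deg R (lin a b)) (deg R (lin c e)) = 1"
proof -
  show "coprime_polys R (lin a b) (lin c e)"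
    using coprime_polys_comb [OF assms coprime_X_one] assms by (simp add: lin_as_comb)
  have "deg R (lin \<one> \<zero>) = 1"
    using deg_lin_le [of \<one> \<zero>] deg_belowI [of 1 "lin \<one> \<zero>"] by auto
  then show "max (deg R (lin a b)) (deg R (lin c e)) = 1"
    using deg_comb [OF assms coprime_X_one] deg_lin_le [of \<zero> \<one>] assms by (simp add: lin_as_comb)
qed

lemma hom_subst_lin:
  assumes "a \<in> carrier R" "b \<in> carrier R" "u \<in> carrier P" "w \<in> carrier P"
  shows "hom_subst R 1 (lin a b) u w = a \<odot>\<^sub>P u \<oplus>\<^sub>P b \<odot>\<^sub>P w"
proof -
  have "{..1::nat} = {0, 1}" by auto
  then show ?thesis using assms by (simp add: hom_subst_alt P.a_comm)
qed

lemma ratfun_comp_mobius_left: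
  assumes "a \<in> carrier R" "b \<in> carrier R" "c \<in> carrier R" "e \<in> carrier R" "det2 a b c e \<noteq> \<zero>"
    and "coprime_polys R p q"
  shows "ratfun_comp R (mobius R a b c e) (fraction R p q) =
    fraction R (a \<odot>\<^sub>P p \<oplus>\<^sub>P b \<odot>\<^sub>P q) (c \<odot>\<^sub>P p \<oplus>\<^sub>P e \<odot>\<^sub>P q)"
  using ratfun_comp_fraction [OF coprime_polys_lin [OF assms(1-5)] assms(6) deg_mobius [OF assms(1-5), symmetric]]
    assms coprime_polys_closed [OF assms(6)]
  by (simp add: mobius_eq_fraction hom_subst_lin [unfolded One_nat_def])

lemma ratfun_comp_mobius:
  assumes "a \<in> carrier R" "b \<in> carrier R" "c \<in> carrier R" "e \<in> carrier R" "det2 a b c e \<noteq> \<zero>"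
    "a' \<in> carrier R" "b' \<in> carrier R" "c' \<in> carrier R" "e' \<in> carrier R" "det2 a' b' c' e' \<noteq> \<zero>"
  shows "ratfun_comp R (mobius R a b c e) (mobius R a' b' c' e') =
    mobius R (a \<otimes> a' \<oplus> b \<otimes> c') (a \<otimes> b' \<oplus> b \<otimes> e') (c \<otimes> a' \<oplus> e \<otimes> c') (c \<otimes> b' \<oplus> e \<otimes> e')"
  using ratfun_comp_mobius_left [OF assms(1-5) coprime_polys_lin [OF assms(6-10)]] assms
  by (simp add: mobius_eq_fraction smult_lin add_lin)

lemma PGL2_simps [simp]:
  "mult (PGL2 R) = ratfun_comp R" "monoid.one (PGL2 R) = mobius R \<one> \<zero> \<zero> \<one>"
  by (simp_all add: PGL2_def)

lemma carrier_PGL2: "carrier (PGL2 R) = {mobius R a b c e | a b c e.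
  a \<in> carrier R \<and> b \<in> carrier R \<and> c \<in> carrier R \<and> e \<in> carrier R \<and> det2 a b c e \<noteq> \<zero>}"
  by (simp add: PGL2_def det2_def)

lemma mobius_smult:
  assumes "t \<in> carrier R" "t \<noteq> \<zero>" "a \<in> carrier R" "b \<in> carrier R" "c \<in> carrier R" "e \<in> carrier R"
  shows "mobius R (t \<otimes> a) (t \<otimes> b) (t \<otimes> c) (t \<otimes> e) = mobius R a b c e"
  using fraction_smult [of t "lin a b" "lin c e"] assms by (simp add: mobius_eq_fraction smult_lin)

lemma det2_one [simp]: "det2 \<one> \<zero> \<zero> \<one> = \<one>"
  by (simp add: det2_def R.minus_eq)

text \<open>
  This serves to identify the inverse in \<open>PGL2\<close>: in a monoid a two-sided inverse is unique.
\<close>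

lemma monoid_PGL2: "monoid (PGL2 R)"
proof (rule monoidI)
  fix f g assume "f \<in> carrier (PGL2 R)" "g \<in> carrier (PGL2 R)"
  then obtain a b c e a' b' c' e' where
    fg: "f = mobius R a b c e" "g = mobius R a' b' c' e'"
    and M: "a \<in> carrier R" "b \<in> carrier R" "c \<in> carrier R" "e \<in> carrier R" "det2 a b c e \<noteq> \<zero>"
    "a' \<in> carrier R" "b' \<in> carrier R" "c' \<in> carrier R" "e' \<in> carrier R" "det2 a' b' c' e' \<noteq> \<zero>"
    by (auto simp: carrier_PGL2)
  show "f \<otimes>\<^bsub>PGL2 R\<^esub> g \<in> carrier (PGL2 R)"
    unfolding fg PGL2_simps ratfun_comp_mobius [OF M] carrier_PGL2
    using M det2_mult [OF M(1-4) M(6-9)] mult_nonzero [OF det2_closed [OF M(1-4)] det2_closed [OF M(6-9)]]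
    by (auto intro!: exI)
next
  show "\<one>\<^bsub>PGL2 R\<^esub> \<in> carrier (PGL2 R)" unfolding carrier_PGL2 PGL2_simps
    using R.one_not_zero by (fastforce intro: det2_one)
next
  fix f g h assume "f \<in> carrier (PGL2 R)" "g \<in> carrier (PGL2 R)" "h \<in> carrier (PGL2 R)"
  then obtain a b c e a' b' c' e' a'' b'' c'' e'' where
    fg: "f = mobius R a b c e" "g = mobius R a' b' c' e'" "h = mobius R a'' b'' c'' e''"
    and M: "a \<in> carrier R" "b \<in> carrier R" "c \<in> carrier R" "e \<in> carrier R" "det2 a b c e \<noteq> \<zero>"
    and M': "a' \<in> carrier R" "b' \<in> carrier R" "c' \<in> carrier R" "e' \<in> carrier R" "det2 a' b' c' e' \<noteq> \<zero>"
    and M'': "a'' \<in> carrier R" "b'' \<in> carrier R" "c'' \<in> carrier R" "e'' \<in> carrier R" "det2 a'' b'' c'' e'' \<noteq> \<zero>"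
    by (auto simp: carrier_PGL2)
  have assoc: "(w \<otimes> x \<oplus> y \<otimes> z) \<otimes> s \<oplus> (w \<otimes> x' \<oplus> y \<otimes> z') \<otimes> t = w \<otimes> (x \<otimes> s \<oplus> x' \<otimes> t) \<oplus> y \<otimes> (z \<otimes> s \<oplus> z' \<otimes> t)"
    if "w \<in> carrier R" "x \<in> carrier R" "y \<in> carrier R" "z \<in> carrier R" "s \<in> carrier R" "t \<in> carrier R"
      "x' \<in> carrier R" "z' \<in> carrier R" for w x y z s t x' z'
    using that by algebra
  show "f \<otimes>\<^bsub>PGL2 R\<^esub> g \<otimes>\<^bsub>PGL2 R\<^esub> h = f \<otimes>\<^bsub>PGL2 R\<^esub> (g \<otimes>\<^bsub>PGL2 R\<^esub> h)"
    using M M' M''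
    by (simp add: fg ratfun_comp_mobius det2_mult mult_nonzero assoc)
next
  fix f assume "f \<in> carrier (PGL2 R)"
  then obtain a b c e where fg: "f = mobius R a b c e"
    and M: "a \<in> carrier R" "b \<in> carrier R" "c \<in> carrier R" "e \<in> carrier R" "det2 a b c e \<noteq> \<zero>"
    by (auto simp: carrier_PGL2)
  show "\<one>\<^bsub>PGL2 R\<^esub> \<otimes>\<^bsub>PGL2 R\<^esub> f = f" "f \<otimes>\<^bsub>PGL2 R\<^esub> \<one>\<^bsub>PGL2 R\<^esub> = f"
    using M by (simp_all add: fg ratfun_comp_mobius)
qed

lemma adjugate_det2:
  "a \<in> carrier R \<Longrightarrow> b \<in> carrier R \<Longrightarrow> c \<in> carrier R \<Longrightarrow> e \<in> carrier R \<Longrightarrow>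
    det2 e (\<ominus> b) (\<ominus> c) a = det2 a b c e"
  unfolding det2_def by algebra

lemma inv_mobius:
  assumes M: "a \<in> carrier R" "b \<in> carrier R" "c \<in> carrier R" "e \<in> carrier R" "det2 a b c e \<noteq> \<zero>"
  shows "inv\<^bsub>PGL2 R\<^esub> (mobius R a b c e) = mobius R e (\<ominus> b) (\<ominus> c) a"
proof -
  let ?\<delta> = "det2 a b c e"
  have M': "e \<in> carrier R" "\<ominus> b \<in> carrier R" "\<ominus> c \<in> carrier R" "a \<in> carrier R" "det2 e (\<ominus> b) (\<ominus> c) a \<noteq> \<zero>"
    using M by (auto simp: adjugate_det2)
  have one: "mobius R (?\<delta> \<otimes> \<one>) (?\<delta> \<otimes> \<zero>) (?\<delta> \<otimes> \<zero>) (?\<delta> \<otimes> \<one>) = mobius R \<one> \<zero> \<zero> \<one>"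
    using M by (intro mobius_smult) auto
  have 1: "a \<otimes> e \<oplus> b \<otimes> (\<ominus> c) = ?\<delta> \<otimes> \<one>" "a \<otimes> (\<ominus> b) \<oplus> b \<otimes> a = ?\<delta> \<otimes> \<zero>"
    "c \<otimes> e \<oplus> e \<otimes> (\<ominus> c) = ?\<delta> \<otimes> \<zero>" "c \<otimes> (\<ominus> b) \<oplus> e \<otimes> a = ?\<delta> \<otimes> \<one>"
    using M(1-4) unfolding det2_def by algebra+
  have 2: "e \<otimes> a \<oplus> (\<ominus> b) \<otimes> c = ?\<delta> \<otimes> \<one>" "e \<otimes> b \<oplus> (\<ominus> b) \<otimes> e = ?\<delta> \<otimes> \<zero>"
    "(\<ominus> c) \<otimes> a \<oplus> a \<otimes> c = ?\<delta> \<otimes> \<zero>" "(\<ominus> c) \<otimes> b \<oplus> a \<otimes> e = ?\<delta> \<otimes> \<one>"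
    using M(1-4) unfolding det2_def by algebra+
  have "ratfun_comp R (mobius R a b c e) (mobius R e (\<ominus> b) (\<ominus> c) a) = mobius R \<one> \<zero> \<zero> \<one>"
    unfolding ratfun_comp_mobius [OF M M'] 1 by (rule one)
  moreover have "ratfun_comp R (mobius R e (\<ominus> b) (\<ominus> c) a) (mobius R a b c e) = mobius R \<one> \<zero> \<zero> \<one>"
    unfolding ratfun_comp_mobius [OF M' M] 2 by (rule one)
  moreover have "mobius R a b c e \<in> carrier (PGL2 R)" "mobius R e (\<ominus> b) (\<ominus> c) a \<in> carrier (PGL2 R)"
    using M M' unfolding carrier_PGL2 by blast+
  ultimately show ?thesis using monoid.inv_unique' [OF monoid_PGL2] by (metis PGL2_simps)
qed

lemma deg_pow_le:
  assumes "u \<in> carrier P" "deg R u \<le> 1"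
  shows "deg R (u [^]\<^bsub>P\<^esub> (i::nat)) \<le> i"
proof (induction i)
  case (Suc i)
  have "deg R (u [^]\<^bsub>P\<^esub> Suc i) \<le> deg R (u [^]\<^bsub>P\<^esub> i) + deg R u"
    using assms deg_mult_ring by simp
  then show ?case using Suc assms by simp
qed simp

lemma deg_finsum_le:
  assumes "finite I" "\<And>i. i \<in> I \<Longrightarrow> f i \<in> carrier P" "\<And>i. i \<in> I \<Longrightarrow> deg R (f i) \<le> n"
  shows "deg R (\<Oplus>\<^bsub>P\<^esub>i \<in> I. f i) \<le> n"
  using assms
proof (induction I rule: finite_induct)
  case (insert i I)
  let ?s = "\<Oplus>\<^bsub>P\<^esub>i \<in> I. f i"
  have "?s \<in> carrier P" by (rule P.finsum_closed) (use insert in auto)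
  then have "deg R (f i \<oplus>\<^sub>P ?s) \<le> max (deg R (f i)) (deg R ?s)"
    using insert by (intro deg_add) auto
  also have "\<dots> \<le> n" using insert by (intro max.boundedI) auto
  finally show ?case using insert by (simp add: Pi_def)
qed simp

lemma deg_hom_subst_le:
  assumes "p \<in> carrier P" "u \<in> carrier P" "w \<in> carrier P" "deg R u \<le> 1" "deg R w \<le> 1"
  shows "deg R (hom_subst R n p u w) \<le> n"
  unfolding hom_subst_alt
proof (rule deg_finsum_le)
  fix i assume i: "i \<in> {..n}"
  have "deg R (up_ring.coeff P p i \<odot>\<^sub>P (u [^]\<^bsub>P\<^esub> i \<otimes>\<^sub>P w [^]\<^bsub>P\<^esub> (n - i))) \<le> deg R (u [^]\<^bsub>P\<^esub> i \<otimes>\<^sub>P w [^]\<^bsub>P\<^esub> (n - i))"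
    using assms by (intro deg_smult_decr) auto
  also have "\<dots> \<le> deg R (u [^]\<^bsub>P\<^esub> i) + deg R (w [^]\<^bsub>P\<^esub> (n - i))"
    using assms by (intro deg_mult_ring) auto
  also have "\<dots> \<le> i + (n - i)" using assms by (intro add_mono deg_pow_le)
  finally show "deg R (up_ring.coeff P p i \<odot>\<^sub>P (u [^]\<^bsub>P\<^esub> i \<otimes>\<^sub>P w [^]\<^bsub>P\<^esub> (n - i))) \<le> n" using i by simp
qed (use assms in auto)

lemma Conj_iff:
  assumes M: "a \<in> carrier R" "b \<in> carrier R" "c \<in> carrier R" "e \<in> carrier R" "det2 a b c e \<noteq> \<zero>"
    and pq: "coprime_polys R p q" and n: "n = max (deg R p) (deg R q)"
  shows "mobius R a b c e \<in> Conj R (fraction R p q) \<psi> \<longleftrightarrow>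
    fraction R (hom_subst R n (a \<odot>\<^sub>P p \<oplus>\<^sub>P b \<odot>\<^sub>P q) (lin e (\<ominus> b)) (lin (\<ominus> c) a))
      (hom_subst R n (c \<odot>\<^sub>P p \<oplus>\<^sub>P e \<odot>\<^sub>P q) (lin e (\<ominus> b)) (lin (\<ominus> c) a)) = \<psi>"
proof -
  have M': "e \<in> carrier R" "\<ominus> b \<in> carrier R" "\<ominus> c \<in> carrier R" "a \<in> carrier R" "det2 e (\<ominus> b) (\<ominus> c) a \<noteq> \<zero>"
    using M by (auto simp: adjugate_det2)
  have "mobius R a b c e \<in> carrier (PGL2 R)" using M unfolding carrier_PGL2 by blast
  then show ?thesis
    unfolding Conj_def mem_Collect_eq inv_mobius [OF M] ratfun_comp_mobius_left [OF M pq]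
      mobius_eq_fraction [of e]
    by (subst ratfun_comp_fraction [OF coprime_polys_comb [OF M pq] coprime_polys_lin [OF M']])
      (simp_all add: deg_comb [OF M pq] n)
qed

text \<open>
  The equality of fractions yields a common polynomial factor only. It is constant because substituting
  linear polynomials into a form of degree \<open>n\<close> does not raise the degree above \<open>n\<close>, which the coprime
  representative of the right-hand side already attains.
\<close>

lemma Conj_mobius_D:
  assumes M: "a \<in> carrier R" "b \<in> carrier R" "c \<in> carrier R" "e \<in> carrier R" "det2 a b c e \<noteq> \<zero>"
    and pq: "coprime_polys R p q" and n: "n = max (deg R p) (deg R q)"
    and pq': "coprime_polys R p' q'" and n': "n = max (deg R p') (deg R q')"
    and conj: "mobius R a b c e \<in> Conj R (fraction R p q) (fraction R p' q')"
  obtains t where "t \<in> carrier R" "t \<noteq> \<zero>"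
    "hom_subst R n (a \<odot>\<^sub>P p \<oplus>\<^sub>P b \<odot>\<^sub>P q) (lin e (\<ominus> b)) (lin (\<ominus> c) a) = t \<odot>\<^sub>P p'"
    "hom_subst R n (c \<odot>\<^sub>P p \<oplus>\<^sub>P e \<odot>\<^sub>P q) (lin e (\<ominus> b)) (lin (\<ominus> c) a) = t \<odot>\<^sub>P q'"
proof -
  note cl = coprime_polys_closed [OF pq] coprime_polys_closed [OF pq']
  define f g where "f = hom_subst R n (a \<odot>\<^sub>P p \<oplus>\<^sub>P b \<odot>\<^sub>P q) (lin e (\<ominus> b)) (lin (\<ominus> c) a)"
    and "g = hom_subst R n (c \<odot>\<^sub>P p \<oplus>\<^sub>P e \<odot>\<^sub>P q) (lin e (\<ominus> b)) (lin (\<ominus> c) a)"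
  have fg: "f \<in> carrier P" "g \<in> carrier P" using M cl by (auto simp: f_def g_def)
  have deg: "deg R f \<le> n" "deg R g \<le> n"
    unfolding f_def g_def using M cl deg_lin_le by (auto intro!: deg_hom_subst_le)
  have eq: "fraction R f g = fraction R p' q'"
    using conj unfolding Conj_iff [OF M pq n] f_def g_def .
  have "(p', q') \<in> fraction R f g"
    unfolding eq using cl coprime_polys_nonzero [OF pq'] by (intro fraction_self)
  then have "p' \<otimes>\<^sub>P g = f \<otimes>\<^sub>P q'" using fg cl by (simp add: fraction_iff)
  then obtain h where h: "h \<in> carrier P" "f = h \<otimes>\<^sub>P p'" "g = h \<otimes>\<^sub>P q'"
    using proportional_to_coprime [OF pq' fg] by metis
  have h0: "h \<noteq> \<zero>\<^sub>P"
  proof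
    assume "h = \<zero>\<^sub>P"
    then have "f = \<zero>\<^sub>P" "g = \<zero>\<^sub>P" using h cl by auto
    then have "(\<one>\<^sub>P, \<zero>\<^sub>P) \<in> fraction R f g" "(\<zero>\<^sub>P, \<one>\<^sub>P) \<in> fraction R f g"
      by (simp_all add: fraction_iff UP_one_not_zero)
    then have "p' \<otimes>\<^sub>P \<zero>\<^sub>P = \<one>\<^sub>P \<otimes>\<^sub>P q'" "p' \<otimes>\<^sub>P \<one>\<^sub>P = \<zero>\<^sub>P \<otimes>\<^sub>P q'"
      unfolding eq fraction_iff by blast+
    then have "q' = \<zero>\<^sub>P" "p' = \<zero>\<^sub>P"
      using cl(3,4) by (metis P.r_null P.l_one, metis P.l_null P.r_one)
    then show False using coprime_polys_nonzero [OF pq'] by blast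
  qed
  have "deg R h = 0"
  proof -
    consider "p' \<noteq> \<zero>\<^sub>P" "deg R p' = n" | "q' \<noteq> \<zero>\<^sub>P" "deg R q' = n"
      using coprime_polys_nonzero [OF pq'] n'
      by (cases "p' = \<zero>\<^sub>P"; cases "q' = \<zero>\<^sub>P") (auto simp: max_def split: if_splits)
    then show ?thesis
      by cases (use deg_mult [OF h0 _ h(1)] cl h deg in fastforce)+
  qed
  then have "h = up_ring.monom P (up_ring.coeff P h 0) 0" using deg_zero_impl_monom [OF h(1)] by simp
  then obtain t where t: "t \<in> carrier R" "h = up_ring.monom P t 0" using h(1) coeff_closed by metis
  then have "t \<noteq> \<zero>" using h0 by auto
  then show ?thesis using that [of t] t h cl unfolding f_def g_def by (simp add: monom_mult_is_smult)
qed

lemma Conj_mobius_I: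
  assumes M: "a \<in> carrier R" "b \<in> carrier R" "c \<in> carrier R" "e \<in> carrier R" "det2 a b c e \<noteq> \<zero>"
    and pq: "coprime_polys R p q" and n: "n = max (deg R p) (deg R q)"
    and pq': "p' \<in> carrier P" "q' \<in> carrier P" and t: "t \<in> carrier R" "t \<noteq> \<zero>"
    and "hom_subst R n (a \<odot>\<^sub>P p \<oplus>\<^sub>P b \<odot>\<^sub>P q) (lin e (\<ominus> b)) (lin (\<ominus> c) a) = t \<odot>\<^sub>P p'"
    "hom_subst R n (c \<odot>\<^sub>P p \<oplus>\<^sub>P e \<odot>\<^sub>P q) (lin e (\<ominus> b)) (lin (\<ominus> c) a) = t \<odot>\<^sub>P q'"
  shows "mobius R a b c e \<in> Conj R (fraction R p q) (fraction R p' q')"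
  unfolding Conj_iff [OF M pq n] assms(12,13) using t pq' by (rule fraction_smult)

lemma mobius_eqD:
  assumes M: "a \<in> carrier R" "b \<in> carrier R" "c \<in> carrier R" "e \<in> carrier R" "det2 a b c e \<noteq> \<zero>"
    "a' \<in> carrier R" "b' \<in> carrier R" "c' \<in> carrier R" "e' \<in> carrier R" "det2 a' b' c' e' \<noteq> \<zero>"
    and eq: "mobius R a b c e = mobius R a' b' c' e'"
  obtains t where "t \<in> carrier R" "t \<noteq> \<zero>" "a' = t \<otimes> a" "b' = t \<otimes> b" "c' = t \<otimes> c" "e' = t \<otimes> e"
proof -
  note cop = coprime_polys_lin [OF M(1-5)] coprime_polys_lin [OF M(6-10)]
  have "(lin a' b', lin c' e') \<in> fraction R (lin a b) (lin c e)"
    using eq cop coprime_polys_nonzero [OF cop(2)] M by (simp add: mobius_eq_fraction fraction_self)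
  then obtain t where "t \<in> carrier R" "t \<noteq> \<zero>" "lin a' b' = t \<odot>\<^sub>P lin a b" "lin c' e' = t \<odot>\<^sub>P lin c e"
    using coprime_representatives [OF cop] by (auto simp: fraction_iff)
  then show ?thesis using that [of t] M by (simp add: smult_lin lin_inject)
qed

text \<open>
  If the degree does not drop on passing to lowest terms, then no factor has been cancelled. This turns
  good reduction, which is defined by a degree, into coprimality of the reduced polynomials.
\<close>

lemma coprime_of_degree:
  assumes "p \<in> carrier P" "q \<in> carrier P" "p \<noteq> \<zero>\<^sub>P \<or> q \<noteq> \<zero>\<^sub>P" "deg R p \<le> n" "deg R q \<le> n"
    and deg: "ratfun_degree R (fraction R p q) = n"
  shows "coprime_polys R p q" "max (deg R p) (deg R q) = n"
proof -
  obtain h p0 q0 where h: "coprime_polys R p0 q0" "fraction R p q = fraction R p0 q0"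
    "h \<in> carrier P" "h \<noteq> \<zero>\<^sub>P" "p = h \<otimes>\<^sub>P p0" "q = h \<otimes>\<^sub>P q0"
    using rational_functions_coprime [OF assms(1-3)] by metis
  note cl = coprime_polys_closed [OF h(1)]
  have n: "max (deg R p0) (deg R q0) = n" using deg h ratfun_degree_fraction by simp
  have "deg R h = 0"
  proof -
    consider "p0 \<noteq> \<zero>\<^sub>P" "deg R p0 = n" | "q0 \<noteq> \<zero>\<^sub>P" "deg R q0 = n"
      using coprime_polys_nonzero [OF h(1)] n
      by (cases "p0 = \<zero>\<^sub>P"; cases "q0 = \<zero>\<^sub>P") (auto simp: max_def split: if_splits)
    then show ?thesis
      by cases (use deg_mult [OF h(4) _ h(3)] cl h assms(4,5) in fastforce)+
  qed
  then have "h = up_ring.monom P (up_ring.coeff P h 0) 0" using deg_zero_impl_monom [OF h(3)] by simp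
  then obtain t where t: "t \<in> carrier R" "h = up_ring.monom P t 0" using h(3) coeff_closed by metis
  then have t0: "t \<noteq> \<zero>" using h(4) by auto
  have "p = t \<odot>\<^sub>P p0" "q = t \<odot>\<^sub>P q0" using h(5,6) t cl by (simp_all add: monom_mult_is_smult)
  then show "coprime_polys R p q" "max (deg R p) (deg R q) = n"
    using coprime_polys_smult [OF h(1) t(1) t0] n t t0 cl by simp_all
qed

end

section \<open>Binary forms and conjugation\<close>

text \<open>
  Over a field that is a type, polynomials of type \<open>'a poly\<close> are more convenient. The names \<open>coeff\<close> and
  \<open>degree\<close> also denote operations of abstract polynomial rings.
\<close>

abbreviation pcoeff :: "'a::zero poly \<Rightarrow> nat \<Rightarrow> 'a" where "pcoeff \<equiv> Polynomial.coeff"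
abbreviation pdeg :: "'a::zero poly \<Rightarrow> nat" where "pdeg \<equiv> Polynomial.degree"

text \<open>
  A polynomial \<open>p\<close> of degree at most \<open>n\<close> stands for the binary form \<open>y\<^sup>n p(x / y)\<close> of degree \<open>n\<close>.
\<close>

definition hom_eval :: "nat \<Rightarrow> 'a::comm_ring_1 poly \<Rightarrow> 'a \<Rightarrow> 'a \<Rightarrow> 'a" where
  "hom_eval n p x y = (\<Sum>i\<le>n. pcoeff p i * (x ^ i * y ^ (n - i)))"

text \<open>
  \<open>hom_subst\<close> for polynomials of type \<open>'a poly\<close>
\<close>

definition hom_comp :: "nat \<Rightarrow> 'a::comm_ring_1 poly \<Rightarrow> 'a poly \<Rightarrow> 'a poly \<Rightarrow> 'a poly" where
  "hom_comp n p u w = (\<Sum>i\<le>n. Polynomial.smult (pcoeff p i) (u ^ i * w ^ (n - i)))"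

lemma poly_hom_comp: "poly (hom_comp n p u w) z = hom_eval n p (poly u z) (poly w z)"
  by (simp add: hom_comp_def hom_eval_def poly_sum)

lemma hom_eval_scale: "hom_eval n p (c * x) (c * y) = c ^ n * hom_eval n p x y"
  unfolding hom_eval_def sum_distrib_left
proof (intro sum.cong refl)
  fix i assume "i \<in> {..n}"
  then have "c ^ n = c ^ i * c ^ (n - i)" by (simp add: power_add [symmetric])
  then show "pcoeff p i * ((c * x) ^ i * (c * y) ^ (n - i)) = c ^ n * (pcoeff p i * (x ^ i * y ^ (n - i)))"
    by (simp add: power_mult_distrib mult_ac)
qed

lemma hom_eval_comb:
  "hom_eval n (Polynomial.smult a p + Polynomial.smult b q) x y = a * hom_eval n p x y + b * hom_eval n q x y"
  by (simp add: hom_eval_def algebra_simps sum.distrib sum_distrib_left)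

lemma hom_eval_at_one:
  assumes "pdeg p \<le> n"
  shows "hom_eval n p z 1 = poly p z"
proof -
  have "poly p z = (\<Sum>i\<le>n. pcoeff p i * z ^ i)"
    unfolding poly_altdef using assms by (intro sum.mono_neutral_left) (auto simp: coeff_eq_0)
  then show ?thesis by (simp add: hom_eval_def)
qed

lemma hom_eval_infinity: "hom_eval n p x 0 = pcoeff p n * x ^ n"
proof -
  have "hom_eval n p x 0 = (\<Sum>i\<in>{n}. pcoeff p i * (x ^ i * 0 ^ (n - i)))"
    unfolding hom_eval_def by (intro sum.mono_neutral_right) (auto simp: power_0_left split: if_splits)
  then show ?thesis by simp
qed

lemma hom_eval_eq_poly:
  fixes y :: "'a::field"
  assumes "pdeg p \<le> n" "y \<noteq> 0"
  shows "hom_eval n p x y = y ^ n * poly p (x / y)"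
  using hom_eval_scale [of n p y "x / y" 1] hom_eval_at_one [OF assms(1)] assms(2) by simp

lemma poly_eqI_nonzero:
  fixes f g :: "'a::field_char_0 poly"
  assumes "\<And>z. z \<noteq> 0 \<Longrightarrow> poly f z = poly g z"
  shows "f = g"
proof (rule ccontr)
  assume "f \<noteq> g"
  then have "finite {z. poly (f - g) z = 0}" by (intro poly_roots_finite) simp
  moreover have "UNIV - {0} \<subseteq> {z. poly (f - g) z = 0}" using assms by auto
  ultimately have "finite (UNIV - {0::'a})" by (rule rev_finite_subset)
  then show False by (simp add: infinite_UNIV_char_0)
qed

text \<open>
  A polynomial identity in \<open>z = x / y\<close> is turned into an identity of forms at all points of the plane.
\<close>

lemma hom_comp_identity_eval:
  fixes r :: "'a::field_char_0 poly"
  assumes eq: "hom_comp n r [:-b, e:] [:a, -c:] = Polynomial.smult t p" and deg: "pdeg p \<le> n"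
  shows "hom_eval n r (e * x - b * y) (a * y - c * x) = t * hom_eval n p x y"
proof -
  have nz: "hom_eval n r (e * x - b * y) (a * y - c * x) = t * hom_eval n p x y" if "y \<noteq> 0" for x y
  proof -
    have "poly (hom_comp n r [:-b, e:] [:a, -c:]) (x / y) = t * poly p (x / y)" by (simp add: eq)
    then have *: "hom_eval n r (e * (x / y) - b) (a - c * (x / y)) = t * poly p (x / y)"
      by (simp add: poly_hom_comp algebra_simps)
    have "e * x - b * y = y * (e * (x / y) - b)" "a * y - c * x = y * (a - c * (x / y))"
      using that by (simp_all add: field_simps)
    then have "hom_eval n r (e * x - b * y) (a * y - c * x) =
        y ^ n * hom_eval n r (e * (x / y) - b) (a - c * (x / y))"
      by (simp only: hom_eval_scale)
    then show ?thesis using * hom_eval_eq_poly [OF deg that] by simp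
  qed
  \<comment> \<open>both sides are polynomials in \<open>y\<close>, so the case \<open>y = 0\<close> follows\<close>
  let ?f = "hom_comp n r [:e * x, -b:] [:-c * x, a:]" and ?g = "Polynomial.smult t (hom_comp n p [:x:] [:0, 1:])"
  have fg: "poly ?f z = hom_eval n r (e * x - b * z) (a * z - c * x)" "poly ?g z = t * hom_eval n p x z" for z
    by (simp_all add: poly_hom_comp algebra_simps)
  have "?f = ?g"
    by (rule poly_eqI_nonzero) (unfold fg, rule nz)
  then show ?thesis by (metis fg)
qed

text \<open>
  At a finite point this is the Bezout identity; at infinity, one of the coefficients of degree \<open>n\<close> is
  nonzero.
\<close>

lemma no_common_zero:
  fixes p q :: "'a::field poly"
  assumes "A * p + B * q = 1" "n = max (pdeg p) (pdeg q)" "x \<noteq> 0 \<or> y \<noteq> 0"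
  shows "hom_eval n p x y \<noteq> 0 \<or> hom_eval n q x y \<noteq> 0"
proof (cases "y = 0")
  case True
  have "pcoeff p n \<noteq> 0 \<or> pcoeff q n \<noteq> 0"
  proof (rule ccontr)
    assume *: "\<not> ?thesis"
    have "p = 0 \<or> pdeg p \<noteq> n" "q = 0 \<or> pdeg q \<noteq> n"
      using * by (metis leading_coeff_0_iff)+
    then have "p = 0 \<and> q = 0" using assms(2) by (auto simp: max_def split: if_splits)
    then show False using assms(1) by simp
  qed
  then show ?thesis using True assms(3) by (auto simp: hom_eval_infinity)
next
  case False
  have "poly A (x/y) * poly p (x/y) + poly B (x/y) * poly q (x/y) = 1"
    using arg_cong [OF assms(1), of "\<lambda>f. poly f (x/y)"] by simp
  then have "poly p (x/y) \<noteq> 0 \<or> poly q (x/y) \<noteq> 0" by auto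
  then show ?thesis using False hom_eval_eq_poly [of p n y x] hom_eval_eq_poly [of q n y x] assms(2)
    by auto
qed

text \<open>
  Eigenvectors need not exist over \<open>K\<close> itself. A Bezout identity and the identity that expresses a
  conjugation are polynomial identities, which survive the extension of scalars.
\<close>

abbreviation ac_poly :: "'a::field poly \<Rightarrow> 'a alg_closure poly" where
  "ac_poly \<equiv> map_poly to_ac"

lemma pcoeff_ac_poly [simp]: "pcoeff (ac_poly p) i = to_ac (pcoeff p i)"
  by (simp add: coeff_map_poly)

lemma ac_poly_add [simp]: "ac_poly (p + q) = ac_poly p + ac_poly q"
  by (rule poly_eqI) simp

lemma ac_poly_mult [simp]: "ac_poly (p * q) = ac_poly p * ac_poly q"
  by (rule poly_eqI) (simp add: coeff_mult to_ac_sum)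

lemma ac_poly_power [simp]: "ac_poly (p ^ k) = ac_poly p ^ k"
  by (induction k) simp_all

lemma ac_poly_smult [simp]: "ac_poly (Polynomial.smult c p) = Polynomial.smult (to_ac c) (ac_poly p)"
  by (rule poly_eqI) simp

lemma ac_poly_sum: "ac_poly (\<Sum>i\<in>I. f i) = (\<Sum>i\<in>I. ac_poly (f i))"
  by (induction I rule: infinite_finite_induct) simp_all

lemma ac_poly_hom_comp: "ac_poly (hom_comp n p u w) = hom_comp n (ac_poly p) (ac_poly u) (ac_poly w)"
  by (simp add: hom_comp_def ac_poly_sum)

lemma pdeg_ac_poly [simp]: "pdeg (ac_poly p) = pdeg p"
  by (simp add: degree_map_poly)

text \<open>
  With \<open>M = (a, b; c, e)\<close>, \<open>F = (p, q)\<close> and \<open>G = (p', q')\<close>, this is \<open>M F adj(M) = t G\<close> as maps of the plane.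
\<close>

definition conj_eval where
  "conj_eval n p q p' q' a b c e t \<longleftrightarrow> (\<forall>x y.
     a * hom_eval n p (e * x - b * y) (a * y - c * x) + b * hom_eval n q (e * x - b * y) (a * y - c * x)
       = t * hom_eval n p' x y \<and>
     c * hom_eval n p (e * x - b * y) (a * y - c * x) + e * hom_eval n q (e * x - b * y) (a * y - c * x)
       = t * hom_eval n q' x y)"

text \<open>
  The same identity between polynomials in \<open>z = x / y\<close>. It can be reduced modulo a place, and it can be
  carried over to the algebraic closure.
\<close>

definition conj_poly where
  "conj_poly n p q p' q' a b c e t \<longleftrightarrow>
    hom_comp n (Polynomial.smult a p + Polynomial.smult b q) [:-b, e:] [:a, -c:] = Polynomial.smult t p' \<and>
    hom_comp n (Polynomial.smult c p + Polynomial.smult e q) [:-b, e:] [:a, -c:] = Polynomial.smult t q'"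

lemma conj_eval_of_conj_poly:
  fixes p :: "'a::field_char_0 poly"
  assumes "conj_poly n p q p' q' a b c e t" "pdeg p' \<le> n" "pdeg q' \<le> n"
  shows "conj_eval n p q p' q' a b c e t"
proof -
  note eqs = assms(1) [unfolded conj_poly_def]
  show ?thesis
    unfolding conj_eval_def hom_eval_comb [symmetric]
    using hom_comp_identity_eval [OF conjunct1 [OF eqs] assms(2)]
      hom_comp_identity_eval [OF conjunct2 [OF eqs] assms(3)] by blast
qed

lemma conj_poly_ac:
  assumes "conj_poly n p q p' q' a b c e t"
  shows "conj_poly n (ac_poly p) (ac_poly q) (ac_poly p') (ac_poly q')
    (to_ac a) (to_ac b) (to_ac c) (to_ac e) (to_ac t)"
proof -
  have "ac_poly (hom_comp n (Polynomial.smult a p + Polynomial.smult b q) [:-b, e:] [:a, -c:]) =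
     ac_poly (Polynomial.smult t p')"
    "ac_poly (hom_comp n (Polynomial.smult c p + Polynomial.smult e q) [:-b, e:] [:a, -c:]) =
     ac_poly (Polynomial.smult t q')"
    using assms unfolding conj_poly_def by simp_all
  then show ?thesis by (simp add: conj_poly_def ac_poly_hom_comp map_poly_pCons)
qed

text \<open>
  For \<open>S = (s11, s12; s21, s22)\<close> this is \<open>S F = \<mu> F S\<close>: the map given by \<open>S\<close> is an automorphism of the
  rational function \<open>p / q\<close>.
\<close>

definition commutes_eval where
  "commutes_eval n p q s11 s12 s21 s22 \<mu> \<longleftrightarrow> (\<forall>x y.
     s11 * hom_eval n p x y + s12 * hom_eval n q x y
       = \<mu> * hom_eval n p (s11 * x + s12 * y) (s21 * x + s22 * y) \<and>
     s21 * hom_eval n p x y + s22 * hom_eval n q x y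
       = \<mu> * hom_eval n q (s11 * x + s12 * y) (s21 * x + s22 * y))"

text \<open>
  Here \<open>S = adj(M') M\<close>. Substituting \<open>M x\<close> into the first identity gives \<open>det(M)\<^sup>n M F(x) = t G(M x)\<close>;
  then \<open>adj(M')\<close> is applied to both sides and the second identity is used at \<open>M x\<close>.
\<close>

lemma commutes_of_conj_eval:
  fixes p :: "'a::field poly"
  assumes f: "conj_eval n p q p' q' a b c e t" and g: "conj_eval n p q p' q' a' b' c' e' t'"
    and nz: "a * e - b * c \<noteq> 0" "t \<noteq> 0" "t' \<noteq> 0" "a' * e' - b' * c' \<noteq> 0"
  obtains \<mu> where "\<mu> \<noteq> 0"
    "commutes_eval n p q (e' * a - b' * c) (e' * b - b' * e) (a' * c - c' * a) (a' * e - c' * b) \<mu>"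
proof -
  define \<delta> \<delta>' where "\<delta> = a * e - b * c" and "\<delta>' = a' * e' - b' * c'"
  define \<mu> where "\<mu> = t * \<delta>' / (t' * \<delta> ^ n)"
  define s11 s12 s21 s22 where "s11 = e' * a - b' * c" and "s12 = e' * b - b' * e"
    and "s21 = a' * c - c' * a" and "s22 = a' * e - c' * b"
  note s_def = s11_def s12_def s21_def s22_def
  have "s11 * hom_eval n p x y + s12 * hom_eval n q x y
       = \<mu> * hom_eval n p (s11 * x + s12 * y) (s21 * x + s22 * y) \<and>
     s21 * hom_eval n p x y + s22 * hom_eval n q x y
       = \<mu> * hom_eval n q (s11 * x + s12 * y) (s21 * x + s22 * y)" for x y
  proof -
    define u w where "u = a * x + b * y" and "w = c * x + e * y"
    define P0 Q0 where "P0 = hom_eval n p x y" and "Q0 = hom_eval n q x y"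
    define P' Q' where "P' = hom_eval n p' u w" and "Q' = hom_eval n q' u w"
    define P1 Q1 where "P1 = hom_eval n p (s11 * x + s12 * y) (s21 * x + s22 * y)"
      and "Q1 = hom_eval n q (s11 * x + s12 * y) (s21 * x + s22 * y)"
    have 1: "e * u - b * w = \<delta> * x" "a * w - c * u = \<delta> * y"
      by (simp_all add: u_def w_def \<delta>_def algebra_simps)
    have 2: "e' * u - b' * w = s11 * x + s12 * y" "a' * w - c' * u = s21 * x + s22 * y"
      by (simp_all add: u_def w_def s_def algebra_simps)
    have f1: "a * (\<delta> ^ n * P0) + b * (\<delta> ^ n * Q0) = t * P'" "c * (\<delta> ^ n * P0) + e * (\<delta> ^ n * Q0) = t * Q'"
      using f unfolding conj_eval_def P'_def Q'_def P0_def Q0_def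
      by (metis 1 hom_eval_scale)+
    have g1: "a' * P1 + b' * Q1 = t' * P'" "c' * P1 + e' * Q1 = t' * Q'"
      using g unfolding conj_eval_def P'_def Q'_def P1_def Q1_def by (metis 2)+
    have "t' * \<delta> ^ n * (s11 * P0 + s12 * Q0) =
      t' * (e' * (a * (\<delta> ^ n * P0) + b * (\<delta> ^ n * Q0)) - b' * (c * (\<delta> ^ n * P0) + e * (\<delta> ^ n * Q0)))"
      by (simp add: s_def algebra_simps)
    also have "\<dots> = t * (e' * (t' * P') - b' * (t' * Q'))" unfolding f1 by (simp add: algebra_simps)
    also have "\<dots> = t * \<delta>' * P1" unfolding g1 [symmetric] by (simp add: \<delta>'_def algebra_simps)
    finally have A: "t' * \<delta> ^ n * (s11 * P0 + s12 * Q0) = t * \<delta>' * P1" .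
    have "t' * \<delta> ^ n * (s21 * P0 + s22 * Q0) =
      t' * (a' * (c * (\<delta> ^ n * P0) + e * (\<delta> ^ n * Q0)) - c' * (a * (\<delta> ^ n * P0) + b * (\<delta> ^ n * Q0)))"
      by (simp add: s_def algebra_simps)
    also have "\<dots> = t * (a' * (t' * Q') - c' * (t' * P'))" unfolding f1 by (simp add: algebra_simps)
    also have "\<dots> = t * \<delta>' * Q1" unfolding g1 [symmetric] by (simp add: \<delta>'_def algebra_simps)
    finally have B: "t' * \<delta> ^ n * (s21 * P0 + s22 * Q0) = t * \<delta>' * Q1" .
    show ?thesis unfolding P0_def [symmetric] Q0_def [symmetric] P1_def [symmetric] Q1_def [symmetric] \<mu>_def
      using A B nz by (simp add: field_simps \<delta>_def)
  qed
  moreover have "\<mu> \<noteq> 0" using nz by (simp add: \<mu>_def \<delta>_def \<delta>'_def)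
  ultimately show ?thesis using that unfolding commutes_eval_def s_def by blast
qed

section \<open>Automorphisms of a rational function have finite order\<close>

text \<open>
  The polynomial is affine along the progression \<open>0, h, 2 h, \<dots>\<close>, which is infinite in characteristic 0.
\<close>

lemma second_difference_affine:
  fixes f :: "'a::field_char_0 poly"
  assumes h: "h \<noteq> 0" and diff: "\<And>T. poly f (T + 2 * h) - 2 * poly f (T + h) + poly f T = 0"
  obtains A B where "f = [:A, B:]"
proof -
  define A B where "A = poly f 0" and "B = (poly f h - poly f 0) / h"
  have *: "poly f (of_nat k * h) = A + of_nat k * h * B" for k
  proof (induction k rule: less_induct)
    case (less k)
    consider "k = 0" | "k = 1" | j where "k = j + 2" by (metis One_nat_def add_2_eq_Suc' not0_implies_Suc)
    then show ?case
    proof cases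
      case (3 j)
      have "poly f (of_nat j * h + 2 * h) = 2 * poly f (of_nat j * h + h) - poly f (of_nat j * h)"
        using diff [of "of_nat j * h"] by (simp add: algebra_simps)
      moreover have "of_nat j * h + 2 * h = of_nat k * h" "of_nat j * h + h = of_nat (Suc j) * h"
        using 3 by (simp_all add: algebra_simps)
      ultimately show ?thesis using less [of j] less [of "Suc j"] 3 by (simp add: algebra_simps)
    qed (use h in \<open>auto simp: A_def B_def\<close>)
  qed
  have "f = [:A, B:]"
  proof (rule ccontr)
    assume "f \<noteq> [:A, B:]"
    then have "finite {z. poly (f - [:A, B:]) z = 0}" by (intro poly_roots_finite) simp
    moreover have "range (\<lambda>k. of_nat k * h) \<subseteq> {z. poly (f - [:A, B:]) z = 0}"
      using * by (auto simp: algebra_simps)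
    ultimately have "finite (range (\<lambda>k::nat. of_nat k * h))" by (rule rev_finite_subset)
    moreover have "inj (\<lambda>k::nat. of_nat k * h)" using h by (auto intro: injI)
    ultimately show False using finite_imageD by fastforce
  qed
  then show ?thesis using that by blast
qed

text \<open>
  The coefficient of \<open>T\<^sup>n\<close> in \<open>p(x + T y)\<close> is \<open>p(y)\<close>, which an affine function does not have for \<open>n \<ge> 2\<close>. To
  read off this coefficient, \<open>T\<close> is replaced by its inverse: the reversed polynomial at \<open>0\<close> is \<open>p(y)\<close>.
\<close>

lemma hom_eval_affine_line_zero:
  fixes p :: "'a::field_char_0 poly"
  assumes "hom_comp n p [:x1, y1:] [:x2, y2:] = [:A, B:]" "n \<ge> 2"
  shows "hom_eval n p y1 y2 = 0"
proof -
  have "poly (hom_comp n p [:y1, x1:] [:y2, x2:]) T = poly (Polynomial.smult A ([:0,1:] ^ n) + Polynomial.smult B ([:0,1:] ^ (n - 1))) T"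
    if "T \<noteq> 0" for T
  proof -
    have "hom_eval n p (y1 + T * x1) (y2 + T * x2) = T ^ n * hom_eval n p (x1 + (1/T) * y1) (x2 + (1/T) * y2)"
      using that by (subst hom_eval_scale [symmetric]) (simp add: algebra_simps)
    also have "hom_eval n p (x1 + (1/T) * y1) (x2 + (1/T) * y2) = A + (1/T) * B"
      using arg_cong [OF assms(1), of "\<lambda>f. poly f (1/T)"] by (simp add: poly_hom_comp)
    also have "T ^ n * (A + (1/T) * B) = A * T ^ n + B * T ^ (n - 1)"
    proof -
      have "T ^ n = T * T ^ (n - 1)" using assms(2) by (cases n) auto
      then show ?thesis using that by (simp add: field_simps)
    qed
    finally show ?thesis by (simp add: poly_hom_comp)
  qed
  then have "hom_comp n p [:y1, x1:] [:y2, x2:] = Polynomial.smult A ([:0,1:] ^ n) + Polynomial.smult B ([:0,1:] ^ (n - 1))"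
    by (rule poly_eqI_nonzero)
  from arg_cong [OF this, of "\<lambda>f. poly f 0"] show ?thesis
    using assms(2) by (simp add: poly_hom_comp power_0_left)
qed

lemma eigenvalue_of_matrix:
  fixes \<kappa> :: "'a::field"
  assumes "s11 * u1 + s12 * u2 = \<kappa> * u1" "s21 * u1 + s22 * u2 = \<kappa> * u2" "u1 \<noteq> 0 \<or> u2 \<noteq> 0"
  shows "\<kappa> ^ 2 - (s11 + s22) * \<kappa> + (s11 * s22 - s12 * s21) = 0"
proof -
  let ?D = "\<kappa> ^ 2 - (s11 + s22) * \<kappa> + (s11 * s22 - s12 * s21)"
  have "?D * u1 = (s22 - \<kappa>) * (s11 * u1 + s12 * u2 - \<kappa> * u1) - s12 * (s21 * u1 + s22 * u2 - \<kappa> * u2)"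
    "?D * u2 = (s11 - \<kappa>) * (s21 * u1 + s22 * u2 - \<kappa> * u2) - s21 * (s11 * u1 + s12 * u2 - \<kappa> * u1)"
    by (simp_all add: algebra_simps power2_eq_square)
  then have "?D * u1 = 0" "?D * u2 = 0" using assms(1,2) by simp_all
  then show ?thesis using assms(3) by auto
qed

text \<open>
  The vector \<open>(s12, \<alpha> - s11)\<close> is annihilated by \<open>S - \<alpha>\<close>. If it is zero, then \<open>(\<alpha> - s22, s21)\<close> serves, which is
  nonzero unless \<open>S\<close> is scalar.
\<close>

lemma eigenvector_exists:
  fixes \<alpha> :: "'a::field"
  assumes "\<alpha> ^ 2 - (s11 + s22) * \<alpha> + (s11 * s22 - s12 * s21) = 0"
    and "\<not> (s12 = 0 \<and> s21 = 0 \<and> s11 = s22)"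
  obtains u1 u2 where "u1 \<noteq> 0 \<or> u2 \<noteq> 0" "s11 * u1 + s12 * u2 = \<alpha> * u1" "s21 * u1 + s22 * u2 = \<alpha> * u2"
proof (cases "s12 = 0 \<and> s11 = \<alpha>")
  case False
  have "s11 * s12 + s12 * (\<alpha> - s11) = \<alpha> * s12" by (simp add: algebra_simps)
  moreover have "s21 * s12 + s22 * (\<alpha> - s11) = \<alpha> * (\<alpha> - s11)"
    using assms(1) by (simp add: algebra_simps power2_eq_square)
  ultimately show ?thesis using that [of s12 "\<alpha> - s11"] False by auto
next
  case True
  then show ?thesis using that [of "\<alpha> - s22" s21] assms(2) by (auto simp: algebra_simps)
qed

text \<open>
  By Cayley and Hamilton the matrix \<open>s / \<alpha>\<close> satisfies \<open>X\<^sup>2 - 2 X + 1 = 0\<close>; here it is applied twice to \<open>(x0, y0)\<close>.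
\<close>

lemma unipotent_second_difference:
  fixes \<alpha> :: "'a::field"
  assumes \<alpha>: "\<alpha> \<noteq> 0" and tr: "s11 + s22 = 2 * \<alpha>" and det: "s11 * s22 - s12 * s21 = \<alpha> ^ 2"
    and 0: "s11 * x0 + s12 * y0 = \<alpha> * x1" "s21 * x0 + s22 * y0 = \<alpha> * y1"
    and 1: "s11 * x1 + s12 * y1 = \<alpha> * x2"
  shows "x2 - 2 * x1 + x0 = 0"
proof -
  have "\<alpha> ^ 2 * x2 = s11 * (\<alpha> * x1) + s12 * (\<alpha> * y1)"
    using arg_cong [OF 1, of "(*) \<alpha>"] by (simp add: power2_eq_square algebra_simps)
  also have "\<dots> = (s11 + s22) * (s11 * x0 + s12 * y0) - (s11 * s22 - s12 * s21) * x0"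
    unfolding 0 [symmetric] by (simp add: algebra_simps)
  also have "\<dots> = \<alpha> ^ 2 * (2 * x1 - x0)"
    unfolding tr det 0(1) by (simp add: power2_eq_square algebra_simps)
  finally show ?thesis using \<alpha> by simp
qed

text \<open>
  This is the case of a translation. Let \<open>S = \<alpha> + N\<close> with \<open>N\<^sup>2 = 0\<close> and \<open>y = N x \<noteq> 0\<close>, and follow \<open>F\<close> along the
  line \<open>x + T y\<close>, which \<open>S\<close> maps to itself by a shift of \<open>T\<close>. Since \<open>N\<^sup>2 = 0\<close>, the second differences of
  \<open>F(x + T y)\<close> vanish, so it is affine in \<open>T\<close>; but its coefficient of \<open>T\<^sup>n\<close> is \<open>F(y) \<noteq> 0\<close>.
\<close>

lemma unipotent_not_commuting:
  fixes p q :: "'a::field_char_0 poly"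
  assumes comm: "commutes_eval n p q s11 s12 s21 s22 \<mu>" and n: "n \<ge> 2"
    and nz: "\<And>x y. x \<noteq> 0 \<or> y \<noteq> 0 \<Longrightarrow> hom_eval n p x y \<noteq> 0 \<or> hom_eval n q x y \<noteq> 0"
    and ns: "\<not> (s12 = 0 \<and> s21 = 0 \<and> s11 = s22)" and \<alpha>: "\<alpha> \<noteq> 0"
    and tr: "s11 + s22 = 2 * \<alpha>" and det: "s11 * s22 - s12 * s21 = \<alpha> ^ 2"
  shows False
proof -
  have s22: "s22 = 2 * \<alpha> - s11" using tr by (simp add: algebra_simps)
  define N where "N = (\<lambda>(x, y). ((s11 - \<alpha>) * x + s12 * y, s21 * x + (s22 - \<alpha>) * y))"
  have NN: "(s11 - \<alpha>) * (s11 - \<alpha>) + s12 * s21 = 0"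
    using det unfolding s22 by (simp add: algebra_simps power2_eq_square)
  have s22': "s22 - \<alpha> = - (s11 - \<alpha>)" by (simp add: s22)
  obtain x1 x2 where x: "N (x1, x2) \<noteq> (0, 0)"
  proof (cases "s12 = 0 \<and> s22 = \<alpha>")
    case True
    then show ?thesis using that [of 1 0] ns tr by (auto simp: N_def)
  next
    case False
    then show ?thesis using that [of 0 1] by (auto simp: N_def)
  qed
  obtain y1 y2 where y: "N (x1, x2) = (y1, y2)" by fastforce
  have N2: "(s11 - \<alpha>) * ((s11 - \<alpha>) * u + s12 * w) + s12 * (s21 * u - (s11 - \<alpha>) * w) = 0"
    "s21 * ((s11 - \<alpha>) * u + s12 * w) - (s11 - \<alpha>) * (s21 * u - (s11 - \<alpha>) * w) = 0" for u w
  proof -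
    have "(s11 - \<alpha>) * ((s11 - \<alpha>) * u + s12 * w) + s12 * (s21 * u - (s11 - \<alpha>) * w)
       = ((s11 - \<alpha>) * (s11 - \<alpha>) + s12 * s21) * u" by (simp add: algebra_simps)
    then show "(s11 - \<alpha>) * ((s11 - \<alpha>) * u + s12 * w) + s12 * (s21 * u - (s11 - \<alpha>) * w) = 0" by (simp add: NN)
    have "s21 * ((s11 - \<alpha>) * u + s12 * w) - (s11 - \<alpha>) * (s21 * u - (s11 - \<alpha>) * w)
       = ((s11 - \<alpha>) * (s11 - \<alpha>) + s12 * s21) * w" by (simp add: algebra_simps)
    then show "s21 * ((s11 - \<alpha>) * u + s12 * w) - (s11 - \<alpha>) * (s21 * u - (s11 - \<alpha>) * w) = 0" by (simp add: NN)
  qed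
  have y_def: "y1 = (s11 - \<alpha>) * x1 + s12 * x2" "y2 = s21 * x1 - (s11 - \<alpha>) * x2"
    using y by (auto simp: N_def s22' algebra_simps)
  have Sx: "s11 * x1 + s12 * x2 = \<alpha> * x1 + y1" "s21 * x1 + s22 * x2 = \<alpha> * x2 + y2"
    unfolding y_def by (simp_all add: s22 algebra_simps)
  have Sy: "s11 * y1 + s12 * y2 = \<alpha> * y1" "s21 * y1 + s22 * y2 = \<alpha> * y2"
    using N2 [of x1 x2] unfolding y_def [symmetric] by (simp_all add: s22 algebra_simps)
  have y0: "y1 \<noteq> 0 \<or> y2 \<noteq> 0" using x y by auto
  define F G where "F = hom_eval n p y1 y2" and "G = hom_eval n q y1 y2"
  have FG0: "F \<noteq> 0 \<or> G \<noteq> 0" using nz [OF y0] by (simp add: F_def G_def)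
  \<comment> \<open>the fixed point gives \<open>\<mu> \<alpha>\<^sup>n = \<alpha>\<close>\<close>
  have "s11 * F + s12 * G = \<mu> * \<alpha> ^ n * F" "s21 * F + s22 * G = \<mu> * \<alpha> ^ n * G"
    using comm unfolding commutes_eval_def F_def G_def by (simp_all add: Sy hom_eval_scale)
  then have "(\<mu> * \<alpha> ^ n) ^ 2 - (s11 + s22) * (\<mu> * \<alpha> ^ n) + (s11 * s22 - s12 * s21) = 0"
    using FG0 by (rule eigenvalue_of_matrix)
  then have "(\<mu> * \<alpha> ^ n - \<alpha>) ^ 2 = 0" unfolding tr det by (simp add: power2_eq_square algebra_simps)
  then have mu: "\<mu> * \<alpha> ^ n = \<alpha>" by simp
  define f g where "f = hom_comp n p [:x1, y1:] [:x2, y2:]" and "g = hom_comp n q [:x1, y1:] [:x2, y2:]"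
  define h where "h = 1 / \<alpha>"
  have h: "h \<noteq> 0" using \<alpha> by (simp add: h_def)
  have step: "s11 * poly f T + s12 * poly g T = \<alpha> * poly f (T + h)"
    "s21 * poly f T + s22 * poly g T = \<alpha> * poly g (T + h)" for T
  proof -
    have "s11 * (x1 + T * y1) + s12 * (x2 + T * y2) = (s11 * x1 + s12 * x2) + T * (s11 * y1 + s12 * y2)"
      "s21 * (x1 + T * y1) + s22 * (x2 + T * y2) = (s21 * x1 + s22 * x2) + T * (s21 * y1 + s22 * y2)"
      by (simp_all add: algebra_simps)
    then have S: "s11 * (x1 + T * y1) + s12 * (x2 + T * y2) = \<alpha> * (x1 + (T + h) * y1)"
      "s21 * (x1 + T * y1) + s22 * (x2 + T * y2) = \<alpha> * (x2 + (T + h) * y2)"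
      unfolding Sx Sy using \<alpha> by (simp_all add: h_def algebra_simps)
    show "s11 * poly f T + s12 * poly g T = \<alpha> * poly f (T + h)"
      "s21 * poly f T + s22 * poly g T = \<alpha> * poly g (T + h)"
      using comm [unfolded commutes_eval_def, rule_format, of "x1 + T * y1" "x2 + T * y2"]
      unfolding S hom_eval_scale mult.assoc [symmetric] mu by (simp_all add: f_def g_def poly_hom_comp)
  qed
  have "poly f (T + 2 * h) - 2 * poly f (T + h) + poly f T = 0"
    "poly g (T + 2 * h) - 2 * poly g (T + h) + poly g T = 0" for T
  proof -
    have 2: "T + h + h = T + 2 * h" by simp
    note s1 = step [of T] and s2 = step [of "T + h", unfolded 2]
    show "poly f (T + 2 * h) - 2 * poly f (T + h) + poly f T = 0"
      by (rule unipotent_second_difference [OF \<alpha> tr det s1 s2(1)])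
    show "poly g (T + 2 * h) - 2 * poly g (T + h) + poly g T = 0"
      by (rule unipotent_second_difference [of \<alpha> s22 s11 s21 s12 _ "poly f T" _ "poly f (T + h)"])
        (use \<alpha> tr det s1 s2 in \<open>simp_all add: algebra_simps\<close>)
  qed
  then obtain A B A' B' where "f = [:A, B:]" "g = [:A', B':]"
    using second_difference_affine [OF h] by metis
  then have "F = 0" "G = 0"
    using hom_eval_affine_line_zero n unfolding f_def g_def F_def G_def by blast+
  then show False using FG0 by simp
qed

text \<open>
  For an eigenvector \<open>x\<close> with eigenvalue \<open>\<kappa>\<close>, \<open>S F(x) = \<mu> F(\<kappa> x) = \<mu> \<kappa>\<^sup>n F(x)\<close> and \<open>F(x) \<noteq> 0\<close>, so \<open>\<mu> \<kappa>\<^sup>n\<close> is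
  an eigenvalue. Thus \<open>\<kappa> \<mapsto> \<mu> \<kappa>\<^sup>n\<close> maps \<open>{\<alpha>, \<beta>}\<close> to itself: it identifies the two, fixes them or
  exchanges them, which gives the exponents \<open>n\<close>, \<open>n - 1\<close> and \<open>n + 1\<close>.
\<close>

lemma automorphism_finite_order:
  fixes p q :: "'a::{field_char_0, alg_closed_field} poly"
  assumes comm: "commutes_eval n p q s11 s12 s21 s22 \<mu>" and n: "n \<ge> 2"
    and nz: "\<And>x y. x \<noteq> 0 \<or> y \<noteq> 0 \<Longrightarrow> hom_eval n p x y \<noteq> 0 \<or> hom_eval n q x y \<noteq> 0"
    and ns: "\<not> (s12 = 0 \<and> s21 = 0 \<and> s11 = s22)" and det: "s11 * s22 - s12 * s21 \<noteq> 0" and \<mu>: "\<mu> \<noteq> 0"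
  obtains \<alpha> \<beta> N where "\<alpha> \<noteq> \<beta>" "\<alpha> + \<beta> = s11 + s22" "\<alpha> * \<beta> = s11 * s22 - s12 * s21"
    "N \<in> {n - 1, n, n + 1}" "\<alpha> ^ N = \<beta> ^ N"
proof -
  define \<tau> \<delta> where "\<tau> = s11 + s22" and "\<delta> = s11 * s22 - s12 * s21"
  obtain r where r: "r ^ 2 = \<tau> ^ 2 - 4 * \<delta>" using nth_root_exists [of 2 "\<tau> ^ 2 - 4 * \<delta>"] by auto
  define \<alpha> \<beta> where "\<alpha> = (\<tau> + r) / 2" and "\<beta> = (\<tau> - r) / 2"
  have sum: "\<alpha> + \<beta> = \<tau>" by (simp add: \<alpha>_def \<beta>_def field_simps)
  have "4 * (\<alpha> * \<beta>) = \<tau> ^ 2 - r ^ 2" by (simp add: \<alpha>_def \<beta>_def field_simps power2_eq_square)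
  then have prod: "\<alpha> * \<beta> = \<delta>" by (simp add: r)
  have charpoly: "\<kappa> ^ 2 - \<tau> * \<kappa> + \<delta> = (\<kappa> - \<alpha>) * (\<kappa> - \<beta>)" for \<kappa>
    unfolding sum [symmetric] prod [symmetric] by (simp add: algebra_simps power2_eq_square)
  have ab0: "\<alpha> \<noteq> 0" "\<beta> \<noteq> 0" using prod det by (auto simp: \<delta>_def)
  have "\<alpha> \<noteq> \<beta>"
  proof
    assume "\<alpha> = \<beta>"
    then show False using unipotent_not_commuting [OF comm n nz ns ab0(1)] sum prod
      by (simp add: \<tau>_def \<delta>_def power2_eq_square)
  qed
  have eig: "\<mu> * \<kappa> ^ n = \<alpha> \<or> \<mu> * \<kappa> ^ n = \<beta>" if "\<kappa> = \<alpha> \<or> \<kappa> = \<beta>" for \<kappa>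
  proof -
    have "\<kappa> ^ 2 - (s11 + s22) * \<kappa> + (s11 * s22 - s12 * s21) = 0"
      using charpoly [of \<kappa>] that by (auto simp: \<tau>_def \<delta>_def)
    then obtain u1 u2 where u: "u1 \<noteq> 0 \<or> u2 \<noteq> 0" "s11 * u1 + s12 * u2 = \<kappa> * u1" "s21 * u1 + s22 * u2 = \<kappa> * u2"
      using eigenvector_exists [OF _ ns] by blast
    define F G where "F = hom_eval n p u1 u2" and "G = hom_eval n q u1 u2"
    have "s11 * F + s12 * G = \<mu> * \<kappa> ^ n * F" "s21 * F + s22 * G = \<mu> * \<kappa> ^ n * G"
      using comm unfolding commutes_eval_def F_def G_def by (simp_all add: u hom_eval_scale)
    moreover have "F \<noteq> 0 \<or> G \<noteq> 0" using nz [OF u(1)] by (simp add: F_def G_def)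
    ultimately have "(\<mu> * \<kappa> ^ n) ^ 2 - (s11 + s22) * (\<mu> * \<kappa> ^ n) + (s11 * s22 - s12 * s21) = 0"
      by (rule eigenvalue_of_matrix)
    then show ?thesis using charpoly [of "\<mu> * \<kappa> ^ n"] by (simp add: \<tau>_def \<delta>_def)
  qed
  have "\<exists>N\<in>{n - 1, n, n + 1}. \<alpha> ^ N = \<beta> ^ N"
  proof -
    have n': "\<alpha> ^ n = \<alpha> * \<alpha> ^ (n - 1)" "\<beta> ^ n = \<beta> * \<beta> ^ (n - 1)" using n by (cases n; simp)+
    consider "\<mu> * \<alpha> ^ n = \<mu> * \<beta> ^ n" | "\<mu> * \<alpha> ^ n = \<alpha>" "\<mu> * \<beta> ^ n = \<beta>" | "\<mu> * \<alpha> ^ n = \<beta>" "\<mu> * \<beta> ^ n = \<alpha>"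
      using eig by metis
    then show ?thesis
    proof cases
      case 1
      then show ?thesis using \<mu> by auto
    next
      case 2
      then have "\<mu> * \<alpha> ^ (n - 1) = 1" "\<mu> * \<beta> ^ (n - 1) = 1" using n' ab0 by auto
      then have "\<mu> * \<alpha> ^ (n - 1) = \<mu> * \<beta> ^ (n - 1)" by simp
      then show ?thesis using \<mu> by auto
    next
      case 3
      have "\<mu> * \<alpha> ^ (n + 1) = \<alpha> * (\<mu> * \<alpha> ^ n)" "\<mu> * \<beta> ^ (n + 1) = \<beta> * (\<mu> * \<beta> ^ n)" by simp_all
      then have "\<mu> * \<alpha> ^ (n + 1) = \<alpha> * \<beta>" "\<mu> * \<beta> ^ (n + 1) = \<alpha> * \<beta>" unfolding 3 by simp_all
      then have "\<mu> * \<alpha> ^ (n + 1) = \<mu> * \<beta> ^ (n + 1)" by (simp only:)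
      then show ?thesis using \<mu> by auto
    qed
  qed
  then show ?thesis using that \<open>\<alpha> \<noteq> \<beta>\<close> sum prod unfolding \<tau>_def \<delta>_def by blast
qed

section \<open>Conjugating maps have good reduction\<close>

context finite_place
begin

lemma vabs_poly_le:
  assumes "\<And>i. ||pcoeff f i|| \<le> 1" "||x|| \<le> 1"
  shows "||poly f x|| \<le> 1"
  unfolding poly_altdef using assms
  by (intro vabs_sum_le) (auto simp: vabs_mult vabs_power intro!: mult_le_one power_le_one)

lemma vabs_poly_less:
  assumes "\<And>i. ||pcoeff f i|| < 1" "||x|| \<le> 1"
  shows "||poly f x|| < 1"
  unfolding poly_altdef
proof (intro vabs_sum_less)
  fix i
  have "||x|| ^ i \<le> 1" using assms(2) by (simp add: power_le_one)
  then have "||pcoeff f i|| * ||x|| ^ i \<le> ||pcoeff f i||" by (simp add: mult_left_le)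
  then show "||pcoeff f i * x ^ i|| < 1" using assms(1) [of i] by (simp add: vabs_mult vabs_power)
qed simp

text \<open>
  By homogeneity it suffices to consider vectors of norm 1. If the second coordinate is a unit, the Bezout
  identity modulo the maximal ideal prevents both values from being small; otherwise the monomial \<open>x\<^sup>n\<close>
  dominates. The hypothesis \<open>bez\<close> says that the reductions are coprime.
\<close>

lemma norm_hom_eval:
  fixes p q A B :: "'k poly"
  assumes int: "\<And>i. ||pcoeff p i|| \<le> 1" "\<And>i. ||pcoeff q i|| \<le> 1" "\<And>i. ||pcoeff A i|| \<le> 1" "\<And>i. ||pcoeff B i|| \<le> 1"
    and bez: "\<And>i. ||pcoeff (A * p + B * q - 1) i|| < 1"
    and deg: "pdeg p \<le> n" "pdeg q \<le> n" and top: "||pcoeff p n|| = 1 \<or> ||pcoeff q n|| = 1" and n: "n > 0"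
  shows "max ||hom_eval n p x y|| ||hom_eval n q x y|| = max ||x|| ||y|| ^ n"
proof -
  have prim: "max ||hom_eval n p x y|| ||hom_eval n q x y|| = 1" if xy: "max ||x|| ||y|| = 1" for x y
  proof -
    have xy1: "||x|| \<le> 1" "||y|| \<le> 1" using xy by auto
    have le: "||hom_eval n r x y|| \<le> 1" if "\<And>i. ||pcoeff r i|| \<le> 1" for r
      unfolding hom_eval_def using that xy1
      by (intro vabs_sum_le) (auto simp: vabs_mult vabs_power intro!: mult_le_one power_le_one)
    have "||hom_eval n p x y|| = 1 \<or> ||hom_eval n q x y|| = 1"
    proof (cases "||y|| = 1")
      case True
      then have y: "y \<noteq> 0" by auto
      define z where "z = x / y"
      have z: "||z|| \<le> 1" using xy1 True by (simp add: z_def vabs_divide)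
      have "||poly (A * p + B * q - 1) z|| < 1" by (rule vabs_poly_less [OF bez z])
      then have s: "||poly A z * poly p z + poly B z * poly q z - 1|| < 1" by simp
      have "\<not> ( ||poly p z|| < 1 \<and> ||poly q z|| < 1)"
      proof
        assume *: "||poly p z|| < 1 \<and> ||poly q z|| < 1"
        have "||poly A z|| \<le> 1" "||poly B z|| \<le> 1" using int z by (auto intro: vabs_poly_le)
        then have "||poly A z|| * ||poly p z|| \<le> ||poly p z||" "||poly B z|| * ||poly q z|| \<le> ||poly q z||"
          by (auto intro: mult_left_le_one_le)
        then have "||poly A z * poly p z + poly B z * poly q z|| < 1"
          using vabs_add_le [of "poly A z * poly p z" "poly B z * poly q z"] * by (auto simp: vabs_mult)
        then have "||(poly A z * poly p z + poly B z * poly q z) - (poly A z * poly p z + poly B z * poly q z - 1)|| < 1"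
          using s vabs_diff_le [of "poly A z * poly p z + poly B z * poly q z" "poly A z * poly p z + poly B z * poly q z - 1"]
          by linarith
        then show False by simp
      qed
      moreover have "||poly p z|| \<le> 1" "||poly q z|| \<le> 1" using int z by (auto intro: vabs_poly_le)
      ultimately have "||poly p z|| = 1 \<or> ||poly q z|| = 1" by linarith
      then show ?thesis
        using hom_eval_eq_poly [OF deg(1) y, of x] hom_eval_eq_poly [OF deg(2) y, of x] True
        by (auto simp: vabs_mult vabs_power z_def)
    next
      case False
      then have y: "||y|| < 1" and x: "||x|| = 1" using xy xy1 by (auto simp: max_def split: if_splits)
      have *: "||hom_eval n r x y|| = 1" if r: "\<And>i. ||pcoeff r i|| \<le> 1" "||pcoeff r n|| = 1" for r
      proof -
        have "||\<Sum>i<n. pcoeff r i * (x ^ i * y ^ (n - i))|| < 1"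
        proof (rule vabs_sum_less)
          fix i assume "i \<in> {..<n}"
          then have "||y|| ^ (n - i) < 1" using y by (simp add: power_less_one_iff)
          then have "||pcoeff r i|| * ||y|| ^ (n - i) < 1"
            using r(1) [of i] by (meson mult_left_le_one_le order_le_less_trans vabs_nonneg zero_le_power)
          then show "||pcoeff r i * (x ^ i * y ^ (n - i))|| < 1" by (simp add: vabs_mult vabs_power x)
        qed simp
        moreover have "hom_eval n r x y = pcoeff r n * x ^ n + (\<Sum>i<n. pcoeff r i * (x ^ i * y ^ (n - i)))"
          by (simp add: hom_eval_def lessThan_Suc_atMost [symmetric])
        moreover have "||pcoeff r n * x ^ n|| = 1" by (simp add: vabs_mult vabs_power x r)
        ultimately show ?thesis using vabs_add_dominant by simp
      qed
      show ?thesis using top * int by blast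
    qed
    then show ?thesis using le int by (metis max.absorb1 max.absorb2)
  qed
  show ?thesis
  proof (cases "x = 0 \<and> y = 0")
    case True
    then show ?thesis using n hom_eval_scale [of n p 0 0 0] hom_eval_scale [of n q 0 0 0]
      by (simp add: power_0_left)
  next
    case False
    define c where "c = (if ||x|| \<ge> ||y|| then x else y)"
    have c: "||c|| = max ||x|| ||y||" by (simp add: c_def)
    have "0 < ||c||" using False by (auto simp: c less_max_iff_disj)
    then have c0: "c \<noteq> 0" by simp
    have "max ||x / c|| ||y / c|| = 1"
      using c0 by (auto simp: vabs_divide c_def max_def divide_simps split: if_splits)
    from prim [OF this] have "||c|| ^ n * max ||hom_eval n p (x / c) (y / c)|| ||hom_eval n q (x / c) (y / c)|| = ||c|| ^ n"
      by simp
    then have "max ||c ^ n * hom_eval n p (x / c) (y / c)|| ||c ^ n * hom_eval n q (x / c) (y / c)|| = ||c|| ^ n"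
      by (simp add: vabs_mult vabs_power max_mult_distrib_left)
    then show ?thesis using c0 by (simp add: hom_eval_scale [symmetric] c)
  qed
qed

lemma norm_matrix_le:
  assumes "||a|| \<le> 1" "||b|| \<le> 1"
  shows "||a * x + b * y|| \<le> max ||x|| ||y||"
proof -
  have "||a|| * ||x|| \<le> ||x||" "||b|| * ||y|| \<le> ||y||" using assms by (auto intro: mult_left_le_one_le)
  then show ?thesis using vabs_add_le [of "a * x" "b * y"] by (auto simp: vabs_mult)
qed

text \<open>
  Write \<open>\<Delta> = ||det M||\<close>. An integral matrix does not increase norms, and \<open>adj(M) M = det M\<close> shows that \<open>M\<close>
  decreases them at most by the factor \<open>\<Delta>\<close>. Take norms in \<open>M F(adj(M) x) = t G(x)\<close>. If \<open>x\<close> and \<open>adj(M) x\<close> both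
  have norm 1, this gives \<open>\<Delta> \<le> ||t||\<close>. If \<open>x\<close> is a column of \<open>M\<close> of norm 1, then \<open>adj(M) x\<close> has norm \<open>\<Delta>\<close>, and
  it gives \<open>||t|| \<le> \<Delta>\<^sup>n\<close>. As \<open>\<Delta> \<le> 1\<close> and \<open>n \<ge> 2\<close>, all are equal to 1.
\<close>

lemma conj_det_unit:
  fixes p q p' q' :: "'k poly"
  assumes F: "\<And>x y. max ||hom_eval n p x y|| ||hom_eval n q x y|| = max ||x|| ||y|| ^ n"
    and G: "\<And>x y. max ||hom_eval n p' x y|| ||hom_eval n q' x y|| = max ||x|| ||y|| ^ n"
    and conj: "conj_eval n p q p' q' a b c e t" and n: "n \<ge> 2"
    and int: "||a|| \<le> 1" "||b|| \<le> 1" "||c|| \<le> 1" "||e|| \<le> 1"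
    and unit: "||a|| = 1 \<or> ||b|| = 1 \<or> ||c|| = 1 \<or> ||e|| = 1" and det: "a * e - b * c \<noteq> 0"
  shows "||a * e - b * c|| = 1" "||t|| = 1"
proof -
  define \<Delta> where "\<Delta> = ||a * e - b * c||"
  have \<Delta>: "0 < \<Delta>" using det by (simp add: \<Delta>_def)
  have "||a * e|| \<le> 1" "||b * c|| \<le> 1" using int by (auto simp: vabs_mult intro!: mult_le_one)
  then have \<Delta>1: "\<Delta> \<le> 1" using vabs_diff_le [of "a * e" "b * c"] by (simp add: \<Delta>_def)
  define M where "M x y = max ||a * x + b * y|| ||c * x + e * y||" for x y
  have M_le: "M x y \<le> max ||x|| ||y||" for x y
    using norm_matrix_le int by (simp add: M_def)
  have M_ge: "\<Delta> * max ||x|| ||y|| \<le> M x y" for x y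
  proof -
    have "e * (a * x + b * y) + (- b) * (c * x + e * y) = (a * e - b * c) * x"
      "(- c) * (a * x + b * y) + a * (c * x + e * y) = (a * e - b * c) * y"
      by (simp_all add: algebra_simps)
    then have "||(a * e - b * c) * x|| \<le> M x y" "||(a * e - b * c) * y|| \<le> M x y"
      using norm_matrix_le [of e "- b" "a * x + b * y" "c * x + e * y"]
        norm_matrix_le [of "- c" a "a * x + b * y" "c * x + e * y"] int
      by (auto simp: M_def)
    then show ?thesis by (simp add: vabs_mult \<Delta>_def max_mult_distrib_left)
  qed
  have norm: "M (hom_eval n p (e * x - b * y) (a * y - c * x)) (hom_eval n q (e * x - b * y) (a * y - c * x)) =
      ||t|| * max ||x|| ||y|| ^ n" for x y
  proof -
    have "||t|| * max ||hom_eval n p' x y|| ||hom_eval n q' x y|| =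
        max ||t * hom_eval n p' x y|| ||t * hom_eval n q' x y||"
      by (simp add: vabs_mult max_mult_distrib_left)
    then show ?thesis using conj unfolding M_def conj_eval_def by (simp add: G)
  qed
  \<comment> \<open>a unit vector whose image under the adjugate is again primitive\<close>
  have lower: "\<Delta> \<le> ||t||"
  proof -
    obtain x y where xy: "max ||x|| ||y|| = 1" "max ||e * x - b * y|| ||a * y - c * x|| = 1"
    proof (cases "||e|| = 1 \<or> ||c|| = 1")
      case True
      then show ?thesis using that [of 1 0] int by (auto simp: max_def)
    next
      case False
      then show ?thesis using that [of 0 1] int unit by (auto simp: max_def)
    qed
    show ?thesis using norm [of x y] F [of "e * x - b * y" "a * y - c * x"] xy
        M_ge [of "hom_eval n p (e * x - b * y) (a * y - c * x)" "hom_eval n q (e * x - b * y) (a * y - c * x)"] by simp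
  qed
  \<comment> \<open>a primitive column of the matrix, which the adjugate scales by the determinant\<close>
  have upper: "||t|| \<le> \<Delta> ^ n"
  proof -
    obtain x y where xy: "max ||x|| ||y|| = 1" "max ||e * x - b * y|| ||a * y - c * x|| = \<Delta>"
    proof (cases "||a|| = 1 \<or> ||c|| = 1")
      case True
      have "max ||e * a - b * c|| ||a * c - c * a|| = \<Delta>" using \<Delta> by (simp add: \<Delta>_def mult.commute)
      then show ?thesis using that [of a c] True int by (auto simp: max_def split: if_splits)
    next
      case False
      have "max ||e * b - b * e|| ||a * e - c * b|| = \<Delta>" using \<Delta> by (simp add: \<Delta>_def mult.commute)
      then show ?thesis using that [of b e] False int unit by (auto simp: max_def split: if_splits)
    qed
    show ?thesis using norm [of x y] F [of "e * x - b * y" "a * y - c * x"] xy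
        M_le [of "hom_eval n p (e * x - b * y) (a * y - c * x)" "hom_eval n q (e * x - b * y) (a * y - c * x)"] by simp
  qed
  have "\<Delta> = 1"
  proof (rule ccontr)
    assume "\<Delta> \<noteq> 1"
    then have "\<Delta> < 1" using \<Delta>1 by simp
    then have "\<Delta> ^ n < \<Delta> ^ 1" using n \<Delta> by (intro power_strict_decreasing) auto
    then show False using lower upper by simp
  qed
  then show "||a * e - b * c|| = 1" "||t|| = 1" using lower upper by (auto simp: \<Delta>_def)
qed

end

section \<open>Automorphisms that reduce to the identity\<close>

text \<open>
  The Lucas sequence: the trace of the \<open>k\<close>-th power of a matrix with trace \<open>\<tau>\<close> and determinant \<open>\<delta>\<close>. It
  allows working with powers of a matrix in terms of elements of \<open>K\<close> alone.
\<close>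

fun lucas :: "'a::comm_ring_1 \<Rightarrow> 'a \<Rightarrow> nat \<Rightarrow> 'a" where
  "lucas \<tau> \<delta> 0 = 2"
| "lucas \<tau> \<delta> (Suc 0) = \<tau>"
| "lucas \<tau> \<delta> (Suc (Suc k)) = \<tau> * lucas \<tau> \<delta> (Suc k) - \<delta> * lucas \<tau> \<delta> k"

lemma to_ac_lucas:
  assumes "\<alpha> + \<beta> = to_ac \<tau>" "\<alpha> * \<beta> = to_ac \<delta>"
  shows "to_ac (lucas \<tau> \<delta> k) = \<alpha> ^ k + \<beta> ^ k"
  using assms
proof (induction \<tau> \<delta> k rule: lucas.induct)
  case (3 \<tau> \<delta> k)
  then have "to_ac (lucas \<tau> \<delta> (Suc (Suc k))) = (\<alpha> + \<beta>) * (\<alpha> ^ Suc k + \<beta> ^ Suc k) - (\<alpha> * \<beta>) * (\<alpha> ^ k + \<beta> ^ k)"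
    by simp
  then show ?case by (simp add: algebra_simps)
qed auto

lemma sum_odd_even: "(\<Sum>k\<le>2 * m + 1. f k) = (\<Sum>i\<le>m. f (2 * i) + f (2 * i + 1))"
  for f :: "nat \<Rightarrow> 'a::comm_monoid_add"
  by (induction m) (simp_all add: add.assoc)

lemma binomial_odd_part:
  fixes r :: "'a::comm_ring_1"
  shows "(1 + r) ^ (2 * m + 1) - (1 - r) ^ (2 * m + 1) =
    2 * r * (\<Sum>i\<le>m. of_nat ((2 * m + 1) choose (2 * i + 1)) * (r\<^sup>2) ^ i)"
proof -
  have b: "(1 + x) ^ (2 * m + 1) = (\<Sum>k\<le>2 * m + 1. of_nat ((2 * m + 1) choose k) * x ^ k)" for x :: 'a
    using binomial_ring [of x 1 "2 * m + 1"] by (simp add: add.commute)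
  have "(1 + r) ^ (2 * m + 1) - (1 - r) ^ (2 * m + 1) =
      (\<Sum>k\<le>2 * m + 1. of_nat ((2 * m + 1) choose k) * (r ^ k - (- r) ^ k))"
    using b [of r] b [of "- r"] by (simp only: sum_subtractf [symmetric] right_diff_distrib uminus_add_conv_diff diff_conv_add_uminus [symmetric])
  also have "\<dots> = (\<Sum>i\<le>m. of_nat ((2 * m + 1) choose (2 * i + 1)) * (2 * (r * (r\<^sup>2) ^ i)))"
    unfolding sum_odd_even by (intro sum.cong refl) (simp add: power_mult)
  finally show ?thesis by (simp add: sum_distrib_left mult_ac)
qed

text \<open>
  With \<open>\<zeta> = \<alpha> / \<beta>\<close>, a power of the root of unity \<open>\<zeta>\<close> has prime order.
\<close>

lemma prime_order_power:
  fixes \<alpha> \<beta> :: "'a::monoid_mult"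
  assumes "\<alpha> ^ N = \<beta> ^ N" "N > 0" "\<alpha> \<noteq> \<beta>"
  obtains r k where "prime r" "r dvd N" "\<alpha> ^ k \<noteq> \<beta> ^ k" "(\<alpha> ^ k) ^ r = (\<beta> ^ k) ^ r"
  using assms
proof (induction N arbitrary: thesis rule: less_induct)
  case (less N)
  have "N \<noteq> 1" using less.prems by auto
  then obtain r where r: "prime r" "r dvd N" using prime_factor_nat by blast
  then obtain k where k: "N = k * r" by (metis dvd_div_mult_self)
  have k0: "k > 0" "k < N" using less.prems k prime_gt_1_nat [OF r(1)] by auto
  show ?case
  proof (cases "\<alpha> ^ k = \<beta> ^ k")
    case True
    from less.IH [OF k0(2) _ True k0(1) less.prems(4)] show ?thesis
      using less.prems(1) k by (metis dvd_mult2)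
  next
    case False
    then show ?thesis using less.prems r k by (simp add: power_mult)
  qed
qed

context finite_place
begin

text \<open>
  The hypotheses say that trace and determinant are those of a scalar matrix \<open>s\<close> modulo the maximal ideal.
\<close>

lemma lucas_cong:
  assumes "||s|| \<le> 1" "||\<tau> - 2 * s|| < 1" "||\<delta> - s ^ 2|| < 1"
  shows "||lucas \<tau> \<delta> k - 2 * s ^ k|| < 1"
proof (induction k rule: less_induct)
  case (less k)
  have small: "||x * y|| < 1" if "||x|| < 1" "||y|| \<le> 1" for x y
    using that by (metis mult_left_le order_le_less_trans vabs_mult vabs_nonneg)
  have int: "||x|| \<le> 1" if "||x - y|| < 1" "||y|| \<le> 1" for x y
    using vabs_add_le [of "x - y" y] that by simp
  have s: "||2 * s ^ j|| \<le> 1" for j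
    using assms(1) vabs_of_nat_le [of 2] by (auto simp: vabs_mult vabs_power intro!: mult_le_one power_le_one)
  have \<tau>: "||2 * s|| \<le> 1" using s [of 1] by simp
  have \<delta>: "||\<delta>|| \<le> 1" using int [OF assms(3)] assms(1) by (simp add: vabs_power power_le_one)
  consider "k = 0" | "k = 1" | j where "k = Suc (Suc j)"
    by (metis One_nat_def not0_implies_Suc)
  then show ?case
  proof cases
    case (3 j)
    have IH: "||lucas \<tau> \<delta> (Suc j) - 2 * s ^ Suc j|| < 1" "||lucas \<tau> \<delta> j - 2 * s ^ j|| < 1"
      using less [of "Suc j"] less [of j] 3 by simp_all
    have "lucas \<tau> \<delta> k - 2 * s ^ k =
        ((\<tau> - 2 * s) * lucas \<tau> \<delta> (Suc j) + (lucas \<tau> \<delta> (Suc j) - 2 * s ^ Suc j) * (2 * s)) -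
        ((\<delta> - s ^ 2) * (2 * s ^ j) + (lucas \<tau> \<delta> j - 2 * s ^ j) * \<delta>)"
      by (simp add: 3 algebra_simps power2_eq_square)
    also have "||\<dots>|| \<le> max (max ||(\<tau> - 2 * s) * lucas \<tau> \<delta> (Suc j)|| ||(lucas \<tau> \<delta> (Suc j) - 2 * s ^ Suc j) * (2 * s)||)
        (max ||(\<delta> - s ^ 2) * (2 * s ^ j)|| ||(lucas \<tau> \<delta> j - 2 * s ^ j) * \<delta>||)"
      by (rule order_trans [OF vabs_diff_le max.mono [OF vabs_add_le vabs_add_le]])
    also have "\<dots> < 1" unfolding max_less_iff_conj
      using small [OF assms(2) int [OF IH(1) s]] small [OF IH(1) \<tau>] small [OF assms(3) s] small [OF IH(2) \<delta>]
      by blast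
    finally show ?thesis .
  qed (use assms in auto)
qed

end

locale finite_place_char_0 = finite_place v for v :: "'k::field_char_0 \<Rightarrow> int"
begin

text \<open>
  Let \<open>a\<close> and \<open>b\<close> be \<open>k\<close>-th powers of the eigenvalues whose ratio has prime order \<open>r\<close>, and \<open>z = (a - b) / (a + b)\<close>.
  Then \<open>a\<^sup>r = b\<^sup>r\<close> becomes \<open>(1 + z)\<^sup>r = (1 - z)\<^sup>r\<close>, whose binomial expansion is a polynomial in \<open>z\<^sup>2\<close> times \<open>2 z\<close>.
  And \<open>w = z\<^sup>2\<close> is the discriminant \<open>D\<close> of the \<open>k\<close>-th power of the matrix divided by the square of its trace \<open>\<tau>'\<close>, an
  element of \<open>K\<close>. Modulo the maximal ideal this power is a scalar \<open>S\<close>; hence \<open>\<tau>'\<close>, which is congruent to \<open>2 S\<close>, is a unit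
  and \<open>D\<close> is small. In particular \<open>a + b \<noteq> 0\<close>, which excludes \<open>r = 2\<close>.
\<close>

lemma eisenstein_of_finite_order:
  fixes s \<tau> \<delta> :: 'k
  assumes s: "||s|| = 1" and two: "||2|| = 1" and cong: "||\<tau> - 2 * s|| < 1" "||\<delta> - s\<^sup>2|| < 1"
    and ab: "\<alpha> + \<beta> = to_ac \<tau>" "\<alpha> * \<beta> = to_ac \<delta>" "\<alpha> \<noteq> \<beta>" and N: "\<alpha> ^ N = \<beta> ^ N" "N > 0"
  obtains m w where "prime (2 * m + 1)" "(2 * m + 1) dvd N" "||w|| < 1"
    "(\<Sum>i\<le>m. of_nat ((2 * m + 1) choose (2 * i + 1)) * w ^ i) = 0"
proof -
  obtain r k where r: "prime r" "r dvd N" "\<alpha> ^ k \<noteq> \<beta> ^ k" "(\<alpha> ^ k) ^ r = (\<beta> ^ k) ^ r"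
    using prime_order_power [OF N ab(3)] by metis
  define a b where "a = \<alpha> ^ k" and "b = \<beta> ^ k"
  define \<tau>' where "\<tau>' = lucas \<tau> \<delta> k"
  define S where "S = s ^ k"
  have S: "||S|| = 1" using s by (simp add: S_def vabs_power)
  have sum: "to_ac \<tau>' = a + b" using to_ac_lucas [OF ab(1,2)] by (simp add: \<tau>'_def a_def b_def)
  have prod: "to_ac (\<delta> ^ k) = a * b"
    using ab(2) by (simp add: a_def b_def power_mult_distrib [symmetric])
  have cong': "||\<tau>' - 2 * S|| < 1" using lucas_cong [OF _ cong] s by (simp add: \<tau>'_def S_def)
  have \<tau>': "||\<tau>'|| = 1"
    using vabs_add_dominant [of "\<tau>' - 2 * S" "2 * S"] cong' S two by (simp add: vabs_mult)
  have \<delta>': "||\<delta> ^ k - S\<^sup>2|| < 1"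
  proof -
    have "||\<delta>|| \<le> 1" using vabs_add_le [of "\<delta> - s\<^sup>2" "s\<^sup>2"] cong(2) s by (simp add: vabs_power)
    have "||\<delta> ^ j - (s\<^sup>2) ^ j|| < 1" for j
    proof (induction j)
      case (Suc j)
      have "\<delta> ^ Suc j - (s\<^sup>2) ^ Suc j = \<delta> * (\<delta> ^ j - (s\<^sup>2) ^ j) + (\<delta> - s\<^sup>2) * (s\<^sup>2) ^ j"
        by (simp add: algebra_simps)
      moreover have "||\<delta> * (\<delta> ^ j - (s\<^sup>2) ^ j)|| < 1"
        using Suc \<open>||\<delta>|| \<le> 1\<close> by (metis mult_left_le_one_le order_le_less_trans vabs_mult vabs_nonneg)
      moreover have "||(\<delta> - s\<^sup>2) * (s\<^sup>2) ^ j|| < 1" using cong(2) s by (simp add: vabs_mult vabs_power)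
      ultimately show ?case using vabs_add_le by (smt (verit))
    qed simp
    from this [of k] show ?thesis by (simp add: S_def power_mult [symmetric] mult.commute)
  qed
  define D where "D = \<tau>'\<^sup>2 - 4 * \<delta> ^ k"
  have D: "||D|| < 1"
  proof -
    have "D = (\<tau>' - 2 * S) * (\<tau>' + 2 * S) - 4 * (\<delta> ^ k - S\<^sup>2)"
      by (simp add: D_def algebra_simps power2_eq_square)
    moreover have "||\<tau>' + 2 * S|| \<le> 1"
      using vabs_add_le [of \<tau>' "2 * S"] \<tau>' S two by (simp add: vabs_mult)
    then have "||(\<tau>' - 2 * S) * (\<tau>' + 2 * S)|| < 1"
      using cong' by (metis mult_left_le order_le_less_trans vabs_mult vabs_nonneg)
    moreover have "||4 * (\<delta> ^ k - S\<^sup>2)|| < 1"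
      using \<delta>' vabs_of_nat_le [of 4] by (metis mult_left_le_one_le of_nat_numeral order_le_less_trans vabs_mult vabs_nonneg)
    ultimately show ?thesis using vabs_diff_le by (smt (verit))
  qed
  have \<tau>0: "\<tau>' \<noteq> 0" using \<tau>' by auto
  define w where "w = D / \<tau>'\<^sup>2"
  have w: "||w|| < 1" using D \<tau>' by (simp add: w_def vabs_divide vabs_power)
  have ab0: "a + b \<noteq> 0" using sum \<tau>0 by (metis to_ac_eq_0_iff)
  have "r \<noteq> 2"
  proof
    assume "r = 2"
    then have "(a - b) * (a + b) = 0" using r(4) by (simp add: a_def b_def algebra_simps power2_eq_square)
    then show False using ab0 r(3) by (simp add: a_def b_def)
  qed
  then have "odd r" using r(1) prime_odd_nat prime_ge_2_nat by (metis le_neq_implies_less)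
  then obtain m where m: "r = 2 * m + 1" by (auto elim: oddE)
  define z where "z = (a - b) / (a + b)"
  have z0: "z \<noteq> 0" using ab0 r(3) by (simp add: z_def a_def b_def)
  have "z\<^sup>2 = to_ac w"
  proof -
    have "(a - b)\<^sup>2 = (a + b)\<^sup>2 - 4 * (a * b)" by (simp add: power2_eq_square algebra_simps)
    then show ?thesis by (simp add: z_def w_def D_def sum [symmetric] prod [symmetric] power_divide)
  qed
  have "1 + z = 2 * a / (a + b)" "1 - z = 2 * b / (a + b)"
    using ab0 by (simp_all add: z_def field_simps)
  then have "(1 + z) ^ r - (1 - z) ^ r = 0"
    using r(4) by (simp add: a_def b_def power_divide power_mult_distrib)
  then have "2 * z * (\<Sum>i\<le>m. of_nat ((2 * m + 1) choose (2 * i + 1)) * (z\<^sup>2) ^ i) = 0"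
    unfolding m binomial_odd_part .
  then have "(\<Sum>i\<le>m. of_nat ((2 * m + 1) choose (2 * i + 1)) * (z\<^sup>2) ^ i) = 0" using z0 by simp
  then have "to_ac (\<Sum>i\<le>m. of_nat ((2 * m + 1) choose (2 * i + 1)) * w ^ i) = 0"
    unfolding \<open>z\<^sup>2 = to_ac w\<close> by (simp add: to_ac_sum)
  then have "(\<Sum>i\<le>m. of_nat ((2 * m + 1) choose (2 * i + 1)) * w ^ i) = 0"
    by (simp only: to_ac_eq_0_iff)
  then show ?thesis using that r(1,2) w unfolding m by blast
qed

text \<open>
  The usual argument with the Newton polygon: the middle coefficients are divisible by the prime
  \<open>r = 2 m + 1\<close>, so that their terms are smaller than the constant term \<open>r\<close>, which the leading term \<open>w\<^sup>m\<close> has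
  to cancel.
\<close>

lemma eisenstein_norm:
  assumes prime: "prime (2 * m + 1)" and w: "||w|| < 1"
    and root: "(\<Sum>i\<le>m. of_nat ((2 * m + 1) choose (2 * i + 1)) * w ^ i) = 0"
  shows "||of_nat (2 * m + 1)|| < 1" "||w|| ^ m = ||of_nat (2 * m + 1)||" "m > 0"
proof -
  let ?p = "2 * m + 1"
  show m: "m > 0" using prime by (cases m) auto
  define T where "T = (\<Sum>i\<in>{0<..<m}. of_nat (?p choose (2 * i + 1)) * w ^ i)"
  have "{..m} = insert 0 (insert m {0<..<m})" using m by auto
  then have eq: "of_nat ?p + (w ^ m + T) = 0"
    using root m by (simp add: T_def binomial_eq_0)
  have "(of_nat ?p :: 'k) \<noteq> 0" by (metis Suc_eq_plus1 of_nat_neq_0)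
  then have pos: "0 < ||of_nat ?p||" by (simp only: vabs_pos_iff not_False_eq_True)
  have T: "||T|| < ||of_nat ?p||"
    unfolding T_def
  proof (rule vabs_sum_less)
    fix i assume i: "i \<in> {0<..<m}"
    then have "?p dvd (?p choose (2 * i + 1))" by (intro dvd_choose_prime prime) auto
    then obtain j where "?p choose (2 * i + 1) = ?p * j" by blast
    then have "||of_nat (?p choose (2 * i + 1))|| = ||of_nat ?p|| * ||of_nat j||" by (metis of_nat_mult vabs_mult)
    also have "\<dots> \<le> ||of_nat ?p||" by (intro mult_left_le vabs_of_nat_le) simp
    finally have "||of_nat (?p choose (2 * i + 1)) * w ^ i|| \<le> ||of_nat ?p|| * ||w|| ^ i"
      by (simp add: vabs_mult vabs_power mult_right_mono)
    also have "\<dots> < ||of_nat ?p|| * 1"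
      using i w by (intro mult_strict_left_mono pos) (auto simp: power_less_one_iff)
    finally show "||of_nat (?p choose (2 * i + 1)) * w ^ i|| < ||of_nat ?p||" by simp
  qed (rule pos)
  have "(of_nat ?p + T) + w ^ m = 0" using eq by (simp only: add_ac)
  then have "w ^ m = - (of_nat ?p + T)" by (rule minus_unique [symmetric])
  then have "||w ^ m|| = ||of_nat ?p||" using vabs_add_dominant [OF T] by (metis vabs_minus)
  then show eq2: "||w|| ^ m = ||of_nat ?p||" by (simp only: vabs_power)
  show "||of_nat ?p|| < 1" using w m unfolding eq2 [symmetric] by (simp add: power_less_one_iff)
qed

end

section \<open>Number fields\<close>

text \<open>
  The exponent of \<open>p\<close> in a rational number. It does not depend on the place above \<open>p\<close>, which matters in
  comparing the values of a rational number at several places.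
\<close>

definition padic_ord :: "nat \<Rightarrow> rat \<Rightarrow> int" where
  "padic_ord p c = int (multiplicity p (nat \<bar>fst (quotient_of c)\<bar>)) - int (multiplicity p (nat (snd (quotient_of c))))"

context finite_place_char_0
begin

lemma vabs_of_nat_coprime:
  assumes p: "||of_nat p|| < 1" and "coprime p n"
  shows "||of_nat n|| = 1"
proof (rule ccontr)
  assume "||of_nat n|| \<noteq> 1"
  then have n: "||of_nat n|| < 1" using vabs_of_nat_le [of n] by simp
  obtain x y where "x * int p + y * int n = 1"
    using assms(2) bezout_int [of "int p" "int n"] by auto
  then have 1: "of_int x * of_nat p + of_int y * of_nat n = (1::'k)"
    by (metis of_int_1 of_int_add of_int_mult of_int_of_nat_eq)
  have "||of_int z * a|| < 1" if "||a|| < 1" for z a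
    using that vabs_of_int_le [of z] by (metis mult_left_le_one_le order_le_less_trans vabs_mult vabs_nonneg)
  then have "||of_int x * of_nat p + of_int y * of_nat n|| < 1"
    using vabs_add_le p n by (meson max_less_iff_conj order_le_less_trans)
  then show False by (simp add: 1)
qed

lemma vabs_of_nat_eq:
  assumes p: "prime p" "||of_nat p|| < 1" and n: "n \<noteq> 0"
  shows "||of_nat n|| = ||of_nat p|| ^ multiplicity p n"
proof -
  obtain y where y: "n = p ^ multiplicity p n * y" "\<not> p dvd y"
    using multiplicity_decompose' [of n p] n p(1) not_prime_unit by blast
  have "coprime p y" using y(2) p(1) prime_imp_coprime by blast
  then have "||of_nat y|| = 1" using vabs_of_nat_coprime p by blast
  then show ?thesis by (subst y(1)) (simp add: vabs_mult vabs_power)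
qed

lemma of_rat_quotient:
  obtains x y where "of_rat c = of_int x / (of_int y :: 'k)" "fst (quotient_of c) = x" "snd (quotient_of c) = y" "y > 0"
    "c \<noteq> 0 \<Longrightarrow> x \<noteq> 0"
proof -
  obtain x y where xy: "quotient_of c = (x, y)" by fastforce
  then have c: "c = of_int x / of_int y" by (rule quotient_of_div)
  have y: "y > 0" using quotient_of_denom_pos [OF xy] .
  have "of_rat c = of_int x / (of_int y :: 'k)" by (simp add: c of_rat_divide)
  moreover have "c \<noteq> 0 \<Longrightarrow> x \<noteq> 0" using c by auto
  ultimately show ?thesis using that [of x y] xy y by simp
qed

lemma vabs_of_int: "||of_int x|| = ||of_nat (nat \<bar>x\<bar>)||"
  by (cases x rule: int_cases2) simp_all

lemma vabs_of_rat_eq: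
  assumes p: "prime p" "||of_nat p|| < 1" and c: "c \<noteq> 0"
  shows "||of_rat c|| = ||of_nat p|| powr padic_ord p c"
proof -
  obtain x y where xy: "of_rat c = of_int x / (of_int y :: 'k)" "fst (quotient_of c) = x" "snd (quotient_of c) = y" "y > 0"
    "x \<noteq> 0" using of_rat_quotient [of c] c by metis
  have p0: "||of_nat p|| > 0" using p(1) by auto
  have "||of_int x|| = ||of_nat p|| ^ multiplicity p (nat \<bar>x\<bar>)"
    unfolding vabs_of_int by (rule vabs_of_nat_eq [OF p]) (use xy in simp)
  moreover have "||of_int y|| = ||of_nat p|| ^ multiplicity p (nat \<bar>y\<bar>)"
    unfolding vabs_of_int by (rule vabs_of_nat_eq [OF p]) (use xy in simp)
  ultimately have "||of_rat c|| = ||of_nat p|| ^ multiplicity p (nat \<bar>x\<bar>) / ||of_nat p|| ^ multiplicity p (nat y)"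
    using xy(4) by (simp add: xy(1) vabs_divide)
  then show ?thesis using p0 by (simp add: padic_ord_def xy(2,3) powr_diff powr_realpow)
qed

lemma prime_divisor_small:
  assumes "||of_nat n|| < 1" "n > 0"
  obtains p where "prime p" "p dvd n" "||of_nat p|| < 1"
  using assms
proof (induction n arbitrary: thesis rule: less_induct)
  case (less n)
  have "n \<noteq> 1" using less.prems by auto
  then obtain p where p: "prime p" "p dvd n" using prime_factor_nat by blast
  then obtain k where k: "n = p * k" by blast
  show ?case
  proof (cases "||of_nat p|| < 1")
    case False
    then have "||of_nat p|| = 1" using vabs_of_nat_le [of p] by simp
    then have "||of_nat k|| < 1" using less.prems by (simp add: k vabs_mult)
    moreover have "k < n" "k > 0" using k p less.prems prime_gt_1_nat [OF p(1)] by auto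
    ultimately show ?thesis using less.IH [of k] less.prems(1) k by (metis dvd_mult)
  qed (use p less.prems in auto)
qed

lemma vabs_of_rat_ne_1:
  assumes "c \<noteq> 0" "||of_rat c|| \<noteq> 1"
  obtains p where "prime p" "p dvd nat \<bar>fst (quotient_of c)\<bar> * nat (snd (quotient_of c))" "||of_nat p|| < 1"
proof -
  obtain x y where xy: "of_rat c = of_int x / (of_int y :: 'k)" "fst (quotient_of c) = x" "snd (quotient_of c) = y" "y > 0"
    "x \<noteq> 0" using of_rat_quotient [of c] assms by metis
  have "\<not> ( ||of_int x|| = 1 \<and> ||of_int y|| = 1)" using assms(2) unfolding xy(1) vabs_divide by auto
  then have "||of_int x|| < 1 \<or> ||of_int y|| < 1"
    using vabs_of_int_le [of x] vabs_of_int_le [of y] by linarith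
  then show ?thesis
  proof
    assume "||of_int x|| < 1"
    then obtain p where "prime p" "p dvd nat \<bar>x\<bar>" "||of_nat p|| < 1"
      unfolding vabs_of_int using prime_divisor_small [of "nat \<bar>x\<bar>"] xy(5) by (metis zero_less_abs_iff zero_less_nat_eq)
    then show ?thesis using that [of p] xy(2,3) by simp
  next
    assume "||of_int y|| < 1"
    then obtain p where "prime p" "p dvd nat \<bar>y\<bar>" "||of_nat p|| < 1"
      unfolding vabs_of_int using prime_divisor_small [of "nat \<bar>y\<bar>"] xy(4) by (metis zero_less_abs_iff zero_less_nat_eq less_irrefl)
    then show ?thesis using that [of p] xy(2-4) by simp
  qed
qed

lemma sum_distinct_norms_nonzero:
  assumes "finite I" "I \<noteq> {}" "\<And>i. i \<in> I \<Longrightarrow> f i \<noteq> 0" "inj_on (\<lambda>i. ||f i||) I"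
  shows "(\<Sum>i\<in>I. f i) \<noteq> 0"
proof -
  define M where "M = Max ((\<lambda>i. ||f i||) ` I)"
  have "M \<in> (\<lambda>i. ||f i||) ` I" unfolding M_def using assms by (intro Max_in) auto
  then obtain i where i: "i \<in> I" "||f i|| = M" by auto
  have "||f j|| < ||f i||" if "j \<in> I" "j \<noteq> i" for j
  proof -
    have "||f j|| \<le> M" unfolding M_def using assms that by (intro Max_ge) auto
    moreover have "||f j|| \<noteq> ||f i||" using inj_onD [OF assms(4) _ that(1) i(1)] that(2) by auto
    ultimately show ?thesis using i by simp
  qed
  then show ?thesis using sum_dominant_nonzero [OF assms(1) i(1)] assms(3) i(1) by blast
qed

text \<open>
  The term \<open>c\<^sub>i w\<^sup>i\<close> has absolute value \<open>||w||\<close> to the power \<open>m k + i\<close>, where \<open>k\<close> is the exponent of \<open>p\<close> in \<open>c\<^sub>i\<close>.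
  These exponents are distinct modulo \<open>m\<close>, so no cancellation is possible.
\<close>

lemma eisenstein_powers_independent:
  assumes p: "prime p" "||of_nat p|| < 1" and w: "||w|| ^ m = ||of_nat p||" and m: "m > 0"
    and zero: "(\<Sum>i<m. of_rat (c i) * w ^ i) = 0" and i: "i < m"
  shows "c i = 0"
proof (rule ccontr)
  assume ci: "c i \<noteq> 0"
  let ?I = "{j \<in> {..<m}. c j \<noteq> 0}"
  have "(of_nat p :: 'k) \<noteq> 0" using p(1) by auto
  then have w0: "w \<noteq> 0" using w m by (auto simp: power_0_left)
  then have wpos: "0 < ||w||" by simp
  have w1: "||w|| \<noteq> 1" using w p(2) by auto
  have norm: "||of_rat (c j) * w ^ j|| = ||w|| powr (of_int (int m * padic_ord p (c j) + int j))" if "c j \<noteq> 0" for j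
  proof -
    have "||of_rat (c j) * w ^ j|| = ( ||w|| powr m) powr padic_ord p (c j) * ||w|| powr j"
      using vabs_of_rat_eq [OF p that] w wpos by (simp add: vabs_mult vabs_power powr_realpow)
    then show ?thesis by (simp add: powr_powr powr_add [symmetric])
  qed
  have "inj_on (\<lambda>j. ||of_rat (c j) * w ^ j||) ?I"
  proof (rule inj_onI)
    fix j k assume jk: "j \<in> ?I" "k \<in> ?I" and eq: "||of_rat (c j) * w ^ j|| = ||of_rat (c k) * w ^ k||"
    then have "||w|| powr (of_int (int m * padic_ord p (c j) + int j)) = ||w|| powr (of_int (int m * padic_ord p (c k) + int k))"
      using norm by simp
    then have "int m * padic_ord p (c j) + int j = int m * padic_ord p (c k) + int k"
      using powr_inj [OF wpos w1] by (metis of_int_eq_iff)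
    then have "(int m * padic_ord p (c j) + int j) mod int m = (int m * padic_ord p (c k) + int k) mod int m"
      by simp
    then show "j = k" using jk by simp
  qed
  then have "(\<Sum>j\<in>?I. of_rat (c j) * w ^ j) \<noteq> 0"
    using i ci w0 by (intro sum_distinct_norms_nonzero) auto
  moreover have "(\<Sum>j\<in>?I. of_rat (c j) * w ^ j) = (\<Sum>j<m. of_rat (c j) * w ^ j)"
    by (intro sum.mono_neutral_left) auto
  ultimately show False using zero by simp
qed

end

lemma vector_space_rat_scale: "vector_space (rat_scale :: rat \<Rightarrow> 'k::field_char_0 \<Rightarrow> 'k)"
  by unfold_locales (simp_all add: rat_scale_def algebra_simps of_rat_add of_rat_mult)

lemma number_field_basis:
  assumes "number_field TYPE('k::field_char_0)"
  obtains Basis where "finite_dimensional_vector_space (rat_scale :: rat \<Rightarrow> 'k \<Rightarrow> 'k) Basis"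
proof -
  interpret V: vector_space "rat_scale :: rat \<Rightarrow> 'k \<Rightarrow> 'k" by (rule vector_space_rat_scale)
  obtain B :: "'k set" where B: "finite B" "V.span B = UNIV" using assms by (auto simp: number_field_def)
  obtain B' where B': "B' \<subseteq> B" "V.independent B'" "B \<subseteq> V.span B'"
    using V.maximal_independent_subset by blast
  have "V.span B' = UNIV" using B B' V.span_mono V.span_span by (metis UNIV_I subsetI subset_antisym)
  then have "finite_dimensional_vector_space (rat_scale :: rat \<Rightarrow> 'k \<Rightarrow> 'k) B'"
    using B B' by unfold_locales (auto intro: finite_subset)
  then show ?thesis by (rule that)
qed

lemma independent_family_card_le:
  fixes f :: "'i \<Rightarrow> 'k::field_char_0"
  assumes nf: "number_field TYPE('k)" and I: "finite I"
    and ind: "\<And>c i. (\<Sum>i\<in>I. of_rat (c i) * f i) = 0 \<Longrightarrow> i \<in> I \<Longrightarrow> c i = 0"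
  shows "card I \<le> degree_over_rat TYPE('k)"
proof -
  obtain Basis where "finite_dimensional_vector_space (rat_scale :: rat \<Rightarrow> 'k \<Rightarrow> 'k) Basis"
    using number_field_basis [OF nf] .
  then interpret V: finite_dimensional_vector_space "rat_scale :: rat \<Rightarrow> 'k \<Rightarrow> 'k" Basis .
  have inj: "inj_on f I"
  proof (rule inj_onI, rule ccontr)
    fix i j assume ij: "i \<in> I" "j \<in> I" "f i = f j" "i \<noteq> j"
    define c :: "'i \<Rightarrow> rat" where "c = (\<lambda>k. if k = i then 1 else if k = j then - 1 else 0)"
    have "(\<Sum>k\<in>I. of_rat (c k) * f k) = (\<Sum>k\<in>{i, j}. of_rat (c k) * f k)"
      using I ij by (intro sum.mono_neutral_right) (auto simp: c_def)
    also have "\<dots> = 0" using ij by (simp add: c_def of_rat_minus)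
    finally show False using ind [of c i] ij by (simp add: c_def)
  qed
  have "V.independent (f ` I)"
  proof (rule V.independent_if_scalars_zero)
    show "finite (f ` I)" using I by simp
    fix g x assume 0: "(\<Sum>x\<in>f ` I. rat_scale (g x) x) = 0" and x: "x \<in> f ` I"
    have "(\<Sum>i\<in>I. of_rat (g (f i)) * f i) = 0"
      using 0 inj by (simp add: sum.reindex rat_scale_def)
    then show "g x = 0" using ind x by auto
  qed
  then have "card (f ` I) \<le> V.dim (UNIV :: 'k set)" by (intro V.independent_card_le_dim) auto
  then show ?thesis using inj by (simp add: card_image degree_over_rat_def)
qed

text \<open>
  The degree formula for \<open>\<rat> \<subseteq> \<rat>(w) \<subseteq> K\<close>. Instead of a basis of \<open>K\<close> over the subfield, a subspace \<open>W\<close> is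
  taken that is stable under \<open>w\<close>, has dimension divisible by \<open>m\<close> and is as large as possible. If \<open>b\<close> were
  outside \<open>W\<close>, then \<open>W\<close> could be enlarged by the independent vectors \<open>b, w b, \<dots>, w\<^sup>m\<^sup>-\<^sup>1 b\<close>.
\<close>

lemma degree_dvd_of_power_basis:
  fixes w :: "'k::field_char_0"
  assumes nf: "number_field TYPE('k)" and m: "m > 0"
    and ind: "\<And>c i. (\<Sum>i<m. of_rat (c i) * w ^ i) = 0 \<Longrightarrow> i < m \<Longrightarrow> c i = 0"
    and rel: "w ^ m = (\<Sum>i<m. of_rat (d i) * w ^ i)"
  shows "m dvd degree_over_rat TYPE('k)"
proof -
  obtain Basis where "finite_dimensional_vector_space (rat_scale :: rat \<Rightarrow> 'k \<Rightarrow> 'k) Basis"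
    using number_field_basis [OF nf] .
  then interpret V: finite_dimensional_vector_space "rat_scale :: rat \<Rightarrow> 'k \<Rightarrow> 'k" Basis .
  define stable where "stable W \<longleftrightarrow> V.subspace W \<and> (\<forall>x\<in>W. w * x \<in> W) \<and> m dvd V.dim W" for W
  have "stable {0}" unfolding stable_def by (simp add: V.subspace_def rat_scale_def)
  moreover have "\<forall>W. stable W \<longrightarrow> V.dim W \<le> V.dimension"
    using V.dim_subset_UNIV by blast
  ultimately obtain W where W: "stable W" and max: "\<And>W'. stable W' \<Longrightarrow> V.dim W' \<le> V.dim W"
    using Lattices_Big.ex_has_greatest_nat [of stable "{0}" V.dim "Suc V.dimension"] by (metis less_Suc_eq_le)
  have sub: "V.subspace W" and wW: "\<And>x. x \<in> W \<Longrightarrow> w * x \<in> W" and dvd: "m dvd V.dim W"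
    using W by (auto simp: stable_def)
  have powW: "w ^ i * x \<in> W" if "x \<in> W" for i x
    using that by (induction i) (auto simp: mult.assoc wW)
  have combW: "(\<Sum>i<j. of_rat (c i) * w ^ i) * x \<in> W" if "x \<in> W" for c j x
  proof -
    have "(\<Sum>i<j. of_rat (c i) * w ^ i) * x = (\<Sum>i<j. rat_scale (c i) (w ^ i * x))"
      by (simp add: sum_distrib_right rat_scale_def mult.assoc)
    then show ?thesis using powW [OF that] by (simp add: V.subspace_sum V.subspace_scale sub)
  qed
  have "W = UNIV"
  proof (rule ccontr)
    assume "W \<noteq> UNIV"
    then obtain b where b: "b \<notin> W" by blast
    \<comment> \<open>multiplication by a nonzero polynomial in \<open>w\<close> is bijective on \<open>W\<close>\<close>
    have cancel: "c i = 0" if mem: "(\<Sum>i<m. of_rat (c i) * w ^ i) * b \<in> W" and i: "i < m" for c i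
    proof -
      define a where "a = (\<Sum>i<m. of_rat (c i) * w ^ i)"
      have "a = 0"
      proof (rule ccontr)
        assume a: "a \<noteq> 0"
        interpret P: finite_dimensional_vector_space_pair rat_scale Basis rat_scale Basis ..
        have lin: "Vector_Spaces.linear rat_scale rat_scale ((*) a)"
          by unfold_locales (simp_all add: rat_scale_def algebra_simps)
        interpret L: Vector_Spaces.linear rat_scale rat_scale "(*) a" by (rule lin)
        have "V.dim ((*) a ` W) = V.dim W"
          using a by (intro P.dim_image_eq lin) (simp add: inj_on_def)
        moreover have "V.subspace ((*) a ` W)"
          using L.subspace_image [OF sub] .
        moreover have "(*) a ` W \<subseteq> W" using combW by (auto simp: a_def)
        ultimately have "(*) a ` W = W" using V.subspace_dim_equal sub by (metis order_refl)
        moreover have "a * b \<in> W" using mem by (simp add: a_def)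
        ultimately obtain x where "x \<in> W" "a * b = a * x" by blast
        then show False using a b by simp
      qed
      then show ?thesis using ind [OF _ i] by (simp add: a_def)
    qed
    define S where "S j = W \<union> (\<lambda>i. w ^ i * b) ` {..<j}" for j
    have S_Suc: "S (Suc j) = insert (w ^ j * b) (S j)" for j by (auto simp: S_def lessThan_Suc)
    have span: "\<exists>c. x - (\<Sum>i<j. of_rat (c i) * w ^ i) * b \<in> W" if "x \<in> V.span (S j)" for x j
      using that
    proof (induction j arbitrary: x)
      case 0
      then show ?case using sub by (simp add: S_def V.span_eq_iff [THEN iffD2])
    next
      case (Suc j)
      then obtain k where "x - rat_scale k (w ^ j * b) \<in> V.span (S j)"
        unfolding S_Suc V.span_breakdown_eq by blast
      then obtain c where "x - rat_scale k (w ^ j * b) - (\<Sum>i<j. of_rat (c i) * w ^ i) * b \<in> W"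
        using Suc.IH by blast
      moreover have "(\<Sum>i<Suc j. of_rat ((c(j := k)) i) * w ^ i) = (\<Sum>i<j. of_rat (c i) * w ^ i) + of_rat k * w ^ j"
        by simp
      ultimately show ?case by (intro exI [of _ "c(j := k)"]) (simp add: rat_scale_def algebra_simps)
    qed
    have notin: "w ^ j * b \<notin> V.span (S j)" if j: "j < m" for j
    proof
      assume "w ^ j * b \<in> V.span (S j)"
      then obtain c where c: "w ^ j * b - (\<Sum>i<j. of_rat (c i) * w ^ i) * b \<in> W" using span by blast
      define e where "e = (\<lambda>i. if i = j then 1 else if i < j then - c i else 0)"
      have "(\<Sum>i<m. of_rat (e i) * w ^ i) = (\<Sum>i<Suc j. of_rat (e i) * w ^ i)"
        using j by (intro sum.mono_neutral_right) (auto simp: e_def)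
      also have "\<dots> = w ^ j - (\<Sum>i<j. of_rat (c i) * w ^ i)"
        by (simp add: e_def of_rat_minus sum_negf)
      finally have "(\<Sum>i<m. of_rat (e i) * w ^ i) * b \<in> W" using c by (simp only: left_diff_distrib)
      then show False using cancel [of e j] j by (simp add: e_def)
    qed
    have dim: "V.dim (S j) = V.dim W + j" if "j \<le> m" for j
      using that
    proof (induction j)
      case (Suc j)
      then show ?case using notin [of j] by (simp add: S_Suc V.dim_insert)
    qed (simp add: S_def)
    have "w * x \<in> V.span (S m)" if "x \<in> V.span (S m)" for x
    proof -
      have "V.subspace {x. w * x \<in> V.span (S m)}"
        using V.subspace_span [of "S m"] unfolding V.subspace_def
        by (auto simp: rat_scale_def distrib_left mult.left_commute [of w])
      moreover have "S m \<subseteq> {x. w * x \<in> V.span (S m)}"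
      proof
        fix x assume "x \<in> S m"
        then consider "x \<in> W" | i where "i < m" "x = w ^ i * b" by (auto simp: S_def)
        then have "w * x \<in> V.span (S m)"
        proof cases
          case 1
          then show ?thesis using wW by (intro V.span_base) (auto simp: S_def)
        next
          case (2 i)
          show ?thesis
          proof (cases "Suc i < m")
            case True
            have "w * x = w ^ Suc i * b" using 2 by simp
            then show ?thesis using True by (intro V.span_base) (auto simp: S_def simp del: power_Suc)
          next
            case False
            then have "w * x = w ^ m * b" using 2 by (metis less_antisym mult.assoc not_less_eq power_Suc)
            also have "\<dots> = (\<Sum>i<m. rat_scale (d i) (w ^ i * b))"
              unfolding rel by (simp add: sum_distrib_right rat_scale_def mult.assoc)
            also have "\<dots> \<in> V.span (S m)"
              by (intro V.span_sum V.span_scale V.span_base) (auto simp: S_def)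
            finally show ?thesis .
          qed
        qed
        then show "x \<in> {x. w * x \<in> V.span (S m)}" by simp
      qed
      ultimately have "V.span (S m) \<subseteq> {x. w * x \<in> V.span (S m)}" by (intro V.span_minimal)
      then show ?thesis using that by blast
    qed
    then have "stable (V.span (S m))"
      using dim [of m] dvd by (simp add: stable_def)
    then have "V.dim (S m) \<le> V.dim W" using max by fastforce
    then show False using dim [of m] m by simp
  qed
  then show ?thesis using dvd by (simp add: degree_over_rat_def)
qed

text \<open>
  Otherwise the valuation ring of \<open>v\<close> is contained in that of \<open>u\<close>. Comparing with the powers of a
  uniformizer \<open>\<pi>\<close> of \<open>v\<close> then gives \<open>u = u(\<pi>) v\<close>, and \<open>u(\<pi>) = 1\<close> because both are normalized.
\<close>

lemma finite_places_incomparable: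
  fixes v u :: "'k::field \<Rightarrow> int"
  assumes v: "v \<in> finite_places" and u: "u \<in> finite_places" and ne: "v \<noteq> u"
  shows "\<exists>a. place_abs v a \<le> 1 \<and> place_abs u a > 1"
proof (rule ccontr)
  interpret v: finite_place v by unfold_locales (rule v)
  interpret u: finite_place u by unfold_locales (rule u)
  assume "\<not> ?thesis"
  then have le: "place_abs u a \<le> 1" if "place_abs v a \<le> 1" for a
    using that by (meson not_le)
  have "1 \<in> v ` (- {0})" using v by (simp add: finite_places_def)
  then obtain \<pi> where \<pi>: "\<pi> \<noteq> 0" "v \<pi> = 1" by (metis ComplD imageE singletonI)
  define k where "k = u \<pi>"
  have k0: "k \<ge> 0" using le [of \<pi>] \<pi> by (simp add: v.vabs_le_1_iff u.vabs_le_1_iff k_def)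
  have abs_\<pi>: "place_abs v \<pi> = 2 powr (- 1)" "place_abs u \<pi> = 2 powr (- k)"
    using \<pi> by (simp_all add: place_abs_def k_def)
  have uk: "u a = k * v a" if a: "a \<noteq> 0" for a
  proof -
    have powi: "place_abs w (x powi z) = place_abs w x powi z" if "w \<in> finite_places" for w :: "'k \<Rightarrow> int" and x z
    proof -
      interpret w: finite_place w by unfold_locales (rule that)
      show ?thesis by (simp add: power_int_def w.vabs_power w.vabs_inverse)
    qed
    have e: "(2 powr t) powi z = 2 powr (t * z)" for t :: real and z :: int
      by (simp add: powr_real_of_int' [symmetric] powr_powr)
    define y where "y = a * \<pi> powi (- v a)"
    have "place_abs v y = 2 powr (- v a) * 2 powr ((- 1) * (- v a))"
      using a by (simp only: y_def v.vabs_mult powi [OF v] abs_\<pi> e) (simp add: place_abs_def)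
    then have "place_abs v y = 1" by (simp add: powr_add [symmetric])
    then have "place_abs v y \<le> 1" "place_abs v (inverse y) \<le> 1" by (simp_all add: v.vabs_inverse)
    then have "place_abs u y \<le> 1" "place_abs u (inverse y) \<le> 1" using le by auto
    moreover have "y \<noteq> 0" using a \<pi> by (simp add: y_def)
    ultimately have "place_abs u y = 1" by (auto simp: u.vabs_inverse inverse_le_1_iff)
    moreover have "place_abs u y = 2 powr (- u a) * 2 powr ((- k) * (- v a))"
      using a by (simp only: y_def u.vabs_mult powi [OF u] abs_\<pi> e) (simp add: place_abs_def)
    ultimately have "2 powr (of_int (- u a + k * v a)) = (2::real) powr 0" by (simp add: powr_add [symmetric])
    then have "real_of_int (- u a + k * v a) = 0" by (subst (asm) powr_inj) auto
    then show ?thesis by linarith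
  qed
  have "1 \<in> u ` (- {0})" using u by (simp add: finite_places_def)
  then obtain a where "a \<noteq> 0" "u a = 1" by (metis ComplD imageE singletonI)
  then have "k * v a = 1" using uk by simp
  then have "k = 1" using k0 by (metis zmult_eq_1_iff zero_le_one not_one_le_zero neg_0_le_iff_le)
  then have "v a = u a" for a
    using uk [of a] v u by (cases "a = 0") (auto simp: finite_places_def)
  then show False using ne by blast
qed

text \<open>
  Places are added one at a time. Let \<open>x\<close> serve \<open>T\<close>, and let \<open>y\<close> separate \<open>v\<close> from the new place \<open>u\<close>. If \<open>x\<close> is
  small at \<open>u\<close>, it will do; if it is a unit there, take \<open>x\<^sup>r y\<close> with large \<open>r\<close>. If it is large, take
  \<open>y x\<^sup>r / (1 + x\<^sup>r)\<close>, whose second factor is a unit at \<open>v\<close> and \<open>u\<close>, but as small as desired at the places of \<open>T\<close>.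
\<close>

lemma approximation_of_places:
  fixes v :: "'k::field \<Rightarrow> int"
  assumes v: "v \<in> finite_places" and "finite T" "T \<subseteq> finite_places" "v \<notin> T"
  obtains x where "place_abs v x > 1" "\<And>u. u \<in> T \<Longrightarrow> place_abs u x < 1"
  using assms(2-)
proof (induction T arbitrary: thesis rule: finite_induct)
  case empty
  have "- 1 \<in> v ` (- {0})" using v by (simp add: finite_places_def)
  then obtain x where "x \<noteq> 0" "v x = - 1" by (metis ComplD imageE singletonI)
  then show ?case using empty(1) [of x] by (simp add: place_abs_def)
next
  case (insert u T)
  interpret v: finite_place v by unfold_locales (rule v)
  interpret u: finite_place u by unfold_locales (use insert in auto)
  obtain x where x: "place_abs v x > 1" "\<And>u. u \<in> T \<Longrightarrow> place_abs u x < 1" using insert by auto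
  obtain a where a: "place_abs v a \<le> 1" "place_abs u a > 1"
    using finite_places_incomparable [of v u] insert v by auto
  obtain b where b: "place_abs u b \<le> 1" "place_abs v b > 1"
    using finite_places_incomparable [of u v] insert v by auto
  define y where "y = b / a"
  have a0: "a \<noteq> 0" using a by auto
  have y: "place_abs v y > 1" "place_abs u y < 1"
    using a b a0 by (simp_all add: y_def v.vabs_divide u.vabs_divide divide_simps)
  have ev: "eventually (\<lambda>r. \<forall>t\<in>T. place_abs t x ^ r * place_abs t y < 1) sequentially"
  proof (rule eventually_ball_finite [OF insert.hyps(1)], rule ballI)
    fix t assume "t \<in> T"
    interpret t: finite_place t by unfold_locales (use insert \<open>t \<in> T\<close> in auto)
    have "(\<lambda>r. place_abs t x ^ r * place_abs t y) \<longlonglongrightarrow> 0 * place_abs t y"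
      using x(2) [OF \<open>t \<in> T\<close>] by (intro tendsto_mult LIMSEQ_power_zero tendsto_const) simp
    then show "eventually (\<lambda>r. place_abs t x ^ r * place_abs t y < 1) sequentially"
      by (rule order_tendstoD) simp
  qed
  have "eventually (\<lambda>r. r > 0 \<and> (\<forall>t\<in>T. place_abs t x ^ r * place_abs t y < 1)) sequentially"
    by (intro eventually_conj eventually_gt_at_top ev)
  from eventually_happens' [OF sequentially_bot this]
  obtain r where r: "r > 0" "\<And>t. t \<in> T \<Longrightarrow> place_abs t x ^ r * place_abs t y < 1" by blast
  have x0: "x \<noteq> 0" using x(1) by auto
  have vr: "place_abs v x ^ r > 1" using x(1) r(1) by (simp add: one_less_power)
  consider "place_abs u x < 1" | "place_abs u x = 1" | "place_abs u x > 1" by linarith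
  then show ?case
  proof cases
    case 1
    then show ?thesis using insert.prems(1) [of x] x by auto
  next
    case 2
    have "place_abs v (x ^ r * y) > 1" using vr y(1) by (simp add: v.vabs_mult v.vabs_power less_1_mult)
    moreover have "place_abs u (x ^ r * y) < 1" using 2 y by (simp add: u.vabs_mult u.vabs_power)
    moreover have "place_abs t (x ^ r * y) < 1" if "t \<in> T" for t
    proof -
      interpret t: finite_place t by unfold_locales (use insert that in auto)
      show ?thesis using r(2) [OF that] by (simp add: t.vabs_mult t.vabs_power)
    qed
    ultimately show ?thesis using insert.prems(1) [of "x ^ r * y"] by auto
  next
    case 3
    let ?z = "x ^ r * y / (x ^ r + 1)"
    have ur: "place_abs u x ^ r > 1" using 3 r(1) by (simp add: one_less_power)
    have "place_abs v (x ^ r + 1) = place_abs v x ^ r"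
      using v.vabs_add_dominant [of 1 "x ^ r"] vr by (simp add: v.vabs_power)
    then have "place_abs v ?z > 1" using vr y(1) x0 by (simp add: v.vabs_mult v.vabs_power v.vabs_divide)
    moreover have "place_abs u (x ^ r + 1) = place_abs u x ^ r"
      using u.vabs_add_dominant [of 1 "x ^ r"] ur by (simp add: u.vabs_power)
    then have "place_abs u ?z < 1" using ur y(2) x0 by (simp add: u.vabs_mult u.vabs_power u.vabs_divide)
    moreover have "place_abs t ?z < 1" if "t \<in> T" for t
    proof -
      interpret t: finite_place t by unfold_locales (use insert that in auto)
      have "place_abs t x ^ r < 1" using x(2) [OF that] r(1) by (simp add: power_less_one_iff)
      then have "place_abs t (1 + x ^ r) = 1" using t.vabs_add_dominant [of "x ^ r" 1] by (simp add: t.vabs_power)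
      then show ?thesis using r(2) [OF that] by (simp add: t.vabs_mult t.vabs_power t.vabs_divide add.commute)
    qed
    ultimately show ?thesis using insert.prems(1) [of ?z] by auto
  qed
qed

text \<open>
  Let \<open>x v\<close> be large at \<open>v\<close> and small at the other given places. In a relation between the \<open>x v\<close>, consider a
  nonzero coefficient in which the exponent of \<open>p\<close> is least: at its own place, its term dominates all
  others. So there are at most \<open>[K : \<rat>]\<close> places above \<open>p\<close>.
\<close>

lemma finite_places_above_prime:
  assumes nf: "number_field TYPE('k::field_char_0)" and p: "prime p"
  shows "finite {v \<in> finite_places. place_abs v (of_nat p :: 'k) < 1}" (is "finite ?S")
proof (rule ccontr)
  assume "infinite ?S"
  then obtain T where T: "finite T" "card T = Suc (degree_over_rat TYPE('k))" "T \<subseteq> ?S"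
    using infinite_arbitrarily_large by blast
  have "\<exists>x. place_abs v x > 1 \<and> (\<forall>u\<in>T - {v}. place_abs u x < 1)" if "v \<in> T" for v
  proof -
    obtain x where "place_abs v x > 1" "\<And>u. u \<in> T - {v} \<Longrightarrow> place_abs u x < 1"
      by (rule approximation_of_places [of v "T - {v}"]) (use \<open>v \<in> T\<close> T in auto)
    then show ?thesis by blast
  qed
  then obtain x where x: "\<And>v. v \<in> T \<Longrightarrow> place_abs v (x v) > 1"
    "\<And>v u. v \<in> T \<Longrightarrow> u \<in> T \<Longrightarrow> u \<noteq> v \<Longrightarrow> place_abs u (x v) < 1" by (metis Diff_iff empty_iff insert_iff)
  have "card T \<le> degree_over_rat TYPE('k)"
  proof (rule independent_family_card_le [OF nf T(1)])
    fix c v assume zero: "(\<Sum>v\<in>T. of_rat (c v) * x v) = 0" and v: "v \<in> T"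
    show "c v = 0"
    proof (rule ccontr)
      assume cv: "c v \<noteq> 0"
      let ?J = "{u \<in> T. c u \<noteq> 0}"
      let ?o = "\<lambda>u. padic_ord p (c u)"
      have J: "finite ?J" "?J \<noteq> {}" using T v cv by auto
      define M where "M = Min (?o ` ?J)"
      have "M \<in> ?o ` ?J" unfolding M_def using J by (intro Min_in) auto
      then obtain u where u: "u \<in> ?J" "?o u = M" by auto
      have min: "?o u \<le> ?o t" if "t \<in> ?J" for t
        unfolding u(2) M_def using J that by (intro Min_le) auto
      interpret u: finite_place_char_0 u by unfold_locales (use u T in auto)
      have pu: "place_abs u (of_nat p :: 'k) < 1" using u T by auto
      have p0: "place_abs u (of_nat p :: 'k) > 0" using p by auto
      have "(\<Sum>t\<in>?J. of_rat (c t) * x t) \<noteq> 0"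
      proof (rule u.sum_dominant_nonzero [OF J(1) u(1)])
        show "of_rat (c u) * x u \<noteq> 0" using u x(1) [of u] by (auto simp: place_abs_def split: if_splits)
        fix t assume t: "t \<in> ?J" "t \<noteq> u"
        have "place_abs u (of_rat (c t)) \<le> place_abs u (of_rat (c u))"
          using min [OF t(1)] t(1) u(1) pu p0 u.vabs_of_rat_eq [OF p pu]
          by (simp add: powr_mono')
        then have "place_abs u (of_rat (c t) * x t) \<le> place_abs u (of_rat (c u)) * place_abs u (x t)"
          by (simp add: u.vabs_mult mult_right_mono)
        also have "\<dots> < place_abs u (of_rat (c u)) * place_abs u (x u)"
          using x(1) [of u] x(2) [of t u] t u(1) by (intro mult_strict_left_mono) auto
        finally show "place_abs u (of_rat (c t) * x t) < place_abs u (of_rat (c u) * x u)"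
          by (simp add: u.vabs_mult)
      qed
      moreover have "(\<Sum>t\<in>?J. of_rat (c t) * x t) = (\<Sum>t\<in>T. of_rat (c t) * x t)"
        using T(1) by (intro sum.mono_neutral_left) auto
      ultimately show False using zero by simp
    qed
  qed
  then show False using T by simp
qed

text \<open>
  A relation between powers of \<open>x\<close> is impossible at a place where \<open>x\<close> is large and the nonzero coefficients
  are units, because the terms have distinct absolute values. So the place lies above a prime that occurs
  in a coefficient.
\<close>

lemma finite_places_large:
  assumes nf: "number_field TYPE('k::field_char_0)"
  shows "finite {v \<in> finite_places. place_abs v (x :: 'k) > 1}"
proof -
  let ?n = "degree_over_rat TYPE('k)"
  have "\<not> (\<forall>c i. (\<Sum>i\<le>?n. of_rat (c i) * x ^ i) = 0 \<longrightarrow> i \<in> {..?n} \<longrightarrow> c i = 0)"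
    using independent_family_card_le [OF nf, of "{..?n}" "\<lambda>i. x ^ i"] by auto
  then obtain c i where c: "(\<Sum>i\<le>?n. of_rat (c i) * x ^ i) = 0" "i \<le> ?n" "c i \<noteq> 0" by auto
  let ?J = "{j \<in> {..?n}. c j \<noteq> 0}"
  let ?num = "\<lambda>j. nat \<bar>fst (quotient_of (c j))\<bar> * nat (snd (quotient_of (c j)))"
  let ?Q = "{p. prime p \<and> (\<exists>j\<in>?J. p dvd ?num j)}"
  have "?num j \<noteq> 0" if "j \<in> ?J" for j
  proof -
    obtain a b where ab: "quotient_of (c j) = (a, b)" by fastforce
    then have "c j = of_int a / of_int b" "b > 0"
      by (rule quotient_of_div, rule quotient_of_denom_pos)
    then have "a \<noteq> 0" "b > 0" using that by auto
    then show ?thesis by (simp add: ab)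
  qed
  then have "finite {p. p dvd ?num j}" if "j \<in> ?J" for j
    using that by (intro finite_divisors_nat) (simp only: neq0_conv)
  then have "finite (\<Union>j\<in>?J. {p. p dvd ?num j})" by (intro finite_UN_I) auto
  then have finQ: "finite ?Q" by (rule rev_finite_subset) blast
  have "\<exists>p\<in>?Q. place_abs v (of_nat p :: 'k) < 1" if v: "v \<in> finite_places" and big: "place_abs v x > 1" for v
  proof (rule ccontr)
    assume none: "\<not> ?thesis"
    interpret v: finite_place_char_0 v by unfold_locales (rule v)
    have unit: "place_abs v (of_rat (c j) :: 'k) = 1" if "j \<in> ?J" for j
    proof (rule ccontr)
      assume ne: "place_abs v (of_rat (c j) :: 'k) \<noteq> 1"
      have "c j \<noteq> 0" using that by simp
      obtain p where "prime p" "p dvd ?num j" "place_abs v (of_nat p :: 'k) < 1"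
        by (rule v.vabs_of_rat_ne_1 [OF \<open>c j \<noteq> 0\<close> ne])
      then show False using none that by blast
    qed
    have x0: "x \<noteq> 0" using big by auto
    have "(\<Sum>j\<in>?J. of_rat (c j) * x ^ j) \<noteq> 0"
    proof (rule v.sum_distinct_norms_nonzero)
      show "inj_on (\<lambda>j. place_abs v (of_rat (c j) * x ^ j)) ?J"
      proof (rule inj_onI)
        fix j k assume jk: "j \<in> ?J" "k \<in> ?J"
          and eq: "place_abs v (of_rat (c j) * x ^ j) = place_abs v (of_rat (c k) * x ^ k)"
        then have "place_abs v x ^ j = place_abs v x ^ k" by (simp add: v.vabs_mult v.vabs_power unit)
        then show "j = k" using big by (simp add: power_inject_exp)
      qed
    qed (use c x0 in auto)
    moreover have "(\<Sum>j\<in>?J. of_rat (c j) * x ^ j) = (\<Sum>j\<le>?n. of_rat (c j) * x ^ j)"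
      by (intro sum.mono_neutral_left) auto
    ultimately show False using c by simp
  qed
  then have "{v \<in> finite_places. place_abs v x > 1} \<subseteq> (\<Union>p\<in>?Q. {v \<in> finite_places. place_abs v (of_nat p :: 'k) < 1})"
    by blast
  moreover have "finite (\<Union>p\<in>?Q. {v \<in> finite_places. place_abs v (of_nat p :: 'k) < 1})"
    using finQ finite_places_above_prime [OF nf] by (intro finite_UN_I) auto
  ultimately show ?thesis by (rule finite_subset)
qed

lemma finite_places_nonunit:
  assumes nf: "number_field TYPE('k::field_char_0)"
  shows "finite {v \<in> finite_places. (x :: 'k) \<noteq> 0 \<and> place_abs v x \<noteq> 1}"
proof -
  have "{v \<in> finite_places. x \<noteq> 0 \<and> place_abs v x \<noteq> 1} \<subseteq>
    {v \<in> finite_places. place_abs v x > 1} \<union> {v \<in> finite_places. place_abs v (inverse x) > 1}"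
  proof
    fix v assume *: "v \<in> {v \<in> finite_places. x \<noteq> 0 \<and> place_abs v x \<noteq> 1}"
    then interpret v: finite_place v by unfold_locales auto
    show "v \<in> {v \<in> finite_places. place_abs v x > 1} \<union> {v \<in> finite_places. place_abs v (inverse x) > 1}"
      using * by (auto simp: v.vabs_inverse one_less_inverse_iff)
  qed
  then show ?thesis using finite_places_large [OF nf] by (meson finite_UnI finite_subset)
qed

section \<open>Reduction of rational functions\<close>

lemma as_ring_simps [simp]:
  "carrier as_ring = UNIV" "mult as_ring = (*)" "monoid.one as_ring = 1"
  "ring.zero as_ring = 0" "add as_ring = (+)"
  by (simp_all add: as_ring_def)

lemma field_as_ring: "Ring.field (as_ring :: 'k::field ring)"
proof (rule cring.cring_fieldI2)
  show "cring (as_ring :: 'k ring)"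
  proof (rule cringI)
    show "abelian_group (as_ring :: 'k ring)"
      by (rule abelian_groupI) (auto simp: add_ac intro: exI [of _ "- x" for x])
    show "Group.comm_monoid (as_ring :: 'k ring)" by (rule comm_monoidI) (auto simp: mult_ac)
  qed (auto simp: distrib_right)
  fix a :: 'k assume "a \<noteq> \<zero>\<^bsub>as_ring\<^esub>"
  then show "\<exists>b\<in>carrier as_ring. a \<otimes>\<^bsub>as_ring\<^esub> b = \<one>\<^bsub>as_ring\<^esub>"
    by (intro bexI [of _ "inverse a"]) auto
qed simp

context
begin

interpretation K: UP_field "as_ring :: 'k::field ring" "UP as_ring"
  by (rule UP_field.intro [OF field_as_ring])

lemma a_inv_as_ring [simp]: "\<ominus>\<^bsub>as_ring\<^esub> x = - x"
  by (rule K.R.minus_equality) simp_all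

lemma det2_as_ring [simp]: "K.det2 a b c e = a * e - b * c"
  by (simp add: K.det2_def a_minus_def)

lemma finsum_as_ring: "finite I \<Longrightarrow> finsum as_ring f I = sum f I"
  by (induction I rule: finite_induct) simp_all

lemma pcoeff_in_up: "pcoeff p \<in> up as_ring"
proof -
  have "bound 0 (pdeg p) (pcoeff p)" by (auto simp: bound_def coeff_eq_0)
  then show ?thesis by (auto simp: up_def)
qed

lemma pcoeff_closed [simp]: "pcoeff p \<in> carrier (UP as_ring)"
  by (simp add: UP_def pcoeff_in_up)

lemma coeff_pcoeff [simp]: "up_ring.coeff (UP as_ring) (pcoeff p) i = pcoeff p i"
  by (simp add: UP_def pcoeff_in_up)

lemma UP_as_ring_cases:
  assumes "f \<in> carrier (UP as_ring)"
  obtains p where "f = pcoeff p"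
proof -
  from assms obtain n where "bound 0 n f" by (auto simp: UP_def up_def)
  then have "\<forall>\<^sub>\<infinity>i. f i = 0" by (auto simp: MOST_nat bound_def)
  then have "f = pcoeff (Abs_poly f)" by (simp add: Abs_poly_inverse)
  then show ?thesis by (rule that)
qed

lemma pcoeff_zero: "pcoeff 0 = \<zero>\<^bsub>UP as_ring\<^esub>" by (rule K.up_eqI) simp_all

lemma pcoeff_one: "pcoeff 1 = \<one>\<^bsub>UP as_ring\<^esub>" by (rule K.up_eqI) simp_all

lemma pcoeff_add: "pcoeff (p + q) = pcoeff p \<oplus>\<^bsub>UP as_ring\<^esub> pcoeff q"
  by (rule K.up_eqI) simp_all

lemma pcoeff_mult: "pcoeff (p * q) = pcoeff p \<otimes>\<^bsub>UP as_ring\<^esub> pcoeff q"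
  by (rule K.up_eqI) (simp_all add: finsum_as_ring coeff_mult)

lemma pcoeff_smult: "pcoeff (Polynomial.smult c p) = c \<odot>\<^bsub>UP as_ring\<^esub> pcoeff p"
  by (rule K.up_eqI) simp_all

lemma pcoeff_power: "pcoeff (p ^ n) = pcoeff p [^]\<^bsub>UP as_ring\<^esub> n"
  by (induction n) (simp_all add: pcoeff_one pcoeff_mult K.P.m_comm)

lemma pcoeff_sum: "finite I \<Longrightarrow> pcoeff (\<Sum>i\<in>I. f i) = (\<Oplus>\<^bsub>UP as_ring\<^esub>i\<in>I. pcoeff (f i))"
  by (induction I rule: finite_induct) (simp_all add: pcoeff_zero pcoeff_add)

lemma pcoeff_hom_comp:
  "hom_subst as_ring n (pcoeff p) (pcoeff u) (pcoeff w) = pcoeff (hom_comp n p u w)"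
  by (simp add: K.hom_subst_alt hom_comp_def pcoeff_sum pcoeff_smult pcoeff_mult pcoeff_power)

lemma lin_as_ring: "K.lin a b = pcoeff [:b, a:]"
proof (rule K.up_eqI)
  fix n
  show "up_ring.coeff (UP as_ring) (K.lin a b) n = up_ring.coeff (UP as_ring) (pcoeff [:b, a:]) n"
    unfolding coeff_pcoeff by (auto simp: coeff_pCons split: nat.split)
qed (rule K.lin_closed pcoeff_closed; simp)+

lemma deg_pcoeff [simp]: "deg as_ring (pcoeff p) = pdeg p"
  by (intro antisym K.deg_aboveI K.deg_belowI) (auto simp: coeff_eq_0)

lemma coprime_pcoeff_iff:
  "coprime_polys as_ring (pcoeff p) (pcoeff q) \<longleftrightarrow> (\<exists>A B. A * p + B * q = 1)"
proof
  assume "coprime_polys as_ring (pcoeff p) (pcoeff q)"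
  then obtain A B where "A \<in> carrier (UP as_ring)" "B \<in> carrier (UP as_ring)"
    "A \<otimes>\<^bsub>UP as_ring\<^esub> pcoeff p \<oplus>\<^bsub>UP as_ring\<^esub> B \<otimes>\<^bsub>UP as_ring\<^esub> pcoeff q = \<one>\<^bsub>UP as_ring\<^esub>"
    by (auto simp: K.coprime_polys_iff_bezout)
  moreover from this obtain A' B' where "A = pcoeff A'" "B = pcoeff B'" using UP_as_ring_cases by metis
  ultimately have "pcoeff (A' * p + B' * q) = pcoeff 1"
    by (simp add: pcoeff_add pcoeff_mult pcoeff_one)
  then show "\<exists>A B. A * p + B * q = 1" by (auto simp: coeff_inject)
next
  assume "\<exists>A B. A * p + B * q = 1"
  then obtain A B where "A * p + B * q = 1" by blast
  then have "pcoeff (A * p + B * q) = pcoeff 1" by simp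
  then show "coprime_polys as_ring (pcoeff p) (pcoeff q)"
    unfolding pcoeff_add pcoeff_mult pcoeff_one K.coprime_polys_iff_bezout using pcoeff_closed by blast
qed

lemma rational_functions_as_ring:
  assumes "\<phi> \<in> rational_functions as_ring"
  obtains p q where "\<phi> = fraction as_ring (pcoeff p) (pcoeff q)" "coprime_polys as_ring (pcoeff p) (pcoeff q)"
proof -
  from assms obtain p q where pq: "\<phi> = fraction as_ring p q" "p \<in> carrier (UP as_ring)" "q \<in> carrier (UP as_ring)"
    "q \<noteq> \<zero>\<^bsub>UP as_ring\<^esub>" by (auto simp: rational_functions_def)
  obtain h p0 q0 where "coprime_polys as_ring p0 q0" "fraction as_ring p q = fraction as_ring p0 q0"
    using K.rational_functions_coprime [of p q] pq by metis
  moreover from this obtain p' q' where "p0 = pcoeff p'" "q0 = pcoeff q'"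
    using UP_as_ring_cases K.coprime_polys_closed by metis
  ultimately show ?thesis using that pq by simp
qed

end

context finite_place
begin

interpretation K: UP_field "as_ring :: 'k ring" "UP as_ring"
  by (rule UP_field.intro [OF field_as_ring])

interpretation k: UP_field "residue_field v" "UP (residue_field v)"
  by (rule UP_field.intro [OF field_residue_field])

definition integral :: "'k poly \<Rightarrow> bool" where
  "integral p \<longleftrightarrow> (\<forall>i. ||pcoeff p i|| \<le> 1)"

text \<open>
  \<open>reduce_poly\<close> for polynomials of type \<open>'k poly\<close>. On the integral ones it is a ring homomorphism.
\<close>

definition red_poly :: "'k poly \<Rightarrow> nat \<Rightarrow> 'k set" where
  "red_poly p = (\<lambda>i. residue v (pcoeff p i))"

lemma integralD [simp]: "integral p \<Longrightarrow> ||pcoeff p i|| \<le> 1" by (simp add: integral_def)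

lemma reduce_poly_pcoeff: "reduce_poly v (pcoeff p) = red_poly p"
  by (simp add: reduce_poly_def red_poly_def)

lemma red_poly_in_up: "integral p \<Longrightarrow> red_poly p \<in> up (residue_field v)"
proof -
  assume "integral p"
  moreover have "bound \<zero>\<^bsub>residue_field v\<^esub> (pdeg p) (red_poly p)" by (auto simp: bound_def red_poly_def coeff_eq_0 residue_zero)
  ultimately show ?thesis by (auto simp: up_def red_poly_def)
qed

lemma red_poly_closed [simp]: "integral p \<Longrightarrow> red_poly p \<in> carrier (UP (residue_field v))"
  by (simp add: UP_def red_poly_in_up)

lemma coeff_rp [simp]: "integral p \<Longrightarrow> up_ring.coeff (UP (residue_field v)) (red_poly p) i = residue v (pcoeff p i)"
  by (simp add: UP_def red_poly_in_up) (simp add: red_poly_def)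

lemma residue_sum:
  assumes "finite I" "\<And>i. i \<in> I \<Longrightarrow> ||f i|| \<le> 1"
  shows "residue v (\<Sum>i\<in>I. f i) = (\<Oplus>\<^bsub>residue_field v\<^esub>i\<in>I. residue v (f i))"
  using assms
proof (induction I rule: finite_induct)
  case (insert i I)
  then have "||\<Sum>i\<in>I. f i|| \<le> 1" by (intro vabs_sum_le) auto
  then show ?case using insert by (simp add: residue_add)
qed (simp add: residue_zero)

lemma integral_add [intro]: "integral p \<Longrightarrow> integral q \<Longrightarrow> integral (p + q)"
  unfolding integral_def using vabs_add_le by (metis coeff_add max.boundedI order_trans)

lemma integral_mult [intro]: "integral p \<Longrightarrow> integral q \<Longrightarrow> integral (p * q)"
  unfolding integral_def coeff_mult by (auto intro!: vabs_sum_le mult_le_one simp: vabs_mult)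

lemma integral_smult [intro]: "||c|| \<le> 1 \<Longrightarrow> integral p \<Longrightarrow> integral (Polynomial.smult c p)"
  unfolding integral_def by (auto intro!: mult_le_one simp: vabs_mult)

lemma integral_one [simp]: "integral 1" by (simp add: integral_def)

lemma integral_power [intro]: "integral p \<Longrightarrow> integral (p ^ n)"
  by (induction n) auto

lemma integral_pCons [simp]: "integral (pCons a p) \<longleftrightarrow> ||a|| \<le> 1 \<and> integral p"
  unfolding integral_def coeff_pCons by (auto split: nat.split)

lemma integral_zero [simp]: "integral 0" by (simp add: integral_def)

lemma integral_sum: "(\<And>i. i \<in> I \<Longrightarrow> integral (f i)) \<Longrightarrow> integral (\<Sum>i\<in>I. f i)"
  by (induction I rule: infinite_finite_induct) auto

lemma red_poly_add: "integral p \<Longrightarrow> integral q \<Longrightarrow> red_poly (p + q) = red_poly p \<oplus>\<^bsub>UP (residue_field v)\<^esub> red_poly q"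
  by (rule k.up_eqI) (simp_all add: residue_add integral_add)

lemma red_poly_mult: "integral p \<Longrightarrow> integral q \<Longrightarrow> red_poly (p * q) = red_poly p \<otimes>\<^bsub>UP (residue_field v)\<^esub> red_poly q"
proof (rule k.up_eqI)
  assume pq: "integral p" "integral q"
  fix n
  have "residue v (\<Sum>i\<le>n. pcoeff p i * pcoeff q (n - i)) =
     (\<Oplus>\<^bsub>residue_field v\<^esub>i\<in>{..n}. residue v (pcoeff p i * pcoeff q (n - i)))"
    using pq by (intro residue_sum) (auto simp: vabs_mult intro!: mult_le_one)
  also have "\<dots> = (\<Oplus>\<^bsub>residue_field v\<^esub>i\<in>{..n}. residue v (pcoeff p i) \<otimes>\<^bsub>residue_field v\<^esub> residue v (pcoeff q (n - i)))"
    using pq by (intro k.R.finsum_cong') (auto simp: residue_mult)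
  finally show "up_ring.coeff (UP (residue_field v)) (red_poly (p * q)) n =
      up_ring.coeff (UP (residue_field v)) (red_poly p \<otimes>\<^bsub>UP (residue_field v)\<^esub> red_poly q) n"
    using pq by (simp add: integral_mult coeff_mult)
qed (simp_all add: integral_mult)

lemma red_poly_smult: "||c|| \<le> 1 \<Longrightarrow> integral p \<Longrightarrow>
    red_poly (Polynomial.smult c p) = residue v c \<odot>\<^bsub>UP (residue_field v)\<^esub> red_poly p"
  by (rule k.up_eqI) (simp_all add: residue_mult integral_smult)

lemma red_poly_zero: "red_poly 0 = \<zero>\<^bsub>UP (residue_field v)\<^esub>"
  by (rule k.up_eqI) (simp_all add: residue_zero)

lemma red_poly_one: "red_poly 1 = \<one>\<^bsub>UP (residue_field v)\<^esub>"
  by (rule k.up_eqI) (simp_all add: residue_zero residue_one)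

lemma red_poly_power: "integral p \<Longrightarrow> red_poly (p ^ n) = red_poly p [^]\<^bsub>UP (residue_field v)\<^esub> n"
  by (induction n) (simp_all add: red_poly_one red_poly_mult integral_power k.P.m_comm)

lemma red_poly_sum:
  assumes "finite I" "\<And>i. i \<in> I \<Longrightarrow> integral (f i)"
  shows "red_poly (\<Sum>i\<in>I. f i) = (\<Oplus>\<^bsub>UP (residue_field v)\<^esub>i\<in>I. red_poly (f i))"
  using assms
proof (induction I rule: finite_induct)
  case (insert i I)
  then show ?case by (simp add: red_poly_add integral_sum)
qed (simp add: red_poly_zero)

lemma red_poly_hom_comp:
  assumes "integral p" "integral u" "integral w"
  shows "red_poly (hom_comp n p u w) = hom_subst (residue_field v) n (red_poly p) (red_poly u) (red_poly w)"
proof -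
  have "red_poly (hom_comp n p u w) = (\<Oplus>\<^bsub>UP (residue_field v)\<^esub>i\<in>{..n}. red_poly (Polynomial.smult (pcoeff p i) (u ^ i * w ^ (n - i))))"
    unfolding hom_comp_def using assms by (intro red_poly_sum) (auto intro!: integral_smult integral_mult integral_power)
  also have "\<dots> = hom_subst (residue_field v) n (red_poly p) (red_poly u) (red_poly w)"
    unfolding k.hom_subst_alt using assms
    by (intro k.P.finsum_cong') (auto simp: red_poly_smult red_poly_mult red_poly_power integral_mult integral_power)
  finally show ?thesis .
qed

lemma red_poly_linear: "||a|| \<le> 1 \<Longrightarrow> ||b|| \<le> 1 \<Longrightarrow> red_poly [:b, a:] = k.lin (residue v a) (residue v b)"
  by (rule k.up_eqI) (auto simp: coeff_pCons residue_zero split: nat.split)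

lemma deg_rp_le: "integral p \<Longrightarrow> deg (residue_field v) (red_poly p) \<le> pdeg p"
  by (intro k.deg_aboveI) (auto simp: coeff_eq_0 residue_zero)

lemma red_poly_eq_iff:
  assumes "integral p" "integral q"
  shows "red_poly p = red_poly q \<longleftrightarrow> (\<forall>i. ||pcoeff p i - pcoeff q i|| < 1)"
  using assms by (auto simp: red_poly_def fun_eq_iff residue_eq_iff)

text \<open>
  The zero coefficients are lifted to zero, in order that the lift is again a polynomial.
\<close>

lemma red_poly_surj:
  assumes "f \<in> carrier (UP (residue_field v))"
  obtains p where "integral p" "f = red_poly p"
proof -
  let ?k = "residue_field v"
  have cf: "\<exists>x. ||x|| \<le> 1 \<and> f i = residue v x" for i
  proof -
    have "f i \<in> carrier ?k" using assms by (auto simp: UP_def up_def)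
    then show ?thesis using residue_surj by metis
  qed
  define g where "g = (\<lambda>i. if f i = \<zero>\<^bsub>?k\<^esub> then 0 else SOME x. ||x|| \<le> 1 \<and> f i = residue v x)"
  have g: "||g i|| \<le> 1 \<and> f i = residue v (g i)" for i
    using someI_ex [OF cf [of i]] by (auto simp: g_def residue_zero)
  obtain n where "bound \<zero>\<^bsub>?k\<^esub> n f" using assms by (auto simp: UP_def up_def)
  then have "\<forall>\<^sub>\<infinity>i. g i = 0" by (auto simp: MOST_nat bound_def g_def)
  then have "pcoeff (Abs_poly g) = g" by (rule Abs_poly_inverse [OF CollectI])
  then show ?thesis using that [of "Abs_poly g"] g by (simp add: integral_def red_poly_def fun_eq_iff)
qed

lemma residue_uminus: "||x|| \<le> 1 \<Longrightarrow> \<ominus>\<^bsub>residue_field v\<^esub> residue v x = residue v (- x)"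
  by (rule k.R.minus_equality) (simp_all add: residue_add [symmetric] residue_zero)

lemma residue_det2:
  assumes "||a|| \<le> 1" "||b|| \<le> 1" "||c|| \<le> 1" "||e|| \<le> 1"
  shows "k.det2 (residue v a) (residue v b) (residue v c) (residue v e) = residue v (a * e - b * c)"
proof -
  have "||a * e|| \<le> 1" "||b * c|| \<le> 1" using assms by (auto simp: vabs_mult intro!: mult_le_one)
  then show ?thesis using assms
    by (simp add: k.det2_def a_minus_def residue_mult [symmetric] residue_uminus residue_add [symmetric])
qed

lemma normalized_at_iff:
  "normalized_at v (pcoeff p) (pcoeff q) \<longleftrightarrow>
     integral p \<and> integral q \<and> (\<exists>i. ||pcoeff p i|| = 1 \<or> ||pcoeff q i|| = 1)"
proof -
  have unit: "\<not> ||pcoeff r i|| < 1 \<longleftrightarrow> ||pcoeff r i|| = 1" if "integral r" for r i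
    using integralD [OF that, of i] by (simp add: less_le)
  have "(\<forall>i. ||pcoeff p i|| \<le> 1 \<and> ||pcoeff q i|| \<le> 1) \<longleftrightarrow> integral p \<and> integral q"
    unfolding integral_def by blast
  then show ?thesis
    unfolding normalized_at_def coeff_pcoeff integers_at_iff max_ideal_at_iff using unit by auto
qed

text \<open>
  Divide by a coefficient of the largest absolute value.
\<close>

lemma normalized_multiple:
  assumes "p \<noteq> 0 \<or> q \<noteq> 0"
  obtains c where "c \<noteq> 0" "normalized_at v (pcoeff (Polynomial.smult c p)) (pcoeff (Polynomial.smult c q))"
proof -
  define C where "C = pcoeff p ` {..pdeg p} \<union> pcoeff q ` {..pdeg q}"
  define M where "M = Max (place_abs v ` C)"
  have fin: "finite (place_abs v ` C)" "C \<noteq> {}" by (auto simp: C_def)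
  then have "M \<in> place_abs v ` C" unfolding M_def by (intro Max_in) auto
  then obtain x where x: "x \<in> C" "||x|| = M" by auto
  have max: "||y|| \<le> ||x||" if "y \<in> C" for y
    unfolding x(2) M_def using fin that by (intro Max_ge) auto
  have lead: "Polynomial.lead_coeff p \<in> C" "Polynomial.lead_coeff q \<in> C" by (auto simp: C_def)
  have x0: "x \<noteq> 0" using max [OF lead(1)] max [OF lead(2)] assms by auto
  have le: "||pcoeff p i|| \<le> ||x||" "||pcoeff q i|| \<le> ||x||" for i
    using max [of "pcoeff p i"] max [of "pcoeff q i"] by (cases "i \<le> pdeg p"; cases "i \<le> pdeg q"; force simp: C_def coeff_eq_0)+
  have "normalized_at v (pcoeff (Polynomial.smult (inverse x) p)) (pcoeff (Polynomial.smult (inverse x) q))"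
    unfolding normalized_at_iff integral_def
    using le x(1) x0 by (auto simp: vabs_mult vabs_inverse vabs_divide C_def divide_simps)
  then show ?thesis using that [of "inverse x"] x0 by simp
qed

text \<open>
  The representative that the definition of \<open>red\<close> chooses is a multiple of the given one.
\<close>

lemma red_choice:
  assumes cop: "coprime_polys as_ring (pcoeff p) (pcoeff q)"
  obtains c p' q' where "c \<noteq> 0" "p' = Polynomial.smult c p" "q' = Polynomial.smult c q"
    "coprime_polys as_ring (pcoeff p') (pcoeff q')"
    "fraction as_ring (pcoeff p) (pcoeff q) = fraction as_ring (pcoeff p') (pcoeff q')"
    "normalized_at v (pcoeff p') (pcoeff q')"
    "red v (fraction as_ring (pcoeff p) (pcoeff q)) = fraction (residue_field v) (red_poly p') (red_poly q')"
proof -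
  let ?\<phi> = "fraction as_ring (pcoeff p) (pcoeff q)"
  let ?Q = "\<lambda>(f, g). (f, g) \<in> ?\<phi> \<and> coprime_polys as_ring f g \<and> normalized_at v f g"
  have nz: "p \<noteq> 0 \<or> q \<noteq> 0"
    using K.coprime_polys_nonzero [OF cop] by (auto simp: pcoeff_zero)
  obtain c where c: "c \<noteq> 0" "normalized_at v (pcoeff (Polynomial.smult c p)) (pcoeff (Polynomial.smult c q))"
    using normalized_multiple [OF nz] .
  have cop': "coprime_polys as_ring (pcoeff (Polynomial.smult c p)) (pcoeff (Polynomial.smult c q))"
    unfolding pcoeff_smult using c by (intro K.coprime_polys_smult cop) auto
  have "fraction as_ring (pcoeff (Polynomial.smult c p)) (pcoeff (Polynomial.smult c q)) = ?\<phi>"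
    unfolding pcoeff_smult using c by (intro K.fraction_smult) auto
  then have "(pcoeff (Polynomial.smult c p), pcoeff (Polynomial.smult c q)) \<in> ?\<phi>"
    using K.fraction_self [OF _ _ K.coprime_polys_nonzero [OF cop']] by simp
  then have "?Q (SOME x. ?Q x)"
    using c cop' by (intro someI [of ?Q "(pcoeff (Polynomial.smult c p), pcoeff (Polynomial.smult c q))"]) auto
  then obtain f g where fg: "(SOME x. ?Q x) = (f, g)" "(f, g) \<in> ?\<phi>" "coprime_polys as_ring f g" "normalized_at v f g"
    by (cases "SOME x. ?Q x") auto
  obtain t where t: "t \<noteq> 0" "f = t \<odot>\<^bsub>UP as_ring\<^esub> pcoeff p" "g = t \<odot>\<^bsub>UP as_ring\<^esub> pcoeff q"
    using K.coprime_representatives [OF cop fg(3)] fg(2) by (auto simp: K.fraction_iff)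
  have f: "f = pcoeff (Polynomial.smult t p)" "g = pcoeff (Polynomial.smult t q)"
    using t by (simp_all add: pcoeff_smult)
  have "red v ?\<phi> = fraction (residue_field v) (red_poly (Polynomial.smult t p)) (red_poly (Polynomial.smult t q))"
    unfolding red_def fg(1) by (simp add: f reduce_poly_pcoeff)
  then show ?thesis
    using that [OF t(1) refl refl] fg f K.fraction_eq_of_coprime_mem [OF cop fg(3,2)] by simp
qed

text \<open>
  Good reduction, stated for a representative: the reduced polynomials are coprime and still have degree
  \<open>n\<close>.
\<close>

definition good_model :: "nat \<Rightarrow> 'k poly \<Rightarrow> 'k poly \<Rightarrow> bool" where
  "good_model n p q \<longleftrightarrow> integral p \<and> integral q \<and> pdeg p \<le> n \<and> pdeg q \<le> n \<and>
     coprime_polys (residue_field v) (red_poly p) (red_poly q) \<and>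
     max (deg (residue_field v) (red_poly p)) (deg (residue_field v) (red_poly q)) = n"

lemma good_modelI:
  assumes good: "good_reduction v (fraction as_ring (pcoeff p) (pcoeff q))"
    and cop: "coprime_polys as_ring (pcoeff p) (pcoeff q)" and norm: "normalized_at v (pcoeff p) (pcoeff q)"
    and red: "red v (fraction as_ring (pcoeff p) (pcoeff q)) = fraction (residue_field v) (red_poly p) (red_poly q)"
  shows "good_model (max (pdeg p) (pdeg q)) p q"
proof -
  let ?n = "max (pdeg p) (pdeg q)"
  have int: "integral p" "integral q" using norm by (auto simp: normalized_at_iff)
  obtain i where "||pcoeff p i|| = 1 \<or> ||pcoeff q i|| = 1" using norm by (auto simp: normalized_at_iff)
  then have "red_poly p i \<noteq> \<zero>\<^bsub>residue_field v\<^esub> \<or> red_poly q i \<noteq> \<zero>\<^bsub>residue_field v\<^esub>"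
    using int by (auto simp: red_poly_def residue_eq_zero_iff)
  then have nz: "red_poly p \<noteq> \<zero>\<^bsub>UP (residue_field v)\<^esub> \<or> red_poly q \<noteq> \<zero>\<^bsub>UP (residue_field v)\<^esub>"
    by (auto simp: UP_def)
  have "ratfun_degree (residue_field v) (fraction (residue_field v) (red_poly p) (red_poly q)) = ?n"
    using good K.ratfun_degree_fraction [OF cop] red by (simp add: good_reduction_def)
  then show ?thesis
    using k.coprime_of_degree [OF red_poly_closed red_poly_closed nz, of ?n] int
      deg_rp_le [OF int(1)] deg_rp_le [OF int(2)] by (simp add: good_model_def le_max_iff_disj)
qed

text \<open>
  The Bezout identity of the reduced polynomials lifts to one that holds modulo the maximal ideal.
\<close>

lemma norm_good_model:
  assumes "good_model n p q" "n > 0"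
  shows "max ||hom_eval n p x y|| ||hom_eval n q x y|| = max ||x|| ||y|| ^ n"
proof -
  have int: "integral p" "integral q" and deg: "pdeg p \<le> n" "pdeg q \<le> n"
    and cop: "coprime_polys (residue_field v) (red_poly p) (red_poly q)"
    and max: "max (deg (residue_field v) (red_poly p)) (deg (residue_field v) (red_poly q)) = n"
    using assms(1) by (auto simp: good_model_def)
  obtain A' B' where AB': "A' \<in> carrier (UP (residue_field v))" "B' \<in> carrier (UP (residue_field v))"
    "A' \<otimes>\<^bsub>UP (residue_field v)\<^esub> red_poly p \<oplus>\<^bsub>UP (residue_field v)\<^esub> B' \<otimes>\<^bsub>UP (residue_field v)\<^esub> red_poly q = \<one>\<^bsub>UP (residue_field v)\<^esub>"
    using cop by (auto simp: k.coprime_polys_iff_bezout)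
  obtain A B where AB: "integral A" "integral B" "A' = red_poly A" "B' = red_poly B"
    using red_poly_surj AB' by metis
  have "red_poly (A * p + B * q) = red_poly 1"
    using AB' AB int by (simp add: red_poly_add red_poly_mult red_poly_one integral_mult)
  then have bez: "||pcoeff (A * p + B * q - 1) i|| < 1" for i
    using red_poly_eq_iff [of "A * p + B * q" 1] AB int by (simp add: integral_add integral_mult)
  have top: "||pcoeff p n|| = 1 \<or> ||pcoeff q n|| = 1"
  proof (rule ccontr)
    assume "\<not> ?thesis"
    then have "||pcoeff p n|| < 1" "||pcoeff q n|| < 1" using int by (auto simp: less_le)
    then have "up_ring.coeff (UP (residue_field v)) (red_poly p) n = \<zero>\<^bsub>residue_field v\<^esub>"
      "up_ring.coeff (UP (residue_field v)) (red_poly q) n = \<zero>\<^bsub>residue_field v\<^esub>"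
      using int by (simp_all add: residue_eq_zero_iff)
    then show False using max assms(2) k.lcoeff_nonzero_deg [of "red_poly p"] k.lcoeff_nonzero_deg [of "red_poly q"] int
      by (auto simp: max_def split: if_splits)
  qed
  show ?thesis
    by (rule norm_hom_eval [of p q A B n x y]) (use int AB bez deg top assms(2) in auto)
qed

end

section \<open>Conjugations and their reductions\<close>

context finite_place
begin

interpretation K: UP_field "as_ring :: 'k ring" "UP as_ring"
  by (rule UP_field.intro [OF field_as_ring])

interpretation k: UP_field "residue_field v" "UP (residue_field v)"
  by (rule UP_field.intro [OF field_residue_field])

text \<open>
  \<open>p / q\<close> is a representative of \<open>\<phi>\<close> from which the reduction can be computed.
\<close>

definition normalized_model :: "'k ratfun \<Rightarrow> 'k poly \<Rightarrow> 'k poly \<Rightarrow> bool" where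
  "normalized_model \<phi> p q \<longleftrightarrow> \<phi> = fraction as_ring (pcoeff p) (pcoeff q) \<and>
     coprime_polys as_ring (pcoeff p) (pcoeff q) \<and> normalized_at v (pcoeff p) (pcoeff q) \<and>
     red v \<phi> = fraction (residue_field v) (red_poly p) (red_poly q)"

lemma normalized_model_exists:
  assumes "\<phi> \<in> rational_functions as_ring"
  obtains p q where "normalized_model \<phi> p q"
proof -
  obtain p q where pq: "\<phi> = fraction as_ring (pcoeff p) (pcoeff q)" "coprime_polys as_ring (pcoeff p) (pcoeff q)"
    using rational_functions_as_ring [OF assms] .
  show ?thesis
    by (rule red_choice [OF pq(2)]) (rule that, simp add: normalized_model_def pq(1))
qed

lemma normalized_model_degree:
  "normalized_model \<phi> p q \<Longrightarrow> ratfun_degree as_ring \<phi> = max (pdeg p) (pdeg q)"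
  using K.ratfun_degree_fraction by (auto simp: normalized_model_def)

lemma normalized_model_good:
  "normalized_model \<phi> p q \<Longrightarrow> good_reduction v \<phi> \<Longrightarrow> good_model (max (pdeg p) (pdeg q)) p q"
  by (auto simp: normalized_model_def intro: good_modelI)

lemma mobius_model:
  assumes "f \<in> carrier (PGL2 as_ring)"
  obtains a b c e where "f = mobius as_ring a b c e" "a * e - b * c \<noteq> 0"
    "||a|| \<le> 1" "||b|| \<le> 1" "||c|| \<le> 1" "||e|| \<le> 1" "||a|| = 1 \<or> ||b|| = 1 \<or> ||c|| = 1 \<or> ||e|| = 1"
    "red v f = mobius (residue_field v) (residue v a) (residue v b) (residue v c) (residue v e)"
proof -
  obtain a0 b0 c0 e0 where f: "f = mobius as_ring a0 b0 c0 e0" and det: "a0 * e0 - b0 * c0 \<noteq> 0"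
    using assms by (auto simp: K.carrier_PGL2)
  have f': "f = fraction as_ring (pcoeff [:b0, a0:]) (pcoeff [:e0, c0:])"
    by (simp only: f K.mobius_eq_fraction lin_as_ring)
  have cop: "coprime_polys as_ring (pcoeff [:b0, a0:]) (pcoeff [:e0, c0:])"
    using K.coprime_polys_lin [of a0 b0 c0 e0] det by (simp only: lin_as_ring det2_as_ring as_ring_simps UNIV_I simp_thms not_False_eq_True)
  obtain t p' q' where t: "t \<noteq> 0" "p' = Polynomial.smult t [:b0, a0:]" "q' = Polynomial.smult t [:e0, c0:]"
    and fr: "f = fraction as_ring (pcoeff p') (pcoeff q')"
    and norm: "normalized_at v (pcoeff p') (pcoeff q')"
    and red: "red v f = fraction (residue_field v) (red_poly p') (red_poly q')"
    by (rule red_choice [OF cop]) (simp only: f')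
  define a b c e where "a = t * a0" and "b = t * b0" and "c = t * c0" and "e = t * e0"
  have p': "p' = [:b, a:]" "q' = [:e, c:]" by (simp_all add: t a_def b_def c_def e_def)
  have int: "||a|| \<le> 1" "||b|| \<le> 1" "||c|| \<le> 1" "||e|| \<le> 1"
    using norm by (auto simp: normalized_at_iff p')
  obtain i where "||pcoeff p' i|| = 1 \<or> ||pcoeff q' i|| = 1" using norm by (auto simp: normalized_at_iff)
  then have unit: "||a|| = 1 \<or> ||b|| = 1 \<or> ||c|| = 1 \<or> ||e|| = 1"
    by (auto simp: p' coeff_pCons split: nat.splits)
  have "a * e - b * c = t * t * (a0 * e0 - b0 * c0)" by (simp add: a_def b_def c_def e_def algebra_simps)
  then have "a * e - b * c \<noteq> 0" using t(1) det by simp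
  moreover have "f = mobius as_ring a b c e"
    unfolding fr p' by (simp only: K.mobius_eq_fraction lin_as_ring)
  moreover have "red v f = mobius (residue_field v) (residue v a) (residue v b) (residue v c) (residue v e)"
    unfolding red p' k.mobius_eq_fraction using int by (simp add: red_poly_linear)
  ultimately show ?thesis using that int unit by blast
qed

text \<open>
  What is true of the normalized matrix of a conjugating map: reduction preserves its invertibility, and \<open>t\<close> is the
  constant of the conjugation identity.
\<close>

definition unit_conj where
  "unit_conj n p q p' q' a b c e t \<longleftrightarrow>
    ||a|| \<le> 1 \<and> ||b|| \<le> 1 \<and> ||c|| \<le> 1 \<and> ||e|| \<le> 1 \<and> ||a * e - b * c|| = 1 \<and> t \<noteq> 0 \<and>
    conj_poly n p q p' q' a b c e t"

lemma unit_conjD: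
  assumes "unit_conj n p q p' q' a b c e t"
  shows "||a|| \<le> 1" "||b|| \<le> 1" "||c|| \<le> 1" "||e|| \<le> 1" "||a * e - b * c|| = 1" "t \<noteq> 0"
    "conj_poly n p q p' q' a b c e t"
  using assms by (auto simp: unit_conj_def)

end

text \<open>
  By \<open>conj_det_unit\<close> the reduced matrix is invertible and the constant \<open>t\<close> of the conjugation identity has a nonzero
  residue. The identity has integral coefficients, and reducing them gives the corresponding identity
  over the residue field.
\<close>

lemma (in finite_place_char_0) reduce_conjugation:
  assumes \<phi>: "normalized_model \<phi> p q" and \<psi>: "normalized_model \<psi> p' q'"
    and good: "good_model n p q" "good_model n p' q'"
    and n: "n \<ge> 2" "max (pdeg p) (pdeg q) = n" "max (pdeg p') (pdeg q') = n"
    and f: "f \<in> Conj as_ring \<phi> \<psi>"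
  obtains a b c e t where "f = mobius as_ring a b c e"
    "unit_conj n p q p' q' a b c e t"
    "red v f = mobius (residue_field v) (residue v a) (residue v b) (residue v c) (residue v e)"
    "good_reduction v f" "red v f \<in> Conj (residue_field v) (red v \<phi>) (red v \<psi>)"
proof -
  interpret K: UP_field "as_ring :: 'k ring" "UP as_ring"
    by (rule UP_field.intro [OF field_as_ring])
  interpret k: UP_field "residue_field v" "UP (residue_field v)"
    by (rule UP_field.intro [OF field_residue_field])
  have "f \<in> carrier (PGL2 as_ring)" using f by (simp add: Conj_def)
  then obtain a b c e where fm: "f = mobius as_ring a b c e" and det: "a * e - b * c \<noteq> 0"
    and int: "||a|| \<le> 1" "||b|| \<le> 1" "||c|| \<le> 1" "||e|| \<le> 1"
    and unit: "||a|| = 1 \<or> ||b|| = 1 \<or> ||c|| = 1 \<or> ||e|| = 1"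
    and redf: "red v f = mobius (residue_field v) (residue v a) (residue v b) (residue v c) (residue v e)"
    by (rule mobius_model)
  have fr: "\<phi> = fraction as_ring (pcoeff p) (pcoeff q)" "\<psi> = fraction as_ring (pcoeff p') (pcoeff q')"
    and cop: "coprime_polys as_ring (pcoeff p) (pcoeff q)" "coprime_polys as_ring (pcoeff p') (pcoeff q')"
    and red: "red v \<phi> = fraction (residue_field v) (red_poly p) (red_poly q)" "red v \<psi> = fraction (residue_field v) (red_poly p') (red_poly q')"
    using \<phi> \<psi> by (auto simp: normalized_model_def)
  have pol: "integral p" "integral q" "integral p'" "integral q'"
    "pdeg p \<le> n" "pdeg q \<le> n" "pdeg p' \<le> n" "pdeg q' \<le> n"
    using good by (auto simp: good_model_def)
  obtain t where t: "t \<noteq> 0"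
    "hom_subst as_ring n (a \<odot>\<^bsub>UP as_ring\<^esub> pcoeff p \<oplus>\<^bsub>UP as_ring\<^esub> b \<odot>\<^bsub>UP as_ring\<^esub> pcoeff q)
       (K.lin e (\<ominus>\<^bsub>as_ring\<^esub> b)) (K.lin (\<ominus>\<^bsub>as_ring\<^esub> c) a) = t \<odot>\<^bsub>UP as_ring\<^esub> pcoeff p'"
    "hom_subst as_ring n (c \<odot>\<^bsub>UP as_ring\<^esub> pcoeff p \<oplus>\<^bsub>UP as_ring\<^esub> e \<odot>\<^bsub>UP as_ring\<^esub> pcoeff q)
       (K.lin e (\<ominus>\<^bsub>as_ring\<^esub> b)) (K.lin (\<ominus>\<^bsub>as_ring\<^esub> c) a) = t \<odot>\<^bsub>UP as_ring\<^esub> pcoeff q'"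
    by (rule K.Conj_mobius_D [of a b c e "pcoeff p" "pcoeff q" n "pcoeff p'" "pcoeff q'"])
      (use f n det cop in \<open>simp_all add: fm fr\<close>)
  have conj: "conj_poly n p q p' q' a b c e t"
    using t(2,3) unfolding conj_poly_def a_inv_as_ring lin_as_ring pcoeff_smult [symmetric] pcoeff_add [symmetric]
      pcoeff_hom_comp coeff_inject by blast
  have "||a * e - b * c|| = 1" "||t|| = 1"
    using conj_det_unit [OF norm_good_model [OF good(1)] norm_good_model [OF good(2)]
        conj_eval_of_conj_poly [OF conj pol(7,8)] n(1) int unit det] n(1) by simp_all
  note units = this
  have M: "residue v a \<in> carrier (residue_field v)" "residue v b \<in> carrier (residue_field v)"
    "residue v c \<in> carrier (residue_field v)" "residue v e \<in> carrier (residue_field v)"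
    "k.det2 (residue v a) (residue v b) (residue v c) (residue v e) \<noteq> \<zero>\<^bsub>residue_field v\<^esub>"
    using int units(1) by (simp_all add: residue_det2 residue_eq_zero_iff)
  have "ratfun_degree (residue_field v) (red v f) = 1"
    unfolding redf k.mobius_eq_fraction
    using k.ratfun_degree_fraction [OF k.coprime_polys_lin [OF M]] k.deg_mobius [OF M] by simp
  moreover have "ratfun_degree as_ring f = 1"
    unfolding fm K.mobius_eq_fraction
    using K.ratfun_degree_fraction [OF K.coprime_polys_lin [of a b c e]] K.deg_mobius [of a b c e] det by simp
  ultimately have gf: "good_reduction v f" by (simp add: good_reduction_def)
  have subst: "hom_subst (residue_field v) n
      (residue v x \<odot>\<^bsub>UP (residue_field v)\<^esub> red_poly p \<oplus>\<^bsub>UP (residue_field v)\<^esub> residue v y \<odot>\<^bsub>UP (residue_field v)\<^esub> red_poly q)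
      (k.lin (residue v e) (\<ominus>\<^bsub>residue_field v\<^esub> residue v b)) (k.lin (\<ominus>\<^bsub>residue_field v\<^esub> residue v c) (residue v a)) =
      red_poly (hom_comp n (Polynomial.smult x p + Polynomial.smult y q) [:-b, e:] [:a, -c:])"
    if "||x|| \<le> 1" "||y|| \<le> 1" for x y
    using that int pol(1,2)
    by (simp add: red_poly_hom_comp integral_add integral_smult red_poly_add red_poly_smult red_poly_linear residue_uminus)
  have "mobius (residue_field v) (residue v a) (residue v b) (residue v c) (residue v e) \<in>
      Conj (residue_field v) (fraction (residue_field v) (red_poly p) (red_poly q)) (fraction (residue_field v) (red_poly p') (red_poly q'))"
  proof (rule k.Conj_mobius_I [OF M])
    show "coprime_polys (residue_field v) (red_poly p) (red_poly q)"
      "n = max (deg (residue_field v) (red_poly p)) (deg (residue_field v) (red_poly q))"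
      using good(1) by (auto simp: good_model_def)
    show "residue v t \<in> carrier (residue_field v)" "residue v t \<noteq> \<zero>\<^bsub>residue_field v\<^esub>"
      using units(2) by (simp_all add: residue_eq_zero_iff)
  qed (use pol conj units int in \<open>simp_all add: subst conj_poly_def red_poly_smult\<close>)
  then have "red v f \<in> Conj (residue_field v) (red v \<phi>) (red v \<psi>)" by (simp only: redf red)
  moreover have "unit_conj n p q p' q' a b c e t"
    using int units t(1) conj by (simp add: unit_conj_def)
  ultimately show ?thesis using that fm redf gf by blast
qed

text \<open>
  If the two maps have the same reduction, then \<open>S = adj(M') M\<close> is congruent to a scalar. If \<open>S\<close> is a scalar, then
  \<open>M\<close> and \<open>M'\<close> are proportional; otherwise \<open>v\<close> divides an exceptional prime.
\<close>

lemma (in finite_place_char_0) conjugations_equal: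
  assumes nf: "number_field TYPE('k)" and n: "n \<ge> 2"
    and cop: "A * p + B * q = 1" and deg: "max (pdeg p) (pdeg q) = n" "max (pdeg p') (pdeg q') = n"
    and exc: "\<And>r. r \<in> exceptional_primes TYPE('k) n \<Longrightarrow> \<not> divides_prime v r"
    and conj: "unit_conj n p q p' q' a b c e t" "unit_conj n p q p' q' a' b' c' e' t'"
    and eq: "mobius (residue_field v) (residue v a) (residue v b) (residue v c) (residue v e) =
      mobius (residue_field v) (residue v a') (residue v b') (residue v c') (residue v e')"
  shows "mobius as_ring a b c e = mobius as_ring a' b' c' e'"
proof -
  note M = unit_conjD [OF conj(1)] and M' = unit_conjD [OF conj(2)]
  interpret K: UP_field "as_ring :: 'k ring" "UP as_ring"
    by (rule UP_field.intro [OF field_as_ring])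
  interpret k: UP_field "residue_field v" "UP (residue_field v)"
    by (rule UP_field.intro [OF field_residue_field])
  define \<delta> \<delta>' where "\<delta> = a * e - b * c" and "\<delta>' = a' * e' - b' * c'"
  have \<delta>: "||\<delta>|| = 1" "\<delta> \<noteq> 0" "||\<delta>'|| = 1" "\<delta>' \<noteq> 0" using M(5) M'(5) by (auto simp: \<delta>_def \<delta>'_def)
  obtain \<tau> where \<tau>: "\<tau> \<in> carrier (residue_field v)" "\<tau> \<noteq> \<zero>\<^bsub>residue_field v\<^esub>"
    "residue v a' = \<tau> \<otimes>\<^bsub>residue_field v\<^esub> residue v a" "residue v b' = \<tau> \<otimes>\<^bsub>residue_field v\<^esub> residue v b"
    "residue v c' = \<tau> \<otimes>\<^bsub>residue_field v\<^esub> residue v c" "residue v e' = \<tau> \<otimes>\<^bsub>residue_field v\<^esub> residue v e"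
    by (rule k.mobius_eqD [OF _ _ _ _ _ _ _ _ _ _ eq])
      (use M M' in \<open>simp_all add: residue_det2 residue_eq_zero_iff\<close>)
  obtain u where u: "||u|| \<le> 1" "\<tau> = residue v u" using residue_surj [OF \<tau>(1)] .
  have u1: "||u|| = 1" using \<tau>(2) u by (simp add: residue_eq_zero_iff)
  have close: "||x' - u * x|| < 1"
    if "||x|| \<le> 1" "||x'|| \<le> 1" "residue v x' = \<tau> \<otimes>\<^bsub>residue_field v\<^esub> residue v x" for x x'
    using that u residue_eq_iff [of x' "u * x"] by (simp add: residue_mult [symmetric] vabs_mult mult_le_one)
  note cl = close [OF M(1) M'(1) \<tau>(3)] close [OF M(2) M'(2) \<tau>(4)] close [OF M(3) M'(3) \<tau>(5)] close [OF M(4) M'(4) \<tau>(6)]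
  have comb: "||(x' * r - y' * s) - u * (x * r - y * s)|| < 1"
    if "||x' - u * x|| < 1" "||y' - u * y|| < 1" "||r|| \<le> 1" "||s|| \<le> 1" for x x' y y' r s
  proof -
    have "(x' * r - y' * s) - u * (x * r - y * s) = (x' - u * x) * r - (y' - u * y) * s"
      by (simp add: algebra_simps)
    moreover have "||(x' - u * x) * r|| < 1" "||(y' - u * y) * s|| < 1"
      using that by (metis mult_left_le order_le_less_trans vabs_mult vabs_nonneg)+
    ultimately show ?thesis using vabs_diff_le by (metis max_less_iff_conj order_le_less_trans)
  qed
  define s11 s12 s21 s22 where "s11 = e' * a - b' * c" and "s12 = e' * b - b' * e"
    and "s21 = a' * c - c' * a" and "s22 = a' * e - c' * b"
  have s: "||s11 - u * \<delta>|| < 1" "||s12|| < 1" "||s21|| < 1" "||s22 - u * \<delta>|| < 1"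
    using comb [OF cl(4) cl(2) M(1) M(3)] comb [OF cl(4) cl(2) M(2) M(4)]
      comb [OF cl(1) cl(3) M(3) M(1)] comb [OF cl(1) cl(3) M(4) M(2)]
    by (simp_all add: s11_def s12_def s21_def s22_def \<delta>_def mult.commute)
  have detS: "s11 * s22 - s12 * s21 = \<delta> * \<delta>'"
    by (simp add: s11_def s12_def s21_def s22_def \<delta>_def \<delta>'_def algebra_simps)
  show ?thesis
  proof (cases "s12 = 0 \<and> s21 = 0 \<and> s11 = s22")
    case True
    \<comment> \<open>\<open>M' S = \<delta>' M\<close>\<close>
    have "a' * s11 + b' * s21 = \<delta>' * a" "a' * s12 + b' * s22 = \<delta>' * b"
      "c' * s11 + e' * s21 = \<delta>' * c" "c' * s12 + e' * s22 = \<delta>' * e"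
      by (simp_all add: s11_def s12_def s21_def s22_def \<delta>'_def algebra_simps)
    then have eqs: "\<delta>' * a = s11 * a'" "\<delta>' * b = s11 * b'" "\<delta>' * c = s11 * c'" "\<delta>' * e = s11 * e'"
      using True by (simp_all add: mult.commute)
    have "s11 \<noteq> 0" using detS \<delta> True by auto
    have "mobius as_ring a b c e = mobius as_ring (\<delta>' * a) (\<delta>' * b) (\<delta>' * c) (\<delta>' * e)"
      using K.mobius_smult [of \<delta>' a b c e] \<delta> by simp
    also have "\<dots> = mobius as_ring a' b' c' e'"
      unfolding eqs using K.mobius_smult [of s11 a' b' c' e'] \<open>s11 \<noteq> 0\<close> by simp
    finally show ?thesis .
  next
    case False
    let ?p = "ac_poly p" and ?q = "ac_poly q"
    have deg': "pdeg (ac_poly p') \<le> n" "pdeg (ac_poly q') \<le> n" using deg by auto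
    obtain \<mu> where \<mu>: "\<mu> \<noteq> 0" "commutes_eval n ?p ?q (to_ac s11) (to_ac s12) (to_ac s21) (to_ac s22) \<mu>"
    proof (rule commutes_of_conj_eval [OF conj_eval_of_conj_poly [OF conj_poly_ac [OF M(7)] deg']
          conj_eval_of_conj_poly [OF conj_poly_ac [OF M'(7)] deg']])
      show "to_ac a * to_ac e - to_ac b * to_ac c \<noteq> 0" "to_ac a' * to_ac e' - to_ac b' * to_ac c' \<noteq> 0"
        using \<delta> unfolding \<delta>_def \<delta>'_def by (simp_all flip: to_ac_mult to_ac_diff)
    qed (use M(6) M'(6) in \<open>simp_all add: s11_def s12_def s21_def s22_def that\<close>)
    have "ac_poly (A * p + B * q) = 1" by (simp add: cop)
    then have cop': "ac_poly A * ?p + ac_poly B * ?q = 1" by simp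
    have nz: "hom_eval n ?p x y \<noteq> 0 \<or> hom_eval n ?q x y \<noteq> 0" if "x \<noteq> 0 \<or> y \<noteq> 0" for x y
      using no_common_zero [OF cop' _ that] deg by simp
    have det': "to_ac s11 * to_ac s22 - to_ac s12 * to_ac s21 = to_ac (\<delta> * \<delta>')"
      by (simp flip: to_ac_mult to_ac_diff add: detS)
    obtain \<alpha> \<beta> N where ab: "\<alpha> \<noteq> \<beta>" "\<alpha> + \<beta> = to_ac s11 + to_ac s22"
      "\<alpha> * \<beta> = to_ac s11 * to_ac s22 - to_ac s12 * to_ac s21" "N \<in> {n - 1, n, n + 1}" "\<alpha> ^ N = \<beta> ^ N"
      by (rule automorphism_finite_order [OF \<mu>(2) n nz]) (use False \<mu>(1) det' \<delta> in auto)
    have "||2|| = 1"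
    proof -
      have "\<not> 0 < v 2" using exc [of 2] by (simp add: exceptional_primes_def divides_prime_def)
      then have "\<not> ||2|| < 1" using vabs_less_1_iff [of 2] by simp
      then show ?thesis using vabs_of_nat_le [of 2] by simp
    qed
    have s11: "||s11|| = 1"
      using vabs_add_dominant [of "s11 - u * \<delta>" "u * \<delta>"] s(1) u1 \<delta> by (simp add: vabs_mult)
    have diff: "||s22 - s11|| < 1"
      using vabs_diff_le [of "s22 - u * \<delta>" "s11 - u * \<delta>"] s(1,4) by simp
    have cong1: "||(s11 + s22) - 2 * s11|| < 1" using diff by (simp add: algebra_simps)
    have cong2: "||(s11 * s22 - s12 * s21) - s11\<^sup>2|| < 1"
    proof -
      have "(s11 * s22 - s12 * s21) - s11\<^sup>2 = s11 * (s22 - s11) - s12 * s21"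
        by (simp add: algebra_simps power2_eq_square)
      moreover have "||s11 * (s22 - s11)|| < 1" using diff s11 by (simp add: vabs_mult)
      moreover have "||s12 * s21|| < 1"
        using s(2,3) by (metis less_imp_le mult_left_le order_le_less_trans vabs_mult vabs_nonneg)
      ultimately show ?thesis using vabs_diff_le by (metis max_less_iff_conj order_le_less_trans)
    qed
    have N: "N > 0" using ab(4) n by auto
    obtain m w where mw: "prime (2 * m + 1)" "(2 * m + 1) dvd N" "||w|| < 1"
      "(\<Sum>i\<le>m. of_nat ((2 * m + 1) choose (2 * i + 1)) * w ^ i) = 0"
      by (rule eisenstein_of_finite_order [OF s11 \<open>||2|| = 1\<close> cong1 cong2 _ _ ab(1) ab(5) N])
        (use ab(2,3) in simp_all)
    note eis = eisenstein_norm [OF mw(1,3,4)]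
    have "m dvd degree_over_rat TYPE('k)"
    proof (rule degree_dvd_of_power_basis [OF nf eis(3)])
      show "c i = 0" if "(\<Sum>i<m. of_rat (c i) * w ^ i) = 0" "i < m" for c i
        using eisenstein_powers_independent [OF mw(1) eis(1) eis(2) eis(3) that] .
      have "(\<Sum>i<m. of_nat ((2 * m + 1) choose (2 * i + 1)) * w ^ i) + w ^ m = 0"
        using mw(4) by (simp only: lessThan_Suc_atMost [symmetric] sum.lessThan_Suc binomial_n_n of_nat_1 mult_1)
      then have "w ^ m = - (\<Sum>i<m. of_nat ((2 * m + 1) choose (2 * i + 1)) * w ^ i)"
        by (rule minus_unique [symmetric])
      then show "w ^ m = (\<Sum>i<m. of_rat (- of_nat ((2 * m + 1) choose (2 * i + 1))) * w ^ i)"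
        by (simp only: of_rat_minus of_rat_of_nat_eq mult_minus_left sum_negf)
    qed
    moreover have "(2 * m + 1) dvd n * (n\<^sup>2 - 1)"
    proof -
      have "N dvd n * (n\<^sup>2 - 1)"
      proof -
        have "n\<^sup>2 - 1 = (n - 1) * (n + 1)"
          using n by (cases n) (simp_all add: power2_eq_square)
        then show ?thesis using ab(4)
          by (elim insertE emptyE) (simp_all only: dvd_mult dvd_triv_left dvd_triv_right)
      qed
      then show ?thesis using mw(2) dvd_trans by blast
    qed
    ultimately have "2 * m + 1 \<in> exceptional_primes TYPE('k) n"
      using mw(1) by (simp add: exceptional_primes_def)
    then have "\<not> divides_prime v (2 * m + 1)" by (rule exc)
    moreover have "(of_nat (2 * m + 1) :: 'k) \<noteq> 0" by (metis Suc_eq_plus1 of_nat_neq_0)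
    ultimately show ?thesis using eis(1) vabs_less_1_iff unfolding divides_prime_def by blast
  qed
qed

section \<open>The exceptional places and the theorem\<close>

text \<open>
  The Bezout identity can be reduced, so the reduced polynomials are coprime; and the degrees do not drop
  because the leading coefficients are units.
\<close>

lemma (in finite_place) good_reduction_of_unit_coefficients:
  assumes cop: "A * p + B * q = 1" "\<phi> = fraction as_ring (pcoeff p) (pcoeff q)"
    and unit: "\<And>f x. f \<in> {p, q, A, B} \<Longrightarrow> x \<in> set (Polynomial.coeffs f) \<Longrightarrow> x \<noteq> 0 \<Longrightarrow> ||x|| = 1"
  shows "good_reduction v \<phi>"
proof -
  interpret K: UP_field "as_ring :: 'k ring" "UP as_ring"
    by (rule UP_field.intro [OF field_as_ring])
  interpret k: UP_field "residue_field v" "UP (residue_field v)"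
    by (rule UP_field.intro [OF field_residue_field])
  have coeff: "||pcoeff f i|| = (if pcoeff f i = 0 then 0 else 1)" if "f \<in> {p, q, A, B}" for f i
  proof (cases "pcoeff f i = 0")
    case False
    then have "pcoeff f i \<in> set (Polynomial.coeffs f)"
      using le_degree [OF False] by (intro coeff_in_coeffs) auto
    then show ?thesis using unit [OF that] False by auto
  qed simp
  have int: "integral p" "integral q" "integral A" "integral B"
    using coeff by (auto simp: integral_def)
  have cp: "coprime_polys as_ring (pcoeff p) (pcoeff q)" using cop coprime_pcoeff_iff by blast
  obtain t p' q' where t: "t \<noteq> 0" "p' = Polynomial.smult t p" "q' = Polynomial.smult t q"
    and norm: "normalized_at v (pcoeff p') (pcoeff q')"
    and red: "red v \<phi> = fraction (residue_field v) (red_poly p') (red_poly q')"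
    by (rule red_choice [OF cp]) (simp only: cop(2))
  have t1: "||t|| = 1"
  proof -
    obtain i where "||pcoeff p' i|| = 1 \<or> ||pcoeff q' i|| = 1" using norm by (auto simp: normalized_at_iff)
    then show ?thesis using coeff [of p i] coeff [of q i] by (auto simp: t vabs_mult split: if_splits)
  qed
  have red': "red v \<phi> = fraction (residue_field v) (red_poly p) (red_poly q)"
    unfolding red t(2,3) using int t1 by (simp add: red_poly_smult k.fraction_smult residue_eq_zero_iff)
  have "red_poly A \<otimes>\<^bsub>UP (residue_field v)\<^esub> red_poly p \<oplus>\<^bsub>UP (residue_field v)\<^esub> red_poly B \<otimes>\<^bsub>UP (residue_field v)\<^esub> red_poly q = red_poly (A * p + B * q)"
    using int by (simp add: red_poly_add red_poly_mult integral_mult)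
  then have cop': "coprime_polys (residue_field v) (red_poly p) (red_poly q)"
    unfolding k.coprime_polys_iff_bezout cop(1) red_poly_one using int
    by (intro conjI bexI [of _ "red_poly A"] bexI [of _ "red_poly B"]) simp_all
  have deg: "deg (residue_field v) (red_poly f) = pdeg f" if f: "f \<in> {p, q}" for f
  proof (rule antisym)
    have i: "integral f" using f int by auto
    show "deg (residue_field v) (red_poly f) \<le> pdeg f" by (rule deg_rp_le [OF i])
    show "pdeg f \<le> deg (residue_field v) (red_poly f)"
    proof (rule k.deg_belowI)
      assume "pdeg f \<noteq> 0"
      then have "Polynomial.lead_coeff f \<noteq> 0" by auto
      then have "||Polynomial.lead_coeff f|| = 1" using coeff [of f "pdeg f"] f by auto
      then show "up_ring.coeff (UP (residue_field v)) (red_poly f) (pdeg f) \<noteq> \<zero>\<^bsub>residue_field v\<^esub>"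
        using i by (simp add: residue_eq_zero_iff)
    qed (simp add: i)
  qed
  have "ratfun_degree (residue_field v) (red v \<phi>) = max (pdeg p) (pdeg q)"
    unfolding red' k.ratfun_degree_fraction [OF cop'] using deg by simp
  then show ?thesis
    unfolding good_reduction_def cop(2) K.ratfun_degree_fraction [OF cp] deg_pcoeff by simp
qed

lemma finite_bad_reduction:
  assumes nf: "number_field TYPE('k::field_char_0)" and \<phi>: "(\<phi> :: 'k ratfun) \<in> rational_functions as_ring"
  shows "finite {v \<in> finite_places. \<not> good_reduction v \<phi>}"
proof -
  obtain p q where pq: "\<phi> = fraction as_ring (pcoeff p) (pcoeff q)" "coprime_polys as_ring (pcoeff p) (pcoeff q)"
    using rational_functions_as_ring [OF \<phi>] .
  obtain A B where AB: "A * p + B * q = 1" using pq(2) coprime_pcoeff_iff by blast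
  let ?C = "\<Union>f\<in>{p, q, A, B}. set (Polynomial.coeffs f)"
  have "{v \<in> finite_places. \<not> good_reduction v \<phi>} \<subseteq> (\<Union>x\<in>?C. {v \<in> finite_places. x \<noteq> 0 \<and> place_abs v x \<noteq> 1})"
  proof
    fix v assume v: "v \<in> {v \<in> finite_places. \<not> good_reduction v \<phi>}"
    then interpret finite_place v by unfold_locales simp
    show "v \<in> (\<Union>x\<in>?C. {v \<in> finite_places. x \<noteq> 0 \<and> place_abs v x \<noteq> 1})"
      using good_reduction_of_unit_coefficients [OF AB pq(1)] v by blast
  qed
  moreover have "finite (\<Union>x\<in>?C. {v \<in> finite_places. x \<noteq> 0 \<and> place_abs v x \<noteq> 1})"
    using finite_places_nonunit [OF nf] by (intro finite_UN_I) auto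
  ultimately show ?thesis by (rule finite_subset)
qed

lemma finite_exceptional_primes:
  assumes "d \<ge> 2"
  shows "finite (exceptional_primes K d)"
proof -
  have "1 < d\<^sup>2" using assms by (intro one_less_power) auto
  then have "d * (d\<^sup>2 - 1) > 0" using assms by simp
  then have "finite {p. p dvd d * (d\<^sup>2 - 1)}" by (intro finite_divisors_nat)
  then show ?thesis
    unfolding exceptional_primes_def by (rule finite_subset [rotated, of "insert 2 _", OF finite.insertI]) auto
qed

lemma finite_exceptional_places:
  assumes nf: "number_field TYPE('k::field_char_0)" and "(\<phi> :: 'k ratfun) \<in> rational_functions as_ring"
    "\<psi> \<in> rational_functions as_ring" and d: "d \<ge> 2"
  shows "finite (exceptional_places d \<phi> \<psi>)"
proof -
  let ?E = "exceptional_primes TYPE('k) d"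
  have "exceptional_places d \<phi> \<psi> \<subseteq> {v \<in> finite_places. \<not> good_reduction v \<phi>} \<union>
      {v \<in> finite_places. \<not> good_reduction v \<psi>} \<union>
      (\<Union>p\<in>?E. {v \<in> finite_places. (of_nat p :: 'k) \<noteq> 0 \<and> place_abs v (of_nat p :: 'k) \<noteq> 1})"
  proof
    fix v assume v: "v \<in> exceptional_places d \<phi> \<psi>"
    then interpret finite_place v by unfold_locales (simp add: exceptional_places_def)
    have "place_abs v (of_nat p :: 'k) \<noteq> 1" "(of_nat p :: 'k) \<noteq> 0" if "divides_prime v p" for p
    proof -
      show nz: "(of_nat p :: 'k) \<noteq> 0" using that finite_place by (auto simp: divides_prime_def finite_places_def)
      show "place_abs v (of_nat p :: 'k) \<noteq> 1"
        using that vabs_less_1_iff [of "of_nat p"] by (simp add: divides_prime_def)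
    qed
    then show "v \<in> {v \<in> finite_places. \<not> good_reduction v \<phi>} \<union>
      {v \<in> finite_places. \<not> good_reduction v \<psi>} \<union>
      (\<Union>p\<in>?E. {v \<in> finite_places. (of_nat p :: 'k) \<noteq> 0 \<and> place_abs v (of_nat p :: 'k) \<noteq> 1})"
      using v unfolding exceptional_places_def by blast
  qed
  moreover have "finite (\<Union>p\<in>?E. {v \<in> finite_places. (of_nat p :: 'k) \<noteq> 0 \<and> place_abs v (of_nat p :: 'k) \<noteq> 1})"
    by (intro finite_UN_I finite_exceptional_primes [OF d] finite_places_nonunit [OF nf])
  ultimately show ?thesis
    using finite_bad_reduction [OF nf] assms by (meson finite_UnI finite_subset)
qed

theorem corollary4p4:
  fixes \<phi> \<psi> :: "'k::field_char_0 ratfun" and d :: nat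
  assumes "number_field TYPE('k)"
    and "\<phi> \<in> rational_functions as_ring" and "\<psi> \<in> rational_functions as_ring"
    and "ratfun_degree as_ring \<phi> = d" and "ratfun_degree as_ring \<psi> = d" and "d \<ge> 2"
  shows "finite (exceptional_places d \<phi> \<psi>) \<and>
    (Conj as_ring \<phi> \<psi> \<noteq> {} \<longrightarrow>
      (\<forall>v \<in> finite_places - exceptional_places d \<phi> \<psi>.
        (\<forall>f \<in> Conj as_ring \<phi> \<psi>. good_reduction v f) \<and>
        red v \<in> Conj as_ring \<phi> \<psi> \<rightarrow> Conj (residue_field v) (red v \<phi>) (red v \<psi>) \<and>
        inj_on (red v) (Conj as_ring \<phi> \<psi>)))"
proof (intro conjI impI ballI)
  show "finite (exceptional_places d \<phi> \<psi>)" by (rule finite_exceptional_places [OF assms(1-3,6)])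
next
  fix v assume "v \<in> finite_places - exceptional_places d \<phi> \<psi>"
  then have v: "v \<in> finite_places" "good_reduction v \<phi>" "good_reduction v \<psi>"
    and exc: "\<And>r. r \<in> exceptional_primes TYPE('k) d \<Longrightarrow> \<not> divides_prime v r"
    by (auto simp: exceptional_places_def)
  interpret finite_place_char_0 v by unfold_locales (rule v)
  obtain p q where \<phi>: "normalized_model \<phi> p q" using normalized_model_exists [OF assms(2)] .
  obtain p' q' where \<psi>: "normalized_model \<psi> p' q'" using normalized_model_exists [OF assms(3)] .
  have deg: "max (pdeg p) (pdeg q) = d" "max (pdeg p') (pdeg q') = d"
    using normalized_model_degree [OF \<phi>] normalized_model_degree [OF \<psi>] assms by auto
  have good: "good_model d p q" "good_model d p' q'"
    using normalized_model_good [OF \<phi> v(2)] normalized_model_good [OF \<psi> v(3)] deg by auto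
  obtain A B where AB: "A * p + B * q = 1"
    using \<phi> coprime_pcoeff_iff unfolding normalized_model_def by blast
  note reduce = reduce_conjugation [OF \<phi> \<psi> good assms(6) deg]
  show "good_reduction v f" if "f \<in> Conj as_ring \<phi> \<psi>" for f by (rule reduce [OF that])
  show "red v \<in> Conj as_ring \<phi> \<psi> \<rightarrow> Conj (residue_field v) (red v \<phi>) (red v \<psi>)"
  proof
    fix f assume "f \<in> Conj as_ring \<phi> \<psi>"
    then show "red v f \<in> Conj (residue_field v) (red v \<phi>) (red v \<psi>)" by (rule reduce)
  qed
  show "inj_on (red v) (Conj as_ring \<phi> \<psi>)"
  proof (rule inj_onI)
    fix f g assume fg: "f \<in> Conj as_ring \<phi> \<psi>" "g \<in> Conj as_ring \<phi> \<psi>" and eq: "red v f = red v g"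
    obtain a b c e t where f: "f = mobius as_ring a b c e"
      and M: "unit_conj d p q p' q' a b c e t"
      and rf: "red v f = mobius (residue_field v) (residue v a) (residue v b) (residue v c) (residue v e)"
      by (rule reduce [OF fg(1)])
    obtain a' b' c' e' t' where g: "g = mobius as_ring a' b' c' e'"
      and M': "unit_conj d p q p' q' a' b' c' e' t'"
      and rg: "red v g = mobius (residue_field v) (residue v a') (residue v b') (residue v c') (residue v e')"
      by (rule reduce [OF fg(2)])
    show "f = g"
      unfolding f g using conjugations_equal [OF assms(1,6) AB deg exc M M'] eq rf rg by simp
  qed
qed

end
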